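(* Let $F$ be an algebraically closed field of characteristic $0$ and let $A$ be a nonzero finite dimensional Lie or associative algebra over $F$ with an action of a group $G$ by automorphisms and anti-automorphisms. Then $\mathrm{PIexp}^G(A)=\dim A$ if and only if $A$ is $G$-simple.
   Context: Associative algebras $A$ are not assumed unital. An automorphism (anti-automorphism) of $A$ is $\psi\in\mathrm{GL}(A)$ with $\psi(ab)=\psi(a)\psi(b)$ (resp. $\psi(ab)=\psi(b)\psi(a)$) for all $a,b\in A$ (the product being the bracket in the Lie case); an action by automorphisms and anti-automorphisms is a homomorphism from $G$ to the group of all automorphisms and anti-automorphisms of $A$. $A$ is $G$-simple if $A^2\ne0$ and its only $G$-invariant two-sided ideals are $0$ and $A$ (for Lie algebras, $A^2=[A,A]$). $G$-codimensions. If $A$ is associative, let $F\langle X|G\rangle$ be the free associative algebra on free generators $x_j^g$, $j\in\mathbb N$, $g\in G$, and let $P_n^G$ be the linear span of all $x_{\sigma(1)}^{g_1}\cdots x_{\sigma(n)}^{g_n}$, $g_i\in G$, $\sigma\in S_n$. If $A$ is a Lie algebra, replace the free associative algebra by the free Lie algebra on the same generators and $P_n^G$ by the span of all long commutators $[x_{\sigma(1)}^{g_1},\ldots,x_{\sigma(n)}^{g_n}]$. Let $\mathrm{Id}^G(A)$ be the set of elements $f$ of this free algebra vanishing under every substitution $x_j^g\mapsto a_j^g$ with $a_j\in A$, where $a^g$ is the result of the action of $g$ on $a$. Then $c_n^G(A):=\dim\bigl(P_n^G/(P_n^G\cap\mathrm{Id}^G(A))\bigr)$ and $\mathrm{PIexp}^G(A):=\lim_{n\to\infty}\sqrt[n]{c_n^G(A)}$;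 the equality $\mathrm{PIexp}^G(A)=\dim A$ means that the limit exists and equals $\dim A$. *)

theory Defs
  imports
    Complex_Main
    "HOL-Library.Poly_Mapping"
    "HOL-Computational_Algebra.Polynomial"
    "HOL-Combinatorics.Permutations"
    "HOL-Algebra.Group"
begin

section \<open>Algebras, (anti-)automorphisms and \<open>G\<close>-simplicity\<close>

locale nonassoc_algebra = vector_space scale
  for scale :: "'f::field \<Rightarrow> 'a::ab_group_add \<Rightarrow> 'a" +
  fixes mul :: "'a \<Rightarrow> 'a \<Rightarrow> 'a"
  assumes linear_mul_left: "Vector_Spaces.linear scale scale (\<lambda>x. mul x y)"
    and linear_mul_right: "Vector_Spaces.linear scale scale (\<lambda>y. mul x y)"

locale assoc_algebra = nonassoc_algebra +
  assumes mul_assoc: "mul (mul x y) z = mul x (mul y z)"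

locale lie_algebra = nonassoc_algebra +
  assumes mul_self: "mul x x = 0"
    and jacobi: "mul x (mul y z) + mul y (mul z x) + mul z (mul x y) = 0"

definition is_automorphism ::
    "('f::field \<Rightarrow> 'a::ab_group_add \<Rightarrow> 'a) \<Rightarrow> ('a \<Rightarrow> 'a \<Rightarrow> 'a) \<Rightarrow> ('a \<Rightarrow> 'a) \<Rightarrow> bool" where
  "is_automorphism scale mul \<psi> \<longleftrightarrow>
     Vector_Spaces.linear scale scale \<psi> \<and> bij \<psi> \<and> (\<forall>a b. \<psi> (mul a b) = mul (\<psi> a) (\<psi> b))"

definition is_antiautomorphism ::
    "('f::field \<Rightarrow> 'a::ab_group_add \<Rightarrow> 'a) \<Rightarrow> ('a \<Rightarrow> 'a \<Rightarrow> 'a) \<Rightarrow> ('a \<Rightarrow> 'a) \<Rightarrow> bool" where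
  "is_antiautomorphism scale mul \<psi> \<longleftrightarrow>
     Vector_Spaces.linear scale scale \<psi> \<and> bij \<psi> \<and> (\<forall>a b. \<psi> (mul a b) = mul (\<psi> b) (\<psi> a))"

definition aut_antiaut_group ::
    "('f::field \<Rightarrow> 'a::ab_group_add \<Rightarrow> 'a) \<Rightarrow> ('a \<Rightarrow> 'a \<Rightarrow> 'a) \<Rightarrow> ('a \<Rightarrow> 'a) monoid" where
  "aut_antiaut_group scale mul =
     \<lparr>carrier = {\<psi>. is_automorphism scale mul \<psi> \<or> is_antiautomorphism scale mul \<psi>},
      monoid.mult = (\<circ>), one = id\<rparr>"

lemma group_aut_antiaut_group:
  assumes "vector_space scale"
  shows "group (aut_antiaut_group scale mul)"
proof -
  interpret vector_space scale by (rule assms)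
  interpret vp: vector_space_pair scale scale ..
  have lin_id: "Vector_Spaces.linear scale scale id"
    by unfold_locales auto
  have inv_mul: "inv_into UNIV \<psi> (mul a b) = mul (inv_into UNIV \<psi> a) (inv_into UNIV \<psi> b)"
    if "bij \<psi>" "\<forall>a b. \<psi> (mul a b) = mul (\<psi> a) (\<psi> b)" for \<psi> a b
    using that by (metis bij_inv_eq_iff)
  have inv_mul': "inv_into UNIV \<psi> (mul a b) = mul (inv_into UNIV \<psi> b) (inv_into UNIV \<psi> a)"
    if "bij \<psi>" "\<forall>a b. \<psi> (mul a b) = mul (\<psi> b) (\<psi> a)" for \<psi> a b
    using that by (metis bij_inv_eq_iff)
  have lin_inv: "Vector_Spaces.linear scale scale (inv_into UNIV \<psi>)"
    if "Vector_Spaces.linear scale scale \<psi>" "bij \<psi>" for \<psi>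
  proof -
    interpret p: Vector_Spaces.linear scale scale \<psi> by (rule that)
    show ?thesis
    proof unfold_locales
      fix x y c
      show "inv_into UNIV \<psi> (x + y) = inv_into UNIV \<psi> x + inv_into UNIV \<psi> y"
        using that(2) by (metis bij_inv_eq_iff p.add)
      show "inv_into UNIV \<psi> (scale c x) = scale c (inv_into UNIV \<psi> x)"
        using that(2) by (metis bij_inv_eq_iff p.scale)
    qed
  qed
  show ?thesis
  proof (rule groupI)
    fix \<psi> assume "\<psi> \<in> carrier (aut_antiaut_group scale mul)"
    then have "inv_into UNIV \<psi> \<in> carrier (aut_antiaut_group scale mul)" "inv_into UNIV \<psi> \<circ> \<psi> = id"
      by (auto simp: aut_antiaut_group_def is_automorphism_def is_antiautomorphism_def
          lin_inv inv_mul inv_mul' bij_imp_bij_inv bij_is_inj)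
    then show "\<exists>\<psi>'\<in>carrier (aut_antiaut_group scale mul).
        \<psi>' \<otimes>\<^bsub>aut_antiaut_group scale mul\<^esub> \<psi> = \<one>\<^bsub>aut_antiaut_group scale mul\<^esub>"
      by (auto simp: aut_antiaut_group_def)
  qed (auto simp: aut_antiaut_group_def is_automorphism_def is_antiautomorphism_def
      lin_id intro: Vector_Spaces.linear_compose bij_comp)
qed

definition two_sided_ideal ::
    "('f::field \<Rightarrow> 'a::ab_group_add \<Rightarrow> 'a) \<Rightarrow> ('a \<Rightarrow> 'a \<Rightarrow> 'a) \<Rightarrow> 'a set \<Rightarrow> bool" where
  "two_sided_ideal scale mul I \<longleftrightarrow>
     module.subspace scale I \<and> (\<forall>a. \<forall>x\<in>I. mul a x \<in> I \<and> mul x a \<in> I)"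

definition G_simple ::
    "('f::field \<Rightarrow> 'a::ab_group_add \<Rightarrow> 'a) \<Rightarrow> ('a \<Rightarrow> 'a \<Rightarrow> 'a) \<Rightarrow>
     ('g, 'm) monoid_scheme \<Rightarrow> ('g \<Rightarrow> 'a \<Rightarrow> 'a) \<Rightarrow> bool" where
  "G_simple scale mul G \<rho> \<longleftrightarrow>
     module.span scale {mul a b | a b. True} \<noteq> {0} \<and>
     (\<forall>I. two_sided_ideal scale mul I \<and> (\<forall>g\<in>carrier G. \<rho> g ` I \<subseteq> I) \<longrightarrow> I = {0} \<or> I = UNIV)"


section \<open>Dimension of a quotient space\<close>

text \<open>
  \<open>B\<close> is a set of representatives, one for each element, of a basis of \<open>V / W\<close>,
  where \<open>W \<subseteq> V\<close> are subspaces.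
\<close>

definition quotient_basis ::
    "('f::field \<Rightarrow> 'a::ab_group_add \<Rightarrow> 'a) \<Rightarrow> 'a set \<Rightarrow> 'a set \<Rightarrow> 'a set \<Rightarrow> bool" where
  "quotient_basis scale V W B \<longleftrightarrow> B \<subseteq> V \<and> V \<subseteq> module.span scale (B \<union> W) \<and>
     (\<forall>T u. finite T \<longrightarrow> T \<subseteq> B \<longrightarrow> (\<Sum>b\<in>T. scale (u b) b) \<in> W \<longrightarrow> (\<forall>b\<in>T. u b = 0))"

text \<open>The value is \<open>0\<close> if \<open>V / W\<close> is infinite dimensional.\<close>

definition quotient_dim ::
    "('f::field \<Rightarrow> 'a::ab_group_add \<Rightarrow> 'a) \<Rightarrow> 'a set \<Rightarrow> 'a set \<Rightarrow> nat" where
  "quotient_dim scale V W = card (SOME B. quotient_basis scale V W B)"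


lemma (in vector_space) quotient_dim_eq_card:
  assumes V: "subspace V" and W: "subspace W" and "W \<subseteq> V" and B: "quotient_basis scale V W B"
  shows "quotient_dim scale V W = card B"
proof -
  have card_eq: "card B' = card B" if B': "quotient_basis scale V W B'" for B'
  proof -
    have ind: "T \<subseteq> B'' \<Longrightarrow> finite T \<Longrightarrow> (\<Sum>b\<in>T. scale (u b) b) \<in> W \<Longrightarrow> b \<in> T \<Longrightarrow> u b = 0"
      if "quotient_basis scale V W B''" for B'' T u b
      using that unfolding quotient_basis_def by blast
    have indB: "independent B"
      unfolding dependent_explicit using ind[OF B] subspace_0[OF W] by metis
    obtain C where C: "C \<subseteq> W" "independent C" "W \<subseteq> span C"
      using basis_exists[of W] by metis
    have spanC: "span C = W" using C W by (simp add: span_minimal subset_antisym)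
    have "independent (B \<union> C)"
      unfolding dependent_explicit
    proof (rule notI, elim exE conjE)
      fix T u
      assume T: "finite T" "T \<subseteq> B \<union> C" and nz: "\<exists>v\<in>T. u v \<noteq> 0" and s: "(\<Sum>v\<in>T. scale (u v) v) = 0"
      have "(\<Sum>v\<in>T. scale (u v) v) = (\<Sum>v\<in>T\<inter>B. scale (u v) v) + (\<Sum>v\<in>T-B. scale (u v) v)"
        using T(1) by (metis sum.Int_Diff)
      then have e: "(\<Sum>v\<in>T\<inter>B. scale (u v) v) = - (\<Sum>v\<in>T-B. scale (u v) v)"
        using s by (simp add: eq_neg_iff_add_eq_0)
      have "(\<Sum>v\<in>T-B. scale (u v) v) \<in> span C"
        using T by (intro span_sum span_scale span_base) auto
      then have "(\<Sum>v\<in>T\<inter>B. scale (u v) v) \<in> W"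
        unfolding e spanC[symmetric] by (rule span_neg)
      then have z: "\<forall>v\<in>T\<inter>B. u v = 0"
        using ind[OF B, of "T \<inter> B" u] T(1) by auto
      then have "(\<Sum>v\<in>T-B. scale (u v) v) = 0" using e by simp
      then have "\<forall>v\<in>T-B. u v = 0"
        using C(2) T unfolding dependent_explicit by (metis Diff_subset_conv finite_Diff)
      with z nz show False by blast
    qed
    interpret vp: vector_space_pair scale scale ..
    from vp.linear_independent_extend[OF \<open>independent (B \<union> C)\<close>, of "\<lambda>x. if x \<in> B then x else 0"]
    obtain f where lin: "Vector_Spaces.linear scale scale f"
      and f: "\<And>x. x \<in> B \<union> C \<Longrightarrow> f x = (if x \<in> B then x else 0)" by blast
    interpret f: Vector_Spaces.linear scale scale f by (rule lin)
    have BC: "b \<notin> B" if "b \<in> C" for b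
    proof
      assume "b \<in> B"
      then have "(1 :: 'a) = 0"
        using ind[OF B, of "{b}" "\<lambda>_. 1" b] that C(1) by auto
      then show False by simp
    qed
    have fW: "f x = 0" if "x \<in> W" for x
      using that unfolding spanC[symmetric]
      by (induction rule: span_induct_alt) (auto simp: f.zero f.add f.scale f BC)
    have V_sub: "V \<subseteq> span (B \<union> W)" "V \<subseteq> span (B' \<union> W)" and B'V: "B' \<subseteq> V"
      using B B' by (auto simp: quotient_basis_def)
    have fd: "x - f x \<in> W" if "x \<in> V" for x
    proof -
      from that V_sub have "x \<in> span (B \<union> W)" by blast
      then show ?thesis
      proof (induction rule: span_induct_alt)
        case base
        show ?case using W by (simp add: f.zero subspace_0)
      next
        case (step c x y)
        have "x - f x \<in> W" using step(1) f[of x] fW[of x] W by (auto simp: subspace_0)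
        then have "scale c (x - f x) + (y - f y) \<in> W"
          using step W by (intro subspace_add subspace_scale) auto
        then show ?case by (simp add: f.add f.scale scale_right_diff_distrib algebra_simps)
      qed
    qed
    have fspan: "f x \<in> span (f ` S)" if "x \<in> span (S \<union> W)" for x S
      using that
      by (induction rule: span_induct_alt)
        (auto simp: f.zero f.add f.scale fW intro!: span_add span_scale intro: span_base span_zero)
    have fB: "f ` B = B" using f by force
    have coeff: "u b = 0" if "finite T" "T \<subseteq> B'" "(\<Sum>b\<in>T. scale (u b) (f b)) = 0" "b \<in> T" for T u b
    proof -
      have "f (\<Sum>b\<in>T. scale (u b) b) = 0" using that by (simp add: f.sum f.scale)
      moreover have "(\<Sum>b\<in>T. scale (u b) b) \<in> V"
        using V B'V that by (intro subspace_sum subspace_scale) auto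
      ultimately have "(\<Sum>b\<in>T. scale (u b) b) \<in> W" using fd by fastforce
      then show ?thesis using ind[OF B'] that by blast
    qed
    have inj: "inj_on f B'"
    proof (rule inj_onI, rule ccontr)
      fix x y assume *: "x \<in> B'" "y \<in> B'" "f x = f y" "x \<noteq> y"
      have "(1 :: 'a) = 0"
        using coeff[of "{x, y}" "\<lambda>z. if z = x then 1 else - 1" x] * by auto
      then show False by simp
    qed
    have "independent (f ` B')"
      unfolding dependent_explicit
    proof (rule notI, elim exE conjE)
      fix T u
      assume T: "finite T" "T \<subseteq> f ` B'" and nz: "\<exists>v\<in>T. u v \<noteq> 0" and s: "(\<Sum>v\<in>T. scale (u v) v) = 0"
      from T obtain T' where T': "T' \<subseteq> B'" "finite T'" "T = f ` T'"
        by (meson finite_subset_image)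
      have "(\<Sum>b\<in>T'. scale (u (f b)) (f b)) = 0"
        using s T' inj by (simp add: sum.reindex inj_on_subset)
      then show False using coeff[of T' "u \<circ> f"] T' nz by auto
    qed
    moreover have "span (f ` B') = span B"
    proof (rule subset_antisym; rule span_minimal)
      show "f ` B' \<subseteq> span B" using fspan[of _ B] B'V V_sub fB by auto
      show "B \<subseteq> span (f ` B')"
      proof
        fix b assume "b \<in> B"
        then have "b \<in> span (B' \<union> W)" "f b = b"
          using B V_sub f by (auto simp: quotient_basis_def)
        then show "b \<in> span (f ` B')" using fspan[of b B'] by simp
      qed
    qed simp_all
    ultimately have "card (f ` B') = card B"
      using indB by (metis dim_eq_card)
    then show ?thesis using inj by (simp add: card_image)
  qed
  show ?thesis
    unfolding quotient_dim_def by (rule card_eq, rule someI, rule B)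
qed


section \<open>Formal linear combinations\<close>

definition pm_scale :: "'f::semiring_0 \<Rightarrow> ('k \<Rightarrow>\<^sub>0 'f) \<Rightarrow> ('k \<Rightarrow>\<^sub>0 'f)" where
  "pm_scale c p = Poly_Mapping.map ((*) c) p"

lemma lookup_pm_scale [simp]: "Poly_Mapping.lookup (pm_scale c p) k = c * Poly_Mapping.lookup p k"
  by (simp add: pm_scale_def Poly_Mapping.map.rep_eq when_def)

global_interpretation pm: vector_space "pm_scale :: 'f::field \<Rightarrow> ('k \<Rightarrow>\<^sub>0 'f) \<Rightarrow> _"
  by unfold_locales (auto intro!: poly_mapping_eqI simp: lookup_add algebra_simps)

text \<open>The linear extension of a map defined on the basis.\<close>

definition lin_ext ::
    "('f::field \<Rightarrow> 'a::ab_group_add \<Rightarrow> 'a) \<Rightarrow> ('k \<Rightarrow> 'a) \<Rightarrow> ('k \<Rightarrow>\<^sub>0 'f) \<Rightarrow> 'a" where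
  "lin_ext scale v p = (\<Sum>k\<in>Poly_Mapping.keys p. scale (Poly_Mapping.lookup p k) (v k))"

lemma (in vector_space) lin_ext_superset:
  assumes "finite S" "Poly_Mapping.keys p \<subseteq> S"
  shows "lin_ext scale v p = (\<Sum>k\<in>S. scale (Poly_Mapping.lookup p k) (v k))"
  unfolding lin_ext_def
  by (rule sum.mono_neutral_left) (use assms in \<open>auto simp: in_keys_iff\<close>)

lemma (in vector_space) linear_lin_ext:
  fixes v :: "'k \<Rightarrow> 'b"
  shows "Vector_Spaces.linear pm_scale scale (lin_ext scale v)"
proof unfold_locales
  fix p q :: "'k \<Rightarrow>\<^sub>0 'a" and c
  let ?S = "Poly_Mapping.keys p \<union> Poly_Mapping.keys q"
  have "Poly_Mapping.keys (p + q) \<subseteq> ?S" by (rule Poly_Mapping.keys_add)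
  then show "lin_ext scale v (p + q) = lin_ext scale v p + lin_ext scale v q"
    by (simp add: lin_ext_superset[of ?S] lookup_add scale_left_distrib sum.distrib)
  have "Poly_Mapping.keys (pm_scale c p) \<subseteq> Poly_Mapping.keys p" by (auto simp: in_keys_iff)
  then show "lin_ext scale v (pm_scale c p) = scale c (lin_ext scale v p)"
    by (simp add: lin_ext_superset[of "Poly_Mapping.keys p"] scale_sum_right)
qed

lemma (in vector_space) lin_ext_single [simp]:
  "lin_ext scale v (Poly_Mapping.single k c) = scale c (v k)"
  by (simp add: lin_ext_superset[of "{k}"])

text \<open>The bilinear extension of a binary operation on the basis.\<close>

definition bilin_ext :: "('k \<Rightarrow> 'k \<Rightarrow> 'k) \<Rightarrow> ('k \<Rightarrow>\<^sub>0 'f) \<Rightarrow> ('k \<Rightarrow>\<^sub>0 'f) \<Rightarrow> ('k \<Rightarrow>\<^sub>0 'f::field)" where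
  "bilin_ext op p q =
     lin_ext pm_scale (\<lambda>s. lin_ext pm_scale (\<lambda>t. Poly_Mapping.single (op s t) 1) q) p"

lemma lin_ext_add_fun:
  "lin_ext pm_scale (\<lambda>s. v s + w s) p = lin_ext pm_scale v p + lin_ext pm_scale w p"
  by (simp add: lin_ext_def pm.scale_right_distrib sum.distrib)

lemma lin_ext_scale_fun:
  "lin_ext pm_scale (\<lambda>s. pm_scale c (v s)) p = pm_scale c (lin_ext pm_scale v p)"
  by (simp add: lin_ext_def pm.scale_sum_right mult.commute)

global_interpretation free_alg: nonassoc_algebra
  "pm_scale :: 'f::field \<Rightarrow> ('k \<Rightarrow>\<^sub>0 'f) \<Rightarrow> _" "bilin_ext op" for op :: "'k \<Rightarrow> 'k \<Rightarrow> 'k"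
proof
  fix x y z :: "'k \<Rightarrow>\<^sub>0 'f" and c
  interpret l: Vector_Spaces.linear "pm_scale :: 'f \<Rightarrow> ('k \<Rightarrow>\<^sub>0 'f) \<Rightarrow> _" pm_scale "lin_ext pm_scale v"
    for v :: "'k \<Rightarrow> 'k \<Rightarrow>\<^sub>0 'f"
    by (rule pm.linear_lin_ext)
  show "bilin_ext op (x + y) z = bilin_ext op x z + bilin_ext op y z"
    by (simp add: bilin_ext_def l.add)
  show "bilin_ext op (pm_scale c x) z = pm_scale c (bilin_ext op x z)"
    by (simp add: bilin_ext_def l.scale)
  show "bilin_ext op z (x + y) = bilin_ext op z x + bilin_ext op z y"
    by (simp add: bilin_ext_def l.add lin_ext_add_fun)
  show "bilin_ext op z (pm_scale c x) = pm_scale c (bilin_ext op z x)"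
    by (simp add: bilin_ext_def l.scale lin_ext_scale_fun)
qed

lemma bilin_ext_single [simp]:
  "bilin_ext op (Poly_Mapping.single s c) (Poly_Mapping.single t d) =
     Poly_Mapping.single (op s t) (c * d)"
  by (auto simp: bilin_ext_def intro!: poly_mapping_eqI simp: lookup_single when_def)


lemma (in nonassoc_algebra) lin_ext_bilin_ext:
  assumes "\<And>s t. s \<in> Poly_Mapping.keys p \<Longrightarrow> t \<in> Poly_Mapping.keys q \<Longrightarrow> v (op s t) = mul (v s) (v t)"
  shows "lin_ext scale v (bilin_ext op p q) = mul (lin_ext scale v p) (lin_ext scale v q)"
proof -
  interpret v: Vector_Spaces.linear pm_scale scale "lin_ext scale v"
    by (rule linear_lin_ext)
  interpret ml: Vector_Spaces.linear scale scale "\<lambda>x. mul x y" for y by (rule linear_mul_left)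
  interpret mr: Vector_Spaces.linear scale scale "\<lambda>y. mul x y" for x by (rule linear_mul_right)
  have "lin_ext scale v (bilin_ext op p q) =
      (\<Sum>s\<in>Poly_Mapping.keys p. scale (Poly_Mapping.lookup p s)
        (\<Sum>t\<in>Poly_Mapping.keys q. scale (Poly_Mapping.lookup q t) (v (op s t))))"
    by (simp add: bilin_ext_def lin_ext_def[of pm_scale] v.sum v.scale)
  also have "\<dots> = (\<Sum>s\<in>Poly_Mapping.keys p. scale (Poly_Mapping.lookup p s)
        (\<Sum>t\<in>Poly_Mapping.keys q. scale (Poly_Mapping.lookup q t) (mul (v s) (v t))))"
    by (intro sum.cong refl arg_cong2[where f = scale]) (simp add: assms)
  also have "\<dots> = mul (lin_ext scale v p) (lin_ext scale v q)"
    by (simp only: lin_ext_def ml.sum ml.scale) (simp only: mr.sum mr.scale)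
  finally show ?thesis .
qed


section \<open>The free associative algebra\<close>

text \<open>
  The free (non-unital) associative algebra on \<open>X\<close> has the nonempty words in \<open>X\<close> as a basis;
  its product is \<^term>\<open>bilin_ext (@)\<close>.
\<close>

definition free_assoc :: "'x set \<Rightarrow> ('x list \<Rightarrow>\<^sub>0 'f::field) set" where
  "free_assoc X = {p. \<forall>w\<in>Poly_Mapping.keys p. w \<noteq> [] \<and> set w \<subseteq> X}"

fun word_val :: "('a \<Rightarrow> 'a \<Rightarrow> 'a) \<Rightarrow> ('x \<Rightarrow> 'a::zero) \<Rightarrow> 'x list \<Rightarrow> 'a" where
  "word_val mul \<phi> [] = 0"
| "word_val mul \<phi> [x] = \<phi> x"
| "word_val mul \<phi> (x # y # w) = mul (\<phi> x) (word_val mul \<phi> (y # w))"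

definition eval_assoc ::
    "('f::field \<Rightarrow> 'a::ab_group_add \<Rightarrow> 'a) \<Rightarrow> ('a \<Rightarrow> 'a \<Rightarrow> 'a) \<Rightarrow> ('x \<Rightarrow> 'a) \<Rightarrow> ('x list \<Rightarrow>\<^sub>0 'f) \<Rightarrow> 'a" where
  "eval_assoc scale mul \<phi> = lin_ext scale (word_val mul \<phi>)"

context assoc_algebra
begin

lemma word_val_append:
  assumes "v \<noteq> []" "w \<noteq> []"
  shows "word_val mul \<phi> (v @ w) = mul (word_val mul \<phi> v) (word_val mul \<phi> w)"
  using assms(1)
proof (induction v rule: list_nonempty_induct)
  case (single x)
  then show ?case using assms(2) by (cases w) auto
next
  case (cons x xs)
  then show ?case by (cases xs) (auto simp: mul_assoc)
qed

lemma eval_assoc_gen: "eval_assoc scale mul \<phi> (Poly_Mapping.single [x] 1) = \<phi> x"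
  by (simp add: eval_assoc_def)

lemma eval_assoc_mult:
  assumes "p \<in> free_assoc X" "q \<in> free_assoc X"
  shows "eval_assoc scale mul \<phi> (bilin_ext (@) p q) =
    mul (eval_assoc scale mul \<phi> p) (eval_assoc scale mul \<phi> q)"
  unfolding eval_assoc_def using assms
  by (intro lin_ext_bilin_ext word_val_append) (auto simp: free_assoc_def)

end


section \<open>The free Lie algebra\<close>

text \<open>
  The free Lie algebra is the quotient of the free nonassociative algebra, whose basis consists
  of the nonassociative words, by the ideal generated by the Lie identities.
\<close>

datatype (gens: 'x) magma = Gen 'x | Prod "'x magma" "'x magma"

inductive_set lie_ideal :: "('x magma \<Rightarrow>\<^sub>0 'f::field) set" where
  zero: "0 \<in> lie_ideal"
| add: "p \<in> lie_ideal \<Longrightarrow> q \<in> lie_ideal \<Longrightarrow> p + q \<in> lie_ideal"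
| scale: "p \<in> lie_ideal \<Longrightarrow> pm_scale c p \<in> lie_ideal"
| mult_left: "p \<in> lie_ideal \<Longrightarrow> bilin_ext Prod q p \<in> lie_ideal"
| mult_right: "p \<in> lie_ideal \<Longrightarrow> bilin_ext Prod p q \<in> lie_ideal"
| self: "bilin_ext Prod p p \<in> lie_ideal"
| jacobi: "bilin_ext Prod p (bilin_ext Prod q r) + bilin_ext Prod q (bilin_ext Prod r p)
    + bilin_ext Prod r (bilin_ext Prod p q) \<in> lie_ideal"

lemma lie_ideal_uminus: "p \<in> lie_ideal \<Longrightarrow> - p \<in> lie_ideal"
  using lie_ideal.scale[of p "- 1"] by simp

lemma lie_ideal_diff: "p \<in> lie_ideal \<Longrightarrow> q \<in> lie_ideal \<Longrightarrow> p - q \<in> lie_ideal"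
  using lie_ideal.add[of p "- q"] lie_ideal_uminus[of q] by simp

quotient_type (overloaded) ('x, 'f) free_lie = "'x magma \<Rightarrow>\<^sub>0 'f::field" /
  "\<lambda>p q. p - q \<in> lie_ideal"
proof (rule equivpI)
  show "reflp (\<lambda>p q. p - q \<in> lie_ideal)"
    by (rule reflpI) (simp add: lie_ideal.zero)
  show "symp (\<lambda>p q. p - q \<in> lie_ideal)"
    by (rule sympI) (use lie_ideal_uminus in force)
  show "transp (\<lambda>p q. p - q \<in> lie_ideal)"
    by (rule transpI) (use lie_ideal.add in force)
qed

instantiation free_lie :: (type, field) ab_group_add
begin

lift_definition zero_free_lie :: "('a, 'b) free_lie" is 0 .

lift_definition plus_free_lie :: "('a, 'b) free_lie \<Rightarrow> ('a, 'b) free_lie \<Rightarrow> ('a, 'b) free_lie" is "(+)"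
  by (metis add_diff_add lie_ideal.add)

lift_definition uminus_free_lie :: "('a, 'b) free_lie \<Rightarrow> ('a, 'b) free_lie" is uminus
  by (metis lie_ideal_uminus minus_diff_minus)

lift_definition minus_free_lie :: "('a, 'b) free_lie \<Rightarrow> ('a, 'b) free_lie \<Rightarrow> ('a, 'b) free_lie" is "(-)"
proof -
  fix p p' q q' :: "'a magma \<Rightarrow>\<^sub>0 'b"
  assume "p - p' \<in> lie_ideal" "q - q' \<in> lie_ideal"
  then have "(p - p') - (q - q') \<in> lie_ideal" by (rule lie_ideal_diff)
  then show "p - q - (p' - q') \<in> lie_ideal" by (simp add: algebra_simps)
qed

instance
  by standard (transfer; simp add: algebra_simps lie_ideal.zero)+

end

lift_definition fl_scale :: "'f::field \<Rightarrow> ('x, 'f) free_lie \<Rightarrow> ('x, 'f) free_lie" is pm_scale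
  by (metis lie_ideal.scale pm.scale_right_diff_distrib)

lift_definition fl_bracket :: "('x, 'f::field) free_lie \<Rightarrow> ('x, 'f) free_lie \<Rightarrow> ('x, 'f) free_lie"
  is "bilin_ext Prod"
proof -
  fix p p' q q' :: "'x magma \<Rightarrow>\<^sub>0 'f"
  assume *: "p - p' \<in> lie_ideal" "q - q' \<in> lie_ideal"
  interpret ml: Vector_Spaces.linear "pm_scale :: 'f \<Rightarrow> ('x magma \<Rightarrow>\<^sub>0 'f) \<Rightarrow> _" pm_scale
    "\<lambda>x. bilin_ext Prod x y" for y by (rule free_alg.linear_mul_left)
  interpret mr: Vector_Spaces.linear "pm_scale :: 'f \<Rightarrow> ('x magma \<Rightarrow>\<^sub>0 'f) \<Rightarrow> _" pm_scale
    "\<lambda>y. bilin_ext Prod x y" for x by (rule free_alg.linear_mul_right)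
  have "bilin_ext Prod p q - bilin_ext Prod p' q' =
      bilin_ext Prod (p - p') q + bilin_ext Prod p' (q - q')"
    by (simp add: ml.diff mr.diff)
  then show "bilin_ext Prod p q - bilin_ext Prod p' q' \<in> lie_ideal"
    using * by (metis lie_ideal.add lie_ideal.mult_left lie_ideal.mult_right)
qed

lift_definition fl_gen :: "'x \<Rightarrow> ('x, 'f::field) free_lie" is "\<lambda>x. Poly_Mapping.single (Gen x) 1" .

global_interpretation fl: lie_algebra "fl_scale :: 'f::field \<Rightarrow> ('x, 'f) free_lie \<Rightarrow> _" fl_bracket
proof -
  have vs: "vector_space (fl_scale :: 'f \<Rightarrow> ('x, 'f) free_lie \<Rightarrow> _)"
    by unfold_locales
      (transfer; simp add: pm.scale_right_distrib pm.scale_left_distrib lie_ideal.zero)+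
  interpret vector_space "fl_scale :: 'f \<Rightarrow> ('x, 'f) free_lie \<Rightarrow> _" by (rule vs)
  interpret ml: Vector_Spaces.linear "pm_scale :: 'f \<Rightarrow> ('x magma \<Rightarrow>\<^sub>0 'f) \<Rightarrow> _" pm_scale
    "\<lambda>x. bilin_ext Prod x y" for y by (rule free_alg.linear_mul_left)
  interpret mr: Vector_Spaces.linear "pm_scale :: 'f \<Rightarrow> ('x magma \<Rightarrow>\<^sub>0 'f) \<Rightarrow> _" pm_scale
    "\<lambda>y. bilin_ext Prod x y" for x by (rule free_alg.linear_mul_right)
  show "lie_algebra (fl_scale :: 'f \<Rightarrow> ('x, 'f) free_lie \<Rightarrow> _) fl_bracket"
    by unfold_locales
      (transfer; simp add: ml.add ml.scale mr.add mr.scale lie_ideal.zero lie_ideal.self lie_ideal.jacobi)+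
qed

text \<open>The free Lie algebra on \<open>X\<close>, as the subalgebra of the free Lie algebra on the whole type.\<close>

definition free_lie_on :: "'x set \<Rightarrow> ('x, 'f::field) free_lie set" where
  "free_lie_on X = abs_free_lie ` {p. \<forall>t\<in>Poly_Mapping.keys p. gens t \<subseteq> X}"

primrec magma_val :: "('a \<Rightarrow> 'a \<Rightarrow> 'a) \<Rightarrow> ('x \<Rightarrow> 'a) \<Rightarrow> 'x magma \<Rightarrow> 'a" where
  "magma_val mul \<phi> (Gen x) = \<phi> x"
| "magma_val mul \<phi> (Prod s t) = mul (magma_val mul \<phi> s) (magma_val mul \<phi> t)"

text \<open>
  If \<open>mul\<close> is a Lie bracket, the value does not depend on the representative, and \<open>eval_lie\<close> is
  the homomorphism of Lie algebras extending \<open>\<phi>\<close>; see \<open>eval_lie_abs\<close> and the lemmas after it.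
\<close>

definition eval_lie ::
    "('f::field \<Rightarrow> 'a::ab_group_add \<Rightarrow> 'a) \<Rightarrow> ('a \<Rightarrow> 'a \<Rightarrow> 'a) \<Rightarrow> ('x \<Rightarrow> 'a) \<Rightarrow> ('x, 'f) free_lie \<Rightarrow> 'a" where
  "eval_lie scale mul \<phi> f = lin_ext scale (magma_val mul \<phi>) (rep_free_lie f)"

context lie_algebra
begin

lemma eval_magma_mult:
  "lin_ext scale (magma_val mul \<phi>) (bilin_ext Prod p q) =
     mul (lin_ext scale (magma_val mul \<phi>) p) (lin_ext scale (magma_val mul \<phi>) q)"
  by (rule lin_ext_bilin_ext) simp

lemma eval_lie_ideal:
  assumes "p \<in> lie_ideal"
  shows "lin_ext scale (magma_val mul \<phi>) p = 0"
proof -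
  interpret v: Vector_Spaces.linear pm_scale scale "lin_ext scale (magma_val mul \<phi>)"
    by (rule linear_lin_ext)
  interpret ml: Vector_Spaces.linear scale scale "\<lambda>x. mul x y" for y by (rule linear_mul_left)
  interpret mr: Vector_Spaces.linear scale scale "\<lambda>y. mul x y" for x by (rule linear_mul_right)
  from assms show ?thesis
    by induction
      (simp_all add: eval_magma_mult mul_self jacobi v.zero v.add v.scale ml.zero mr.zero)
qed

lemma eval_lie_abs:
  "eval_lie scale mul \<phi> (abs_free_lie p) = lin_ext scale (magma_val mul \<phi>) p"
proof -
  interpret v: Vector_Spaces.linear pm_scale scale "lin_ext scale (magma_val mul \<phi>)"
    by (rule linear_lin_ext)
  have "rep_free_lie (abs_free_lie p) - p \<in> lie_ideal"
    by (rule Quotient3_rep_abs[OF Quotient3_free_lie]) (simp add: lie_ideal.zero)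
  then have "lin_ext scale (magma_val mul \<phi>) (rep_free_lie (abs_free_lie p) - p) = 0"
    by (rule eval_lie_ideal)
  then show ?thesis by (simp add: eval_lie_def v.diff)
qed

lemma eval_lie_gen: "eval_lie scale mul \<phi> (fl_gen x) = \<phi> x"
  by (simp add: fl_gen.abs_eq eval_lie_abs)

lemma eval_lie_bracket:
  "eval_lie scale mul \<phi> (fl_bracket f g) = mul (eval_lie scale mul \<phi> f) (eval_lie scale mul \<phi> g)"
  by (induction f; induction g) (simp add: fl_bracket.abs_eq eval_lie_abs eval_magma_mult)

lemma linear_eval_lie: "Vector_Spaces.linear fl_scale scale (eval_lie scale mul \<phi>)"
proof unfold_locales
  interpret v: Vector_Spaces.linear pm_scale scale "lin_ext scale (magma_val mul \<phi>)"
    by (rule linear_lin_ext)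
  fix f g :: "('c, 'a) free_lie" and c
  show "eval_lie scale mul \<phi> (f + g) = eval_lie scale mul \<phi> f + eval_lie scale mul \<phi> g"
    by (induction f; induction g) (simp add: plus_free_lie.abs_eq eval_lie_abs v.add)
  show "eval_lie scale mul \<phi> (fl_scale c f) = scale c (eval_lie scale mul \<phi> f)"
    by (induction f) (simp add: fl_scale.abs_eq eval_lie_abs v.scale)
qed

end

text \<open>Left-normed long commutators.\<close>

fun long_commutator :: "('x, 'f::field) free_lie list \<Rightarrow> ('x, 'f) free_lie" where
  "long_commutator [] = 0"
| "long_commutator (f # fs) = foldl fl_bracket f fs"


section \<open>\<open>G\<close>-codimensions\<close>

text \<open>The pair \<open>(j, g)\<close> stands for the free generator \<open>x\<^sub>j\<^sup>g\<close>.\<close>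

definition G_letters :: "('g, 'm) monoid_scheme \<Rightarrow> (nat \<times> 'g) set" where
  "G_letters G = UNIV \<times> carrier G"

definition G_subst :: "('g \<Rightarrow> 'a \<Rightarrow> 'a) \<Rightarrow> (nat \<Rightarrow> 'a) \<Rightarrow> nat \<times> 'g \<Rightarrow> 'a" where
  "G_subst \<rho> a = (\<lambda>(j, g). \<rho> g (a j))"

definition multilinear_words :: "('g, 'm) monoid_scheme \<Rightarrow> nat \<Rightarrow> (nat \<times> 'g) list set" where
  "multilinear_words G n =
     {map (\<lambda>i. (\<sigma> i, g i)) [1..<Suc n] | \<sigma> g. \<sigma> permutes {1..n} \<and> g \<in> {1..n} \<rightarrow> carrier G}"

definition P_assoc :: "('g, 'm) monoid_scheme \<Rightarrow> nat \<Rightarrow> ((nat \<times> 'g) list \<Rightarrow>\<^sub>0 'f::field) set" where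
  "P_assoc G n = module.span pm_scale ((\<lambda>w. Poly_Mapping.single w 1) ` multilinear_words G n)"

definition Id_assoc ::
    "('f::field \<Rightarrow> 'a::ab_group_add \<Rightarrow> 'a) \<Rightarrow> ('a \<Rightarrow> 'a \<Rightarrow> 'a) \<Rightarrow>
     ('g, 'm) monoid_scheme \<Rightarrow> ('g \<Rightarrow> 'a \<Rightarrow> 'a) \<Rightarrow> ((nat \<times> 'g) list \<Rightarrow>\<^sub>0 'f) set" where
  "Id_assoc scale mul G \<rho> =
     {f \<in> free_assoc (G_letters G). \<forall>a. eval_assoc scale mul (G_subst \<rho> a) f = 0}"

definition codim_assoc ::
    "('f::field \<Rightarrow> 'a::ab_group_add \<Rightarrow> 'a) \<Rightarrow> ('a \<Rightarrow> 'a \<Rightarrow> 'a) \<Rightarrow>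
     ('g, 'm) monoid_scheme \<Rightarrow> ('g \<Rightarrow> 'a \<Rightarrow> 'a) \<Rightarrow> nat \<Rightarrow> nat" where
  "codim_assoc scale mul G \<rho> n =
     quotient_dim pm_scale (P_assoc G n) (P_assoc G n \<inter> Id_assoc scale mul G \<rho>)"

definition P_lie :: "('g, 'm) monoid_scheme \<Rightarrow> nat \<Rightarrow> (nat \<times> 'g, 'f::field) free_lie set" where
  "P_lie G n = module.span fl_scale ((\<lambda>w. long_commutator (map fl_gen w)) ` multilinear_words G n)"

definition Id_lie ::
    "('f::field \<Rightarrow> 'a::ab_group_add \<Rightarrow> 'a) \<Rightarrow> ('a \<Rightarrow> 'a \<Rightarrow> 'a) \<Rightarrow>
     ('g, 'm) monoid_scheme \<Rightarrow> ('g \<Rightarrow> 'a \<Rightarrow> 'a) \<Rightarrow> (nat \<times> 'g, 'f) free_lie set" where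
  "Id_lie scale mul G \<rho> =
     {f \<in> free_lie_on (G_letters G). \<forall>a. eval_lie scale mul (G_subst \<rho> a) f = 0}"

definition codim_lie ::
    "('f::field \<Rightarrow> 'a::ab_group_add \<Rightarrow> 'a) \<Rightarrow> ('a \<Rightarrow> 'a \<Rightarrow> 'a) \<Rightarrow>
     ('g, 'm) monoid_scheme \<Rightarrow> ('g \<Rightarrow> 'a \<Rightarrow> 'a) \<Rightarrow> nat \<Rightarrow> nat" where
  "codim_lie scale mul G \<rho> n =
     quotient_dim fl_scale (P_lie G n) (P_lie G n \<inter> Id_lie scale mul G \<rho>)"

end

theory Submission
  imports Defs "Jordan_Normal_Form.Determinant" "HOL-Library.Function_Algebras"
    "HOL-Combinatorics.Multiset_Permutations"
begin

text \<open>
  The \<open>n\<close>-th codimension is the dimension of the space of multilinear functions of \<open>n\<close> arguments in \<open>A\<close>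
  that are spanned by products of the arguments, each moved by an element of \<open>G\<close>
  (\<open>codim_assoc_eq\<close>, \<open>codim_lie_eq\<close>). For \<open>d = dim A\<close> this dimension is at most \<open>d^(n + 1)\<close>, and the
  question is when it really grows like \<open>d^n\<close>. Associative and Lie algebras are treated together,
  because everything is governed by the trace form
  \<open>(u, v) = tr (L u L v) + tr (R u R v)\<close>, where \<open>L\<close> and \<open>R\<close> are left and right multiplication: it is
  invariant under automorphisms and anti-automorphisms and satisfies \<open>(x y, z) = (x, y z)\<close>.

  The trace form detects abelian ideals: either it is nondegenerate or \<open>A\<close> has a nonzero
  \<open>G\<close>-invariant ideal \<open>J\<close> with \<open>J J = 0\<close> (\<open>abelian_ideal_or_nondegenerate\<close>). For a Lie algebra this is
  Cartan's criterion: if \<open>x\<close> is a sum of products of elements of the radical of the form with elements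
  of \<open>A\<close>, one compares \<open>ad x\<close> with the derivation that acts by \<open>f \<mu>\<close> on the generalized eigenspace
  of \<open>\<mu>\<close>, where \<open>f\<close> is an additive function with rational values. For an associative algebra an idempotent in
  the radical would have trace zero, hence rank zero. In both cases the elements in question act nilpotently, and
  Engel's theorem provides \<open>J\<close>.

  If \<open>A\<close> is not \<open>G\<close>-simple, most words in a basis of \<open>A\<close> are values at which every multilinear monomial
  vanishes. Given \<open>J\<close>, a monomial vanishes as soon as two arguments lie in \<open>J\<close>; otherwise \<open>A\<close> is the sum
  of a proper ideal and its orthogonal complement, and a monomial vanishes as soon as arguments from
  both occur. The number of remaining words is at most \<open>2 (d - 1/2)^n\<close>
  (\<open>words_abelian_ideal\<close>, \<open>words_two_ideals\<close>).

  If \<open>A\<close> is \<open>G\<close>-simple, the form is nondegenerate. Since \<open>A\<close> is irreducible over the algebra of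
  operators generated by multiplications and \<open>G\<close>, this algebra contains operators of rank one, and they
  yield a nonzero multilinear function that alternates in \<open>d\<close> arguments (\<open>exists_alternating\<close>). When
  a function alternates in \<open>d\<close> arguments, replacing each of them in turn by its image under an
  operator and summing multiplies the function by the trace of the operator; so the space of
  multilinear functions admits multiplication by the trace form of two new arguments, hence by Gram
  determinants of \<open>2 d\<close> new arguments. This gives functions with arbitrarily many alternating blocks
  of size \<open>d\<close> and a fixed number of further arguments.

  The permutations of the arguments of such a function span a space of dimension about \<open>d^n\<close>. Let the
  \<open>i\<close>-th argument of block \<open>b\<close> have the time \<open>b div s + i\<close>, so that a block is spread over \<open>d\<close> consecutive times, and
  only permute arguments of the same time. Evaluated at the words of basis vectors that arise from
  the standard word in the same way, the permuted functions have a diagonal matrix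
  (\<open>block_bijective_shuffle\<close>, \<open>ml_dim_ge_shuffles\<close>). At almost all times the word is an arbitrary
  arrangement of \<open>d\<close> letters that occur \<open>s\<close> times each, and there are about \<open>d^(s d)\<close> of these.
\<close>

section \<open>Linear algebra\<close>

subsection \<open>Functionals and traces\<close>

context vector_space
begin

text \<open>
  With fewer functionals than vectors, the map that collects their values cannot be injective on the
  span: its image has dimension at most \<open>card \<Omega>\<close>.
\<close>

lemma common_kernel:
  fixes l :: "'w \<Rightarrow> 'b \<Rightarrow> 'a"
  assumes fin: "finite \<Omega>" and lin: "\<And>\<omega>. \<omega> \<in> \<Omega> \<Longrightarrow> Vector_Spaces.linear scale (*) (l \<omega>)"
    and X: "independent X" "finite X" and less: "card \<Omega> < card X"
  shows "\<exists>x\<in>span X. x \<noteq> 0 \<and> (\<forall>\<omega>\<in>\<Omega>. l \<omega> x = 0)"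
proof (rule ccontr)
  assume no: "\<not> ?thesis"
  define T :: "'b \<Rightarrow> 'w \<Rightarrow>\<^sub>0 'a" where "T = (\<lambda>x. \<Sum>\<omega>\<in>\<Omega>. Poly_Mapping.single \<omega> (l \<omega> x))"
  have lookT: "Poly_Mapping.lookup (T x) \<omega> = (if \<omega> \<in> \<Omega> then l \<omega> x else 0)" for x \<omega>
    using fin by (auto simp: T_def lookup_sum lookup_single when_def)
  have add: "l \<omega> (x + y) = l \<omega> x + l \<omega> y" and scl: "l \<omega> (scale c x) = c * l \<omega> x" if "\<omega> \<in> \<Omega>" for \<omega> x y c
    using lin[OF that] by (auto simp: Vector_Spaces.linear_iff)
  have linT: "Vector_Spaces.linear scale pm_scale T"
    by unfold_locales (auto intro!: poly_mapping_eqI simp: lookT lookup_add add scl)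
  interpret vp: vector_space_pair scale "pm_scale :: 'a \<Rightarrow> ('w \<Rightarrow>\<^sub>0 'a) \<Rightarrow> _" ..
  have inj: "inj_on T (span X)"
    unfolding vp.linear_inj_on_iff_eq_0[OF linT subspace_span]
  proof (intro ballI impI)
    fix x assume "x \<in> span X" "T x = 0"
    moreover have "l \<omega> x = 0" if "\<omega> \<in> \<Omega>" for \<omega>
      using lookT[of x \<omega>] \<open>T x = 0\<close> that by simp
    ultimately show "x = 0" using no by blast
  qed
  have ind: "pm.independent (T ` X)"
    using vp.linear_independent_injective_image[OF linT X(1) inj] .
  have "T ` X \<subseteq> pm.span ((\<lambda>\<omega>. Poly_Mapping.single \<omega> 1) ` \<Omega>)"
  proof -
    have sc: "Poly_Mapping.single \<omega> c = pm_scale c (Poly_Mapping.single \<omega> 1)" for \<omega> :: 'w and c :: 'a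
      by (auto intro!: poly_mapping_eqI simp: lookup_single when_def)
    have "Poly_Mapping.single \<omega> (l \<omega> x) \<in> pm.span ((\<lambda>\<omega>. Poly_Mapping.single \<omega> 1) ` \<Omega>)"
      if "\<omega> \<in> \<Omega>" for \<omega> x
      by (subst sc) (intro pm.span_scale pm.span_base imageI that)
    then show ?thesis
      unfolding T_def by (intro image_subsetI pm.span_sum)
  qed
  then have "card (T ` X) \<le> card ((\<lambda>\<omega>. Poly_Mapping.single \<omega> (1::'a)) ` \<Omega>)"
    using pm.independent_span_bound[OF _ ind] fin by blast
  also have "\<dots> \<le> card \<Omega>" using fin by (rule card_image_le)
  finally show False
    using less card_image[of T X] inj span_superset[of X] by (metis inj_on_subset linorder_not_less)
qed

end

locale vect_space = vector_space scale
  for scale :: "'f::field \<Rightarrow> 'b::ab_group_add \<Rightarrow> 'b" (infixr \<open>*s\<close> 75)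
begin

text \<open>
  The trace of \<open>T\<close> on the subspace with basis \<open>C\<close>, provided that \<open>T\<close> preserves it.
\<close>

definition trace_on :: "'b set \<Rightarrow> ('b \<Rightarrow> 'b) \<Rightarrow> 'f" where
  "trace_on C T = (\<Sum>c\<in>C. representation C (T c) c)"

text \<open>
  When \<open>T\<close> maps into a smaller subspace, the remaining directions contribute nothing to the trace.
  If both spans agree, this is independence of the basis.
\<close>

lemma trace_on_subspace:
  assumes C: "independent C" "finite C" and C': "independent C'" "finite C'"
    and sub: "C' \<subseteq> span C" and T: "Vector_Spaces.linear scale scale T" and im: "T ` C \<subseteq> span C'"
  shows "trace_on C T = trace_on C' T"
proof -
  interpret T: Vector_Spaces.linear scale scale T by (rule T)
  have *: "representation C (T c) c = (\<Sum>c'\<in>C'. representation C' (T c) c' * representation C c' c)"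
    if "c \<in> C" for c
  proof -
    have "T c \<in> span C'" using im that by auto
    then have "T c = (\<Sum>c'\<in>C'. scale (representation C' (T c) c') c')"
      using C' by (simp add: sum_representation_eq)
    then have "representation C (T c) = representation C (\<Sum>c'\<in>C'. scale (representation C' (T c) c') c')"
      by simp
    also have "\<dots> = (\<lambda>b. \<Sum>c'\<in>C'. representation C' (T c) c' * representation C c' b)"
      using sub C by (simp add: representation_sum span_scale subset_iff representation_scale cong: sum.cong)
    finally show ?thesis by (simp add: fun_eq_iff)
  qed
  have **: "representation C' (T c') c' = (\<Sum>c\<in>C. representation C' (T c) c' * representation C c' c)"
    if "c' \<in> C'" for c'
  proof -
    have "c' = (\<Sum>c\<in>C. scale (representation C c' c) c)"
      using C sub that by (simp add: sum_representation_eq subset_iff)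
    then have "T c' = T (\<Sum>c\<in>C. scale (representation C c' c) c)" by simp
    also have "\<dots> = (\<Sum>c\<in>C. scale (representation C c' c) (T c))" by (simp add: T.sum T.scale)
    finally have "representation C' (T c') = representation C' (\<Sum>c\<in>C. scale (representation C c' c) (T c))"
      by simp
    also have "\<dots> = (\<lambda>b. \<Sum>c\<in>C. representation C c' c * representation C' (T c) b)"
      using im C' by (simp add: representation_sum span_scale subset_iff representation_scale image_subset_iff cong: sum.cong)
    finally show ?thesis by (simp add: fun_eq_iff mult.commute)
  qed
  have "trace_on C T = (\<Sum>c\<in>C. \<Sum>c'\<in>C'. representation C' (T c) c' * representation C c' c)"
    unfolding trace_on_def by (rule sum.cong) (auto simp: *)
  also have "\<dots> = (\<Sum>c'\<in>C'. \<Sum>c\<in>C. representation C' (T c) c' * representation C c' c)"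
    by (rule sum.swap)
  also have "\<dots> = trace_on C' T"
    unfolding trace_on_def by (rule sum.cong) (auto simp: **)
  finally show ?thesis .
qed

lemma linear_funpow: "Vector_Spaces.linear scale scale T \<Longrightarrow> Vector_Spaces.linear scale scale (T ^^ k)"
proof (induction k)
  case 0
  show ?case by (simp add: linear_iff vector_space_axioms Vector_Spaces.linear_iff id_def)
next
  case (Suc k)
  then show ?case using Vector_Spaces.linear_compose[of scale scale "T ^^ k" scale T] by (simp add: o_def)
qed

text \<open>
  The trace does not change when the subspace is replaced by its image, and after \<open>m\<close> steps the image is \<open>0\<close>.
\<close>

lemma trace_on_nilpotent:
  assumes "independent C" "finite C" and T: "Vector_Spaces.linear scale scale T" and "T ` C \<subseteq> span C"
    and "\<And>v. v \<in> span C \<Longrightarrow> (T ^^ m) v = 0"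
  shows "trace_on C T = 0"
  using assms(1,2,4,5)
proof (induction m arbitrary: C)
  case 0
  have "c = 0" if "c \<in> C" for c using 0(4)[of c] span_base[OF that] by simp
  then have "C = {}" using 0(1) dependent_zero by blast
  then show ?case by (simp add: trace_on_def)
next
  case (Suc m)
  interpret T: Vector_Spaces.linear scale scale T by (rule T)
  have sub: "T ` span C \<subseteq> span C"
    using Suc.prems(3) T.span_image[of C] by (metis span_minimal subspace_span)
  obtain C' where C': "C' \<subseteq> T ` span C" "independent C'" "T ` span C \<subseteq> span C'"
    using basis_exists[of "T ` span C"] by metis
  have fin: "finite C'"
    using independent_span_bound[OF Suc.prems(2) C'(2)] C'(1) sub by auto
  have eq: "span C' = T ` span C"
    using C' by (metis T.subspace_image span_minimal subset_antisym subspace_span)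
  have "trace_on C T = trace_on C' T"
    using Suc.prems C' fin sub eq by (intro trace_on_subspace T) (auto intro: span_base)
  also have "\<dots> = 0"
  proof (rule Suc.IH[OF C'(2) fin])
    show "T ` C' \<subseteq> span C'" using C'(1) sub unfolding eq by blast
    fix v assume "v \<in> span C'"
    then obtain u where u: "u \<in> span C" "v = T u" unfolding eq by auto
    then show "(T ^^ m) v = 0" using Suc.prems(4)[of u] by (simp add: funpow_swap1)
  qed
  finally show ?case .
qed

end

locale fin_vect_space = vect_space scale + finite_dimensional_vector_space scale Basis
  for scale :: "'f::field \<Rightarrow> 'b::ab_group_add \<Rightarrow> 'b" (infixr \<open>*s\<close> 75) and Basis
begin

abbreviation trace :: "('b \<Rightarrow> 'b) \<Rightarrow> 'f" where "trace \<equiv> trace_on Basis"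

lemma trace_basis:
  assumes "independent C" "span C = UNIV" "Vector_Spaces.linear scale scale T"
  shows "trace T = trace_on C T"
  using assms finiteI_independent[of C] finite_Basis independent_Basis
  by (intro trace_on_subspace) (auto simp: span_Basis)

lemma trace_add: "trace (\<lambda>x. S x + T x) = trace S + trace T"
  by (simp add: trace_on_def representation_add independent_Basis span_Basis sum.distrib)

lemma trace_diff: "trace (\<lambda>x. S x - T x) = trace S - trace T"
  by (simp add: trace_on_def representation_diff independent_Basis span_Basis sum_subtractf)

lemma trace_scale: "trace (\<lambda>x. scale c (T x)) = c * trace T"
  by (simp add: trace_on_def representation_scale independent_Basis span_Basis sum_distrib_left)

lemma trace_zero: "trace (\<lambda>x. 0) = 0"
  by (simp add: trace_on_def representation_zero)

lemma representation_apply: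
  assumes T: "Vector_Spaces.linear scale scale T"
  shows "representation Basis (T x) b = (\<Sum>c\<in>Basis. representation Basis x c * representation Basis (T c) b)"
proof -
  interpret T: Vector_Spaces.linear scale scale T by (rule T)
  have "T x = T (\<Sum>c\<in>Basis. scale (representation Basis x c) c)"
    by (simp add: sum_representation_eq finite_Basis independent_Basis span_Basis)
  also have "\<dots> = (\<Sum>c\<in>Basis. scale (representation Basis x c) (T c))" by (simp add: T.sum T.scale)
  finally show ?thesis
    by (simp add: representation_sum representation_scale independent_Basis span_Basis)
qed

lemma trace_commute:
  assumes "Vector_Spaces.linear scale scale S" "Vector_Spaces.linear scale scale T"
  shows "trace (\<lambda>x. S (T x)) = trace (\<lambda>x. T (S x))"
  unfolding trace_on_def representation_apply[OF assms(1), of "T _"] representation_apply[OF assms(2), of "S _"]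
  by (rule trans[OF sum.swap]) (simp add: mult.commute)

text \<open>
  An idempotent is the identity on its range, and only the range contributes to the trace.
\<close>

lemma trace_idempotent:
  assumes T: "Vector_Spaces.linear scale scale T" and id: "\<And>x. T (T x) = T x"
  shows "trace T = of_nat (dim (range T))"
proof -
  interpret T: Vector_Spaces.linear scale scale T by (rule T)
  have sub: "subspace (range T)" by (simp add: T.subspace_image)
  obtain C where C: "finite C" "C \<subseteq> range T" "independent C" "span C = range T" "card C = dim (range T)"
    using basis_subspace_exists[OF sub] by metis
  have "trace T = trace_on C T"
    using C finite_Basis independent_Basis span_Basis by (intro trace_on_subspace T) auto
  also have "\<dots> = (\<Sum>c\<in>C. 1)"
    unfolding trace_on_def
  proof (rule sum.cong)
    fix c assume c: "c \<in> C"
    then have "T c = c" using C(2) id by auto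
    then show "representation C (T c) c = 1" using C(3) c by (simp add: representation_basis)
  qed simp
  finally show ?thesis using C by simp
qed

end

subsection \<open>Generalized eigenspaces\<close>

context vect_space
begin

definition eig_diff :: "('b \<Rightarrow> 'b) \<Rightarrow> 'f \<Rightarrow> 'b \<Rightarrow> 'b" where
  "eig_diff T \<mu> x = T x - scale \<mu> x"

definition gen_eigenspace :: "('b \<Rightarrow> 'b) \<Rightarrow> 'f \<Rightarrow> 'b set" where
  "gen_eigenspace T \<mu> = {v. \<exists>m. (eig_diff T \<mu> ^^ m) v = 0}"

context
  fixes T assumes T: "Vector_Spaces.linear scale scale T"
begin

interpretation T: Vector_Spaces.linear scale scale T by (rule T)

lemma linear_eig_diff: "Vector_Spaces.linear scale scale (eig_diff T \<mu>)"
  by unfold_locales (auto simp: eig_diff_def T.add T.scale scale_right_distrib scale_right_diff_distrib mult.commute)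

interpretation N: Vector_Spaces.linear scale scale "eig_diff T \<mu>" for \<mu> by (rule linear_eig_diff)
interpretation Np: Vector_Spaces.linear scale scale "eig_diff T \<mu> ^^ m" for \<mu> m
  by (rule linear_funpow, rule linear_eig_diff)

lemma eig_diff_commute: "eig_diff T \<mu> (eig_diff T \<nu> x) = eig_diff T \<nu> (eig_diff T \<mu> x)"
  by (simp add: eig_diff_def T.diff T.scale scale_right_diff_distrib mult.commute)

lemma eig_diff_funpow_commute: "(eig_diff T \<mu> ^^ m) (eig_diff T \<nu> x) = eig_diff T \<nu> ((eig_diff T \<mu> ^^ m) x)"
  by (induction m) (auto simp: eig_diff_commute[of \<mu> \<nu>])

lemma gen_eigenspace_mono: "(eig_diff T \<mu> ^^ m) v = 0 \<Longrightarrow> m \<le> n \<Longrightarrow> (eig_diff T \<mu> ^^ n) v = 0"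
  using funpow_add[of "n - m" m "eig_diff T \<mu>"] by (simp add: Np.zero)

lemma subspace_gen_eigenspace: "subspace (gen_eigenspace T \<mu>)"
proof (rule subspaceI)
  fix x y assume "x \<in> gen_eigenspace T \<mu>" "y \<in> gen_eigenspace T \<mu>"
  then obtain m n where "(eig_diff T \<mu> ^^ m) x = 0" "(eig_diff T \<mu> ^^ n) y = 0"
    by (auto simp: gen_eigenspace_def)
  then have "(eig_diff T \<mu> ^^ (m + n)) (x + y) = 0"
    by (simp add: Np.add gen_eigenspace_mono[of m \<mu> x] gen_eigenspace_mono[of n \<mu> y])
  then show "x + y \<in> gen_eigenspace T \<mu>" unfolding gen_eigenspace_def by blast
qed (auto simp: gen_eigenspace_def Np.scale Np.zero intro: exI[of _ 0])

lemma gen_eigenspace_eig_diff: "v \<in> gen_eigenspace T \<mu> \<Longrightarrow> eig_diff T \<nu> v \<in> gen_eigenspace T \<mu>"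
  unfolding gen_eigenspace_def mem_Collect_eq eig_diff_funpow_commute using N.zero by metis

lemma gen_eigenspace_funpow: "v \<in> gen_eigenspace T \<mu> \<Longrightarrow> (eig_diff T \<nu> ^^ k) v \<in> gen_eigenspace T \<mu>"
  by (induction k) (auto intro: gen_eigenspace_eig_diff)

lemma gen_eigenspace_eig_diff_iff: "eig_diff T \<mu> v \<in> gen_eigenspace T \<mu> \<longleftrightarrow> v \<in> gen_eigenspace T \<mu>"
proof
  assume "eig_diff T \<mu> v \<in> gen_eigenspace T \<mu>"
  then obtain m where "(eig_diff T \<mu> ^^ Suc m) v = 0"
    by (auto simp: gen_eigenspace_def eig_diff_funpow_commute)
  then show "v \<in> gen_eigenspace T \<mu>" unfolding gen_eigenspace_def by blast
qed (rule gen_eigenspace_eig_diff)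

lemma gen_eigenspace_inj:
  assumes "eig_diff T \<mu> v = 0" "v \<in> gen_eigenspace T \<nu>" "\<mu> \<noteq> \<nu>"
  shows "v = 0"
proof -
  have "eig_diff T \<nu> v = scale (\<mu> - \<nu>) v"
    using assms(1) by (simp add: eig_diff_def scale_left_diff_distrib)
  then have "(eig_diff T \<nu> ^^ m) v = scale ((\<mu> - \<nu>) ^ m) v" for m
    by (induction m) (auto simp: N.scale mult.commute)
  then show ?thesis using assms by (auto simp: gen_eigenspace_def)
qed

lemma gen_eigenspace_disjoint:
  assumes "v \<in> gen_eigenspace T \<mu>" "v \<in> gen_eigenspace T \<nu>" "\<mu> \<noteq> \<nu>"
  shows "v = 0"
proof -
  from assms(1) obtain m where "(eig_diff T \<mu> ^^ m) v = 0" by (auto simp: gen_eigenspace_def)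
  then show ?thesis using assms(2)
  proof (induction m arbitrary: v)
    case (Suc m)
    have "(eig_diff T \<mu> ^^ m) v = 0"
      by (rule gen_eigenspace_inj[OF _ gen_eigenspace_funpow[OF Suc.prems(2)] assms(3)]) (use Suc in simp)
    then show ?case using Suc by simp
  qed simp
qed

text \<open>
  On the generalized eigenspace of \<open>\<nu>\<close>, the operator \<open>T - \<mu>\<close> is a nonzero scalar plus a nilpotent operator.
\<close>

lemma gen_eigenspace_surj:
  assumes U: "subspace U" "T ` U \<subseteq> U" and "\<mu> \<noteq> \<nu>" and "v \<in> gen_eigenspace T \<nu>" "v \<in> U"
  shows "\<exists>x\<in>gen_eigenspace T \<nu> \<inter> U. eig_diff T \<mu> x = v"
proof -
  from assms(4) obtain m where "(eig_diff T \<nu> ^^ m) v = 0" by (auto simp: gen_eigenspace_def)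
  then show ?thesis using assms(4,5)
  proof (induction m arbitrary: v)
    case 0
    then show ?case using subspace_0[OF U(1)] subspace_0[OF subspace_gen_eigenspace]
      by (intro bexI[of _ 0]) (auto simp: N.zero)
  next
    case (Suc m)
    have "eig_diff T \<nu> v \<in> U"
      using Suc.prems U by (auto simp: eig_diff_def intro!: subspace_diff subspace_scale)
    then obtain x where x: "x \<in> gen_eigenspace T \<nu> \<inter> U" "eig_diff T \<mu> x = eig_diff T \<nu> v"
      using Suc.IH[of "eig_diff T \<nu> v"] Suc.prems gen_eigenspace_eig_diff
      by (auto simp: eig_diff_funpow_commute)
    \<comment> \<open>\<open>T - \<mu>\<close> equals \<open>\<nu> - \<mu>\<close> plus \<open>T - \<nu>\<close>, and \<open>x\<close> compensates for the second summand.\<close>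
    let ?y = "scale (inverse (\<nu> - \<mu>)) (v - x)"
    have "eig_diff T \<mu> (v - x) = scale (\<nu> - \<mu>) v"
      by (simp add: N.diff x(2)) (simp add: eig_diff_def scale_left_diff_distrib)
    then have "eig_diff T \<mu> ?y = v" using assms(3) by (simp add: N.scale)
    moreover have "?y \<in> gen_eigenspace T \<nu> \<inter> U"
      using x Suc.prems U subspace_gen_eigenspace
      by (auto intro!: subspace_scale subspace_diff)
    ultimately show ?case by blast
  qed
qed

text \<open>
  A power of \<open>T - \<nu>\<close> removes the component for \<open>\<nu>\<close> and is injective on the other generalized eigenspaces.
\<close>

lemma gen_eigenspace_independent:
  assumes "finite M" "\<And>\<mu>. \<mu> \<in> M \<Longrightarrow> y \<mu> \<in> gen_eigenspace T \<mu>" "(\<Sum>\<mu>\<in>M. y \<mu>) = 0" "\<mu> \<in> M"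
  shows "y \<mu> = 0"
  using assms
proof (induction M arbitrary: y \<mu> rule: finite_induct)
  case (insert \<nu> M)
  obtain m where m: "(eig_diff T \<nu> ^^ m) (y \<nu>) = 0"
    using insert.prems(1)[of \<nu>] by (auto simp: gen_eigenspace_def)
  have "(eig_diff T \<nu> ^^ m) (\<Sum>\<mu>\<in>insert \<nu> M. y \<mu>) = 0" using insert.prems by (simp add: Np.zero)
  then have s: "(\<Sum>\<mu>\<in>M. (eig_diff T \<nu> ^^ m) (y \<mu>)) = 0"
    using insert.hyps m by (simp add: Np.add Np.sum)
  have *: "y \<mu> = 0" if "\<mu> \<in> M" for \<mu>
  proof -
    have "(eig_diff T \<nu> ^^ m) (y \<mu>) = 0"
      using insert.IH[OF _ s that] insert.prems gen_eigenspace_funpow by auto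
    then have "y \<mu> \<in> gen_eigenspace T \<nu>" by (auto simp: gen_eigenspace_def)
    moreover have "\<mu> \<noteq> \<nu>" using that insert.hyps by auto
    ultimately show ?thesis using gen_eigenspace_disjoint[of "y \<mu>" \<mu> \<nu>] insert.prems that by auto
  qed
  then have "y \<nu> = 0" using insert.prems(2) insert.hyps by simp
  then show ?case using * insert.prems by auto
qed simp

text \<open>
  Induction on the number of linear factors. The components of \<open>(T - \<mu>) u\<close> for eigenvalues other than
  \<open>\<mu>\<close> have preimages under \<open>T - \<mu>\<close> in the same generalized eigenspaces. Subtracting these from \<open>u\<close>
  leaves a vector whose image under \<open>T - \<mu>\<close>, and hence which itself, lies in the space for \<open>\<mu>\<close>.
\<close>

lemma span_gen_eigenspaces_of_annihilator:
  assumes U: "subspace U" "T ` U \<subseteq> U"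
  shows "foldr (eig_diff T) \<mu>s u = 0 \<Longrightarrow> u \<in> U \<Longrightarrow> u \<in> span (\<Union>\<mu>. gen_eigenspace T \<mu> \<inter> U)"
proof (induction \<mu>s arbitrary: u rule: rev_induct)
  case (snoc \<mu> \<mu>s)
  let ?S = "\<Union>\<nu>. gen_eigenspace T \<nu> \<inter> U"
  have "eig_diff T \<mu> u \<in> U"
    using snoc.prems U by (auto simp: eig_diff_def intro!: subspace_diff subspace_scale)
  then have "eig_diff T \<mu> u \<in> span ?S" using snoc by simp
  then have "\<exists>z\<in>span ?S. z \<in> U \<and> eig_diff T \<mu> u - eig_diff T \<mu> z \<in> gen_eigenspace T \<mu>"
  proof (induction rule: span_induct_alt)
    case base
    show ?case using subspace_0[OF U(1)] subspace_0[OF subspace_gen_eigenspace]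
      by (intro bexI[of _ 0]) (auto simp: N.zero span_zero)
  next
    case (step c x y)
    then obtain z \<nu> where z: "z \<in> span ?S" "z \<in> U" "y - eig_diff T \<mu> z \<in> gen_eigenspace T \<mu>"
      and x: "x \<in> gen_eigenspace T \<nu>" "x \<in> U" by auto
    show ?case
    proof (cases "\<nu> = \<mu>")
      case True
      have "(scale c x + y) - eig_diff T \<mu> z = scale c x + (y - eig_diff T \<mu> z)" by simp
      also have "\<dots> \<in> gen_eigenspace T \<mu>"
        using z x True subspace_gen_eigenspace by (auto intro!: subspace_add subspace_scale)
      finally show ?thesis using z by blast
    next
      case False
      obtain w where w: "w \<in> gen_eigenspace T \<nu>" "w \<in> U" "eig_diff T \<mu> w = x"
        using gen_eigenspace_surj[OF U, of \<mu> \<nu> x] False x by auto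
      have "(scale c x + y) - eig_diff T \<mu> (scale c w + z) = y - eig_diff T \<mu> z"
        by (simp add: N.add N.scale w)
      moreover have "scale c w + z \<in> span ?S" "scale c w + z \<in> U"
        using w z U(1) by (auto intro!: span_add span_scale subspace_add subspace_scale intro: span_base)
      ultimately show ?thesis using z by metis
    qed
  qed
  then obtain z where z: "z \<in> span ?S" "z \<in> U" "eig_diff T \<mu> (u - z) \<in> gen_eigenspace T \<mu>"
    by (auto simp: N.diff)
  then have "u - z \<in> ?S" using gen_eigenspace_eig_diff_iff U snoc.prems by (auto intro: subspace_diff)
  then have "(u - z) + z \<in> span ?S" using span_add[OF span_base z(1)] by blast
  then show ?case by simp
qed (simp add: span_zero)

definition poly_at :: "'f poly \<Rightarrow> 'b \<Rightarrow> 'b" where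
  "poly_at q u = (\<Sum>i\<le>degree q. scale (coeff q i) ((T ^^ i) u))"

lemma poly_at_bound: "degree q \<le> n \<Longrightarrow> poly_at q u = (\<Sum>i\<le>n. scale (coeff q i) ((T ^^ i) u))"
  unfolding poly_at_def by (rule sum.mono_neutral_left) (auto simp: coeff_eq_0 not_le)

lemma poly_at_linear_factor: "poly_at ([:- \<mu>, 1:] * q) u = eig_diff T \<mu> (poly_at q u)"
proof -
  let ?n = "degree q"
  have "degree ([:- \<mu>, 1:] * q) \<le> Suc ?n"
    by (rule order_trans[OF degree_mult_le]) auto
  moreover have "[:- \<mu>, 1:] * q = Polynomial.smult (- \<mu>) q + pCons 0 q"
    by simp
  ultimately have "poly_at ([:- \<mu>, 1:] * q) u =
      (\<Sum>i\<le>Suc ?n. scale (- \<mu> * coeff q i + coeff (pCons 0 q) i) ((T ^^ i) u))"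
    by (simp add: poly_at_bound[of _ "Suc ?n"])
  also have "\<dots> = scale (- \<mu>) (\<Sum>i\<le>Suc ?n. scale (coeff q i) ((T ^^ i) u)) +
      (\<Sum>i\<le>Suc ?n. scale (coeff (pCons 0 q) i) ((T ^^ i) u))"
    by (simp add: scale_left_distrib scale_left_diff_distrib sum.distrib sum_subtractf sum_negf scale_sum_right scale_right_distrib)
  also have "(\<Sum>i\<le>Suc ?n. scale (coeff (pCons 0 q) i) ((T ^^ i) u)) = T (poly_at q u)"
    by (subst sum.atMost_Suc_shift) (simp add: poly_at_def T.sum T.scale)
  also have "(\<Sum>i\<le>Suc ?n. scale (coeff q i) ((T ^^ i) u)) = poly_at q u"
    by (simp add: poly_at_bound[of q "Suc ?n"])
  finally show ?thesis by (simp add: eig_diff_def)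
qed

end

end

text \<open>
  The vectors \<open>u, T u, T (T u), \<dots>\<close> are linearly dependent.
\<close>

lemma (in fin_vect_space) exists_annihilator:
  assumes T: "Vector_Spaces.linear scale scale T"
  shows "\<exists>q. q \<noteq> 0 \<and> poly_at T q u = 0"
proof -
  interpret vp: vector_space_pair "pm_scale :: 'f \<Rightarrow> (nat \<Rightarrow>\<^sub>0 'f) \<Rightarrow> _" scale ..
  let ?d = "card Basis"
  define X :: "(nat \<Rightarrow>\<^sub>0 'f) set" where "X = (\<lambda>i. Poly_Mapping.single i 1) ` {..?d}"
  have inj: "inj_on (\<lambda>i. Poly_Mapping.single i (1::'f)) {..?d}"
    by (rule inj_onI) (metis lookup_single_eq lookup_single_not_eq zero_neq_one)
  have "pm.independent X"
    unfolding pm.dependent_finite[of X, unfolded X_def, simplified] X_def[symmetric]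
  proof -
    show "pm.independent X"
    proof (rule pm.independent_if_scalars_zero)
      fix f x assume s: "(\<Sum>x\<in>X. pm_scale (f x) x) = 0" and "x \<in> X"
      then obtain i where i: "i \<le> ?d" "x = Poly_Mapping.single i 1" by (auto simp: X_def)
      have "(\<Sum>j\<le>?d. pm_scale (f (Poly_Mapping.single j 1)) (Poly_Mapping.single j (1::'f))) = 0"
        using s inj unfolding X_def by (simp add: sum.reindex)
      then have "Poly_Mapping.lookup (\<Sum>j\<le>?d. pm_scale (f (Poly_Mapping.single j 1)) (Poly_Mapping.single j (1::'f))) i = 0"
        by simp
      then show "f x = 0" using i by (simp add: lookup_sum lookup_single when_def if_distrib[of "(*) _"] cong: if_cong)
    qed (simp add: X_def)
  qed
  moreover have "card X = Suc ?d" using inj by (simp add: X_def card_image)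
  moreover have "Vector_Spaces.linear pm_scale (*) (\<lambda>p. representation Basis (lin_ext scale (\<lambda>i. (T ^^ i) u) p) b)" for b
  proof -
    interpret v: Vector_Spaces.linear pm_scale scale "lin_ext scale (\<lambda>i. (T ^^ i) u)" by (rule linear_lin_ext)
    show ?thesis
      by unfold_locales (auto simp: v.add v.scale representation_add representation_scale independent_Basis span_Basis algebra_simps)
  qed
  ultimately obtain p where p: "p \<noteq> 0"
    "\<forall>b\<in>Basis. representation Basis (lin_ext scale (\<lambda>i. (T ^^ i) u) p) b = 0"
    using pm.common_kernel[of Basis "\<lambda>b p. representation Basis (lin_ext scale (\<lambda>i. (T ^^ i) u) p) b" X] finite_Basis
    by (auto simp: X_def)
  have z: "lin_ext scale (\<lambda>i. (T ^^ i) u) p = 0"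
    using sum_representation_eq[of Basis "lin_ext scale (\<lambda>i. (T ^^ i) u) p" Basis] p(2)
    by (simp add: finite_Basis independent_Basis span_Basis)
  define q where "q = (\<Sum>i\<in>Poly_Mapping.keys p. monom (Poly_Mapping.lookup p i) i)"
  have cq: "coeff q i = Poly_Mapping.lookup p i" for i
    by (simp add: q_def coeff_sum in_keys_iff)
  have "q \<noteq> 0"
  proof
    assume "q = 0"
    then have "Poly_Mapping.lookup p i = 0" for i using cq[of i] by simp
    then show False using p(1) by (metis poly_mapping_eqI lookup_zero)
  qed
  moreover have "poly_at T q u = 0"
  proof -
    have "Poly_Mapping.keys p \<subseteq> {..degree q}" by (auto simp: in_keys_iff cq[symmetric] intro: le_degree)
    then show ?thesis using z by (simp add: poly_at_def[OF T] cq lin_ext_superset[of "{..degree q}"])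
  qed
  ultimately show ?thesis by blast
qed

text \<open>
  Invariant subspaces \<open>U\<close> are included because an operator that is a scalar on each
  generalized eigenspace then preserves \<open>U\<close>; this is applied to ideals.
\<close>

lemma span_gen_eigenspaces:
  fixes scale :: "'f::alg_closed_field \<Rightarrow> 'a::ab_group_add \<Rightarrow> 'a"
  assumes fd: "finite_dimensional_vector_space scale B"
    and T: "Vector_Spaces.linear scale scale T"
    and U: "module.subspace scale U" "T ` U \<subseteq> U" and u: "u \<in> U"
  shows "u \<in> module.span scale (\<Union>\<mu>. vect_space.gen_eigenspace scale T \<mu> \<inter> U)"
proof -
  interpret finite_dimensional_vector_space scale B by (rule fd)
  interpret fin_vect_space scale B ..
  obtain q where q: "q \<noteq> 0" "poly_at T q u = 0" using exists_annihilator[OF T] by blast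
  from alg_closed_imp_factorization[OF q(1)] obtain A where
    A: "q = Polynomial.smult (lead_coeff q) (\<Prod>x\<in>#A. [:-x, 1:])" by blast
  obtain \<mu>s where \<mu>s: "mset \<mu>s = A" using ex_mset by blast
  have "poly_at T (Polynomial.smult c (\<Prod>x\<in>#mset \<mu>s. [:-x, 1:])) u = foldr (eig_diff T) \<mu>s (scale c u)" for c
  proof (induction \<mu>s)
    case Nil
    show ?case by (simp add: poly_at_def[OF T])
  next
    case (Cons \<mu> \<mu>s)
    have "Polynomial.smult c (\<Prod>x\<in>#mset (\<mu> # \<mu>s). [:-x, 1:]) = [:- \<mu>, 1:] * Polynomial.smult c (\<Prod>x\<in>#mset \<mu>s. [:-x, 1:])"
      by (simp add: Polynomial.smult_add_right)
    then show ?case using Cons by (simp only: poly_at_linear_factor[OF T] foldr_Cons o_apply)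
  qed
  then have "foldr (eig_diff T) \<mu>s (scale (lead_coeff q) u) = 0" using q(2) A \<mu>s by metis
  moreover have "scale (lead_coeff q) u \<in> U" using U u by (simp add: subspace_scale)
  ultimately have "scale (lead_coeff q) u \<in> span (\<Union>\<mu>. gen_eigenspace T \<mu> \<inter> U)"
    by (rule span_gen_eigenspaces_of_annihilator[OF T U])
  then have "scale (inverse (lead_coeff q)) (scale (lead_coeff q) u) \<in> span (\<Union>\<mu>. gen_eigenspace T \<mu> \<inter> U)"
    by (rule span_scale)
  then show ?thesis using q(1) by simp
qed

section \<open>Engel's theorem\<close>

context vect_space
begin

definition fun_scale :: "'f \<Rightarrow> ('x \<Rightarrow> 'b) \<Rightarrow> 'x \<Rightarrow> 'b" where
  "fun_scale c f = (\<lambda>x. scale c (f x))"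

lemma fun_scale_apply [simp]: "fun_scale c f x = scale c (f x)"
  by (simp add: fun_scale_def)

lemma vector_space_fun_scale: "vector_space (fun_scale :: 'f \<Rightarrow> ('x \<Rightarrow> 'b) \<Rightarrow> 'x \<Rightarrow> 'b)"
  by unfold_locales (auto simp: fun_eq_iff scale_right_distrib scale_left_distrib)

definition commutator :: "('b \<Rightarrow> 'b) \<Rightarrow> ('b \<Rightarrow> 'b) \<Rightarrow> 'b \<Rightarrow> 'b" where
  "commutator A B = (\<lambda>x. A (B x) - B (A x))"

definition products_vanish :: "nat \<Rightarrow> ('b \<Rightarrow> 'b) set \<Rightarrow> bool" where
  "products_vanish m H \<longleftrightarrow> (\<forall>xs x. set xs \<subseteq> H \<longrightarrow> length xs = m \<longrightarrow> foldr id xs x = 0)"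

lemma products_vanishD:
  assumes "products_vanish m H" "set xs \<subseteq> H" "m \<le> length xs"
  shows "foldr id xs x = 0"
proof -
  have "foldr id (take m xs) (foldr id (drop m xs) x) = 0"
    using assms set_take_subset[of m xs] by (auto simp: products_vanish_def min_def)
  then show ?thesis by (metis append_take_drop_id foldr_append o_apply)
qed

lemma linear_foldr:
  "(\<And>T. T \<in> set xs \<Longrightarrow> Vector_Spaces.linear scale scale T) \<Longrightarrow> Vector_Spaces.linear scale scale (foldr id xs)"
proof (induction xs)
  case Nil
  show ?case by (simp add: Vector_Spaces.linear_iff vector_space_axioms)
next
  case (Cons T xs)
  then show ?case
    using Vector_Spaces.linear_compose[of scale scale "foldr id xs" scale T] by (simp add: o_def id_def)
qed

text \<open>
  Otherwise commutators with elements of \<open>H\<close> could be iterated without ever entering \<open>H\<close>. After \<open>2 m\<close>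
  steps such a commutator expands into products that have \<open>m\<close> factors from \<open>H\<close> on one side,
  so it is \<open>0\<close> and does lie in \<open>H\<close>.
\<close>

lemma normalizer_grows:
  assumes S: "\<And>T. T \<in> S \<Longrightarrow> Vector_Spaces.linear scale scale T"
    and comm: "\<And>A B. A \<in> S \<Longrightarrow> B \<in> S \<Longrightarrow> commutator A B \<in> S"
    and H: "H \<subseteq> S" "H \<noteq> S" "0 \<in> H" "products_vanish m H"
  shows "\<exists>a\<in>S - H. \<forall>h\<in>H. commutator h a \<in> H"
proof (rule ccontr)
  assume no: "\<not> ?thesis"
  have lin: "Vector_Spaces.linear scale scale (foldr id xs)" if "set xs \<subseteq> H" for xs
    using that S H(1) by (intro linear_foldr) auto
  have "\<exists>z\<in>S - H. \<forall>xs ys x. set xs \<subseteq> H \<longrightarrow> set ys \<subseteq> H \<longrightarrow> 2 * m \<le> length xs + length ys + k \<longrightarrow>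
      foldr id xs (z (foldr id ys x)) = 0" for k
  proof (induction k)
    case 0
    obtain z where z: "z \<in> S - H" using H by auto
    have "foldr id xs (z (foldr id ys x)) = 0"
      if "set xs \<subseteq> H" "set ys \<subseteq> H" "2 * m \<le> length xs + length ys" for xs ys x
    proof (cases "m \<le> length xs")
      case True
      then show ?thesis using products_vanishD H that by blast
    next
      case False
      then have "foldr id ys x = 0" using products_vanishD[OF H(4), of ys] that by auto
      moreover have "z 0 = 0" using S[of z] z module_hom.zero[of scale scale z]
        by (auto simp: linear_iff_module_hom Vector_Spaces.linear_def)
      moreover have "foldr id xs 0 = 0"
        using lin[OF that(1)] by (auto simp: Vector_Spaces.linear_def intro: module_hom.zero)
      ultimately show ?thesis by simp
    qed
    then show ?case using z by (metis add_0_right)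
  next
    case (Suc k)
    then obtain z where z: "z \<in> S - H"
      "\<And>xs ys x. set xs \<subseteq> H \<Longrightarrow> set ys \<subseteq> H \<Longrightarrow> 2 * m \<le> length xs + length ys + k \<Longrightarrow>
      foldr id xs (z (foldr id ys x)) = 0" by blast
    obtain h where h: "h \<in> H" "commutator h z \<notin> H" using no z(1) by blast
    have "foldr id xs (commutator h z (foldr id ys x)) = 0"
      if "set xs \<subseteq> H" "set ys \<subseteq> H" "2 * m \<le> length xs + length ys + Suc k" for xs ys x
    proof -
      interpret l: Vector_Spaces.linear scale scale "foldr id xs" by (rule lin[OF that(1)])
      show ?thesis
        using z(2)[of "xs @ [h]" ys x] z(2)[of xs "h # ys" x] that h
        by (simp add: commutator_def l.diff)
    qed
    then show ?case using h z comm[of h z] H by blast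
  qed
  from this[of "2 * m"] obtain z where z: "z \<in> S - H"
    "\<And>xs ys x. set xs \<subseteq> H \<Longrightarrow> set ys \<subseteq> H \<Longrightarrow> foldr id xs (z (foldr id ys x)) = 0"
    by (metis le_add2)
  have "z = 0" using z(2)[of "[]" "[]"] by (auto simp: fun_eq_iff)
  then show False using z H by auto
qed

text \<open>
  Let \<open>V i\<close> consist of the vectors that all products of \<open>i\<close> elements of \<open>H\<close> annihilate. Then \<open>a\<close> preserves
  \<open>V i\<close>, and \<open>H\<close> maps \<open>V (Suc i)\<close> into \<open>V i\<close>. Modulo \<open>V i\<close>, a product of \<open>r\<close> elements of \<open>H'\<close> acts on
  \<open>V (Suc i)\<close> as a multiple of the \<open>r\<close>-th power of \<open>a\<close>, which is \<open>0\<close>.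
\<close>

lemma products_vanish_extend:
  assumes lin: "\<And>T. T \<in> H \<Longrightarrow> Vector_Spaces.linear scale scale T" "Vector_Spaces.linear scale scale a"
    and H: "products_vanish m H" "0 \<in> H" and norm: "\<And>h. h \<in> H \<Longrightarrow> commutator h a \<in> H"
    and a: "\<And>x. (a ^^ r) x = 0"
    and H': "\<And>z. z \<in> H' \<Longrightarrow> \<exists>h\<in>H. \<exists>t. z = (\<lambda>x. h x + scale t (a x))"
  shows "products_vanish (r * m) H'"
proof -
  interpret a: Vector_Spaces.linear scale scale a by (rule lin(2))
  define V where "V i = {v. \<forall>xs. set xs \<subseteq> H \<longrightarrow> length xs = i \<longrightarrow> foldr id xs v = 0}" for i
  have linf: "Vector_Spaces.linear scale scale (foldr id xs)" if "set xs \<subseteq> H" for xs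
    using that lin by (intro linear_foldr) auto
  have subV: "subspace (V i)" for i
  proof (rule subspaceI)
    show "0 \<in> V i" unfolding V_def
      using linf by (auto simp: Vector_Spaces.linear_def intro: module_hom.zero)
    show "x + y \<in> V i" if "x \<in> V i" "y \<in> V i" for x y
      using that linf unfolding V_def by (auto simp: Vector_Spaces.linear_iff)
    show "scale c x \<in> V i" if "x \<in> V i" for c x
      using that linf unfolding V_def by (auto simp: Vector_Spaces.linear_iff)
  qed
  have HV: "h v \<in> V i" if "h \<in> H" "v \<in> V (Suc i)" for h v i
    unfolding V_def
  proof (intro CollectI allI impI)
    fix xs assume "set xs \<subseteq> H" "length xs = i"
    then have "foldr id (xs @ [h]) v = 0" using that unfolding V_def by (simp del: foldr_append)
    then show "foldr id xs (h v) = 0" by simp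
  qed
  have mono: "v \<in> V (Suc i)" if "v \<in> V i" for v i
    unfolding V_def
  proof (intro CollectI allI impI)
    fix xs assume xs: "set xs \<subseteq> H" "length xs = Suc i"
    then obtain x ys where "xs = x # ys" by (cases xs) auto
    then show "foldr id xs v = 0" using xs that lin(1)[of x] unfolding V_def
      by (auto simp: Vector_Spaces.linear_def intro: module_hom.zero)
  qed
  have aV: "a v \<in> V i" if "v \<in> V i" for v i
    using that
  proof (induction i arbitrary: v)
    case 0
    then show ?case by (auto simp: V_def a.zero)
  next
    case (Suc i)
    show ?case unfolding V_def
    proof (intro CollectI allI impI)
      fix xs assume xs: "set xs \<subseteq> H" "length xs = Suc i"
      then obtain ys h where ys: "xs = ys @ [h]" by (metis length_Suc_conv_rev)
      interpret l: Vector_Spaces.linear scale scale "foldr id ys" by (rule linf) (use xs ys in auto)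
      have "h \<in> H" "set ys \<subseteq> H" using xs ys by auto
      then have 1: "foldr id ys (a (h v)) = 0"
        using Suc.IH[OF HV[OF _ Suc.prems]] xs ys by (auto simp: V_def)
      have 2: "foldr id (ys @ [commutator h a]) v = 0"
        using Suc.prems xs ys norm[OF \<open>h \<in> H\<close>] by (simp add: V_def del: foldr_append)
      have "h (a v) = a (h v) + commutator h a v" by (simp add: commutator_def)
      then show "foldr id xs (a v) = 0" using 1 2 by (simp add: ys l.add)
    qed
  qed
  have B: "foldr id zs v \<in> V (Suc i) \<and> (\<exists>c. foldr id zs v - scale c ((a ^^ length zs) v) \<in> V i)"
    if "set zs \<subseteq> H'" "v \<in> V (Suc i)" for zs v i
    using that(1)
  proof (induction zs)
    case Nil
    show ?case using that(2) subspace_0[OF subV] by (auto intro: exI[of _ 1])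
  next
    case (Cons z zs)
    let ?u = "foldr id zs v" and ?l = "length zs"
    obtain c where c: "?u - scale c ((a ^^ ?l) v) \<in> V i" and u: "?u \<in> V (Suc i)"
      using Cons.IH Cons.prems by (metis insert_subset list.simps(15))
    obtain h t where h: "h \<in> H" "z = (\<lambda>x. h x + scale t (a x))" using H' Cons.prems by (meson list.set_intros(1) subsetD)
    have hu: "h ?u \<in> V i" using HV h u by blast
    have "z ?u - scale (t * c) ((a ^^ Suc ?l) v) = h ?u + scale t (a (?u - scale c ((a ^^ ?l) v)))"
      by (simp add: h(2) a.diff a.scale scale_right_diff_distrib)
    also have "\<dots> \<in> V i" using hu aV[OF c] subV by (auto intro: subspace_add subspace_scale)
    finally have "\<exists>c. foldr id (z # zs) v - scale c ((a ^^ length (z # zs)) v) \<in> V i" by auto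
    moreover have "foldr id (z # zs) v \<in> V (Suc i)"
      using mono[OF hu] aV[OF u] subV by (auto simp: h(2) intro: subspace_add subspace_scale)
    ultimately show ?case by blast
  qed
  have C: "foldr id zs v = 0" if "set zs \<subseteq> H'" "length zs = r * i" "v \<in> V i" for zs v i
    using that
  proof (induction i arbitrary: zs v)
    case 0
    then show ?case by (auto simp: V_def)
  next
    case (Suc i)
    let ?xs = "take (r * i) zs" and ?ys = "drop (r * i) zs"
    have "set ?ys \<subseteq> H'" "set ?xs \<subseteq> H'" using Suc.prems(1) set_drop_subset[of "r*i" zs] set_take_subset[of "r*i" zs] by auto
    moreover have "length ?ys = r" using Suc.prems(2) by simp
    ultimately have "foldr id ?ys v \<in> V i" using B[of ?ys v i] Suc.prems(3) a by (auto)
    then have "foldr id ?xs (foldr id ?ys v) = 0" using Suc.prems \<open>set ?xs \<subseteq> H'\<close> by (intro Suc.IH) auto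
    then show ?case by (metis append_take_drop_id foldr_append o_apply)
  qed
  have "v \<in> V m" for v using H(1) by (auto simp: V_def products_vanish_def)
  then show ?thesis unfolding products_vanish_def using C by blast
qed

text \<open>
  A subspace of \<open>S\<close> that is closed under commutators, has vanishing long products and is as large as
  possible must be \<open>S\<close>: an element that normalizes it could be adjoined.
\<close>

theorem engel:
  assumes sub: "module.subspace fun_scale S" and fin: "finite F" "S \<subseteq> module.span fun_scale F"
    and lin: "\<And>T. T \<in> S \<Longrightarrow> Vector_Spaces.linear scale scale T"
    and comm: "\<And>A B. A \<in> S \<Longrightarrow> B \<in> S \<Longrightarrow> commutator A B \<in> S"
    and nil: "\<And>T. T \<in> S \<Longrightarrow> \<exists>m. \<forall>x. (T ^^ m) x = 0"
  shows "\<exists>m. products_vanish m S"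
proof -
  interpret fs: vector_space "fun_scale :: 'f \<Rightarrow> ('b \<Rightarrow> 'b) \<Rightarrow> _" by (rule vector_space_fun_scale)
  define good where "good X \<longleftrightarrow> X \<subseteq> S \<and> fs.independent X \<and>
      (\<forall>A\<in>fs.span X. \<forall>B\<in>fs.span X. commutator A B \<in> fs.span X) \<and> (\<exists>m. products_vanish m (fs.span X))" for X
  have bound: "card X \<le> card F" if "good X" for X
    using that fs.independent_span_bound[OF fin(1), of X] fin(2) unfolding good_def by blast
  have lin0: "A 0 = 0" if "A \<in> S" for A
    using lin[OF that] by (auto simp: Vector_Spaces.linear_def intro: module_hom.zero)
  have "good {}"
  proof -
    have "products_vanish 1 {0 :: 'b \<Rightarrow> 'b}"
      unfolding products_vanish_def by (auto simp: length_Suc_conv)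
    then show ?thesis using fs.subspace_0[OF sub]
        fs.independent_empty
      unfolding good_def by (auto simp: commutator_def zero_fun_def intro: exI[of _ 1])
  qed
  then obtain X where X: "good X" "\<And>Y. good Y \<Longrightarrow> card Y \<le> card X"
    using ex_has_greatest_nat[of good "{}" card "Suc (card F)"] bound by (metis le_imp_less_Suc)
  let ?H = "fs.span X"
  obtain m where m: "products_vanish m ?H" using X(1) good_def by blast
  have HS: "?H \<subseteq> S" using X(1) sub unfolding good_def by (metis fs.span_minimal)
  show ?thesis
  proof (cases "?H = S")
    case False
    obtain a where a: "a \<in> S" "a \<notin> ?H" "\<And>h. h \<in> ?H \<Longrightarrow> commutator h a \<in> ?H"
      using normalizer_grows[OF lin comm HS False fs.span_zero m] by blast
    obtain r where r: "\<And>x. (a ^^ r) x = 0" using nil a(1) by blast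
    have shape: "\<exists>h\<in>?H. \<exists>t. z = (\<lambda>x. h x + scale t (a x))" if z: "z \<in> fs.span (insert a X)" for z
    proof -
      obtain k where "z - fun_scale k a \<in> ?H" using z unfolding fs.span_breakdown_eq by blast
      moreover have "z = (\<lambda>x. (z - fun_scale k a) x + scale k (a x))" by (auto simp: fun_eq_iff)
      ultimately show ?thesis by blast
    qed
    have "products_vanish (r * m) (fs.span (insert a X))"
      by (rule products_vanish_extend[OF _ _ m fs.span_zero a(3) r shape]) (use lin a HS in auto)
    moreover have "commutator A B \<in> fs.span (insert a X)"
      if AB: "A \<in> fs.span (insert a X)" "B \<in> fs.span (insert a X)" for A B
    proof -
      obtain h1 t1 h2 t2 where h: "h1 \<in> ?H" "A = (\<lambda>x. h1 x + scale t1 (a x))"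
        "h2 \<in> ?H" "B = (\<lambda>x. h2 x + scale t2 (a x))"
        using shape[OF AB(1)] shape[OF AB(2)] by blast
      interpret h1: Vector_Spaces.linear scale scale h1 using lin HS h by blast
      interpret h2: Vector_Spaces.linear scale scale h2 using lin HS h by blast
      interpret a: Vector_Spaces.linear scale scale a using lin a by blast
      have "commutator A B = commutator h1 h2 + fun_scale t2 (commutator h1 a) - fun_scale t1 (commutator h2 a)"
        by (auto simp: fun_eq_iff h commutator_def h1.add h1.scale h2.add h2.scale a.add a.scale
            scale_right_diff_distrib scale_right_distrib mult.commute algebra_simps)
      also have "\<dots> \<in> ?H"
        using X(1) h a(3) unfolding good_def by (intro fs.span_add fs.span_diff fs.span_scale) auto
      also have "?H \<subseteq> fs.span (insert a X)" by (intro fs.span_mono) auto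
      finally show ?thesis .
    qed
    moreover have "fs.independent (insert a X)"
      using X(1) a(2) fs.independent_insertI unfolding good_def by blast
    ultimately have "good (insert a X)"
      using X(1) a(1) unfolding good_def by blast
    moreover have "finite X"
      using X(1) fs.independent_span_bound[OF fin(1), of X] fin(2) unfolding good_def by blast
    moreover have "a \<notin> X" using a(2) fs.span_base by blast
    ultimately show ?thesis using X(2)[of "insert a X"] by simp
  qed (use m in blast)
qed

end

section \<open>The trace form\<close>

text \<open>
  A field of characteristic \<open>0\<close> is a vector space over the rational numbers.
\<close>

lemma exists_rational_functional:
  fixes \<mu> :: "'f::field_char_0"
  assumes "\<mu> \<noteq> 0"
  shows "\<exists>f :: 'f \<Rightarrow> rat. (\<forall>a b. f (a + b) = f a + f b) \<and> (\<forall>r a. f (of_rat r * a) = r * f a) \<and> f \<mu> = 1"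
proof -
  interpret q: vector_space "\<lambda>r (x::'f). of_rat r * x"
    by unfold_locales (auto simp: algebra_simps of_rat_add of_rat_mult)
  interpret r: vector_space "(*) :: rat \<Rightarrow> rat \<Rightarrow> rat"
    by unfold_locales (auto simp: algebra_simps)
  interpret vp: vector_space_pair "\<lambda>r (x::'f). of_rat r * x" "(*) :: rat \<Rightarrow> rat \<Rightarrow> rat" ..
  have "q.independent {\<mu>}" using assms by simp
  from vp.linear_independent_extend[OF this, of "\<lambda>_. 1"]
  show ?thesis by (auto simp: Vector_Spaces.linear_iff)
qed

text \<open>
  \<open>M\<close> is the set of eigenvalues and \<open>n \<mu>\<close> the dimension of the generalized eigenspace of \<open>\<mu>\<close>. On this
  space \<open>D\<close> is the scalar \<open>\<phi> \<mu>\<close> and \<open>T\<close> is \<open>\<mu>\<close> plus a nilpotent operator, which has trace \<open>0\<close>.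
\<close>

lemma eigenvalue_scaling:
  fixes scale :: "'f::alg_closed_field \<Rightarrow> 'a::ab_group_add \<Rightarrow> 'a" and \<phi> :: "'f \<Rightarrow> 'f"
  assumes fd: "fin_vect_space scale B" and T: "Vector_Spaces.linear scale scale T"
  shows "\<exists>D M n. Vector_Spaces.linear scale scale D \<and>
    (\<forall>\<mu>. \<forall>v\<in>vect_space.gen_eigenspace scale T \<mu>. D v = scale (\<phi> \<mu>) v) \<and>
    finite M \<and> (\<forall>\<mu>\<in>M. n \<mu> \<noteq> (0::nat)) \<and>
    (\<forall>\<mu>. \<forall>v\<in>vect_space.gen_eigenspace scale T \<mu>. v \<noteq> 0 \<longrightarrow> \<mu> \<in> M) \<and>
    vect_space.trace_on scale B (\<lambda>x. D (T x)) = (\<Sum>\<mu>\<in>M. of_nat (n \<mu>) * \<phi> \<mu> * \<mu>)"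
proof -
  interpret fin_vect_space scale B by (rule fd)
  interpret T: Vector_Spaces.linear scale scale T by (rule T)
  let ?E = "gen_eigenspace T"
  have fvs: "finite_dimensional_vector_space scale B" ..
  obtain C where C: "C \<subseteq> (\<Union>\<mu>. ?E \<mu>)" "independent C" "(\<Union>\<mu>. ?E \<mu>) \<subseteq> span C"
    using maximal_independent_subset by metis
  have "x \<in> span (\<Union>\<mu>. ?E \<mu>)" for x
    using span_gen_eigenspaces[OF fvs T, of UNIV x] by simp
  moreover have "span (\<Union>\<mu>. ?E \<mu>) \<subseteq> span C" by (rule span_minimal[OF C(3) subspace_span])
  ultimately have spanC: "span C = UNIV" by blast
  have finC: "finite C" using C(2) by (rule finiteI_independent)
  define ev where "ev c = (SOME \<mu>. c \<in> ?E \<mu>)" for c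
  have ev: "c \<in> ?E (ev c)" if "c \<in> C" for c
    unfolding ev_def by (rule someI_ex) (use C(1) that in auto)
  define M where "M = ev ` C"
  define Cm where "Cm \<mu> = {c \<in> C. ev c = \<mu>}" for \<mu>
  have finM: "finite M" using finC by (simp add: M_def)
  have CmE: "span (Cm \<mu>) \<subseteq> ?E \<mu>" for \<mu>
    by (rule span_minimal) (use ev subspace_gen_eigenspace[OF T] in \<open>auto simp: Cm_def\<close>)
  have E_Cm: "v \<in> span (Cm \<mu>) \<and> (v \<noteq> 0 \<longrightarrow> \<mu> \<in> M)" if v: "v \<in> ?E \<mu>" for v \<mu>
  proof -
    define y where "y \<nu> = (\<Sum>c\<in>Cm \<nu>. scale (representation C v c) c)" for \<nu>
    have y: "y \<nu> \<in> span (Cm \<nu>)" for \<nu>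
      unfolding y_def by (intro span_sum span_scale) (auto intro: span_base)
    have "v = (\<Sum>c\<in>C. scale (representation C v c) c)"
      using C(2) finC spanC by (simp add: sum_representation_eq)
    also have "\<dots> = (\<Sum>\<nu>\<in>M. y \<nu>)"
      unfolding y_def M_def Cm_def by (rule sum.image_gen[OF finC])
    also have "\<dots> = (\<Sum>\<nu>\<in>insert \<mu> M. y \<nu>)"
      by (rule sum.mono_neutral_left) (use finM in \<open>auto simp: y_def Cm_def M_def intro!: sum.neutral\<close>)
    finally have vs: "v = (\<Sum>\<nu>\<in>insert \<mu> M. y \<nu>)" .
    have 0: "(\<Sum>\<nu>\<in>insert \<mu> M. if \<nu> = \<mu> then y \<nu> - v else y \<nu>) = 0"
    proof -
      have "(\<Sum>\<nu>\<in>insert \<mu> M. if \<nu> = \<mu> then y \<nu> - v else y \<nu>) =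
          (\<Sum>\<nu>\<in>insert \<mu> M. y \<nu> - (if \<nu> = \<mu> then v else 0))" by (rule sum.cong) auto
      also have "\<dots> = (\<Sum>\<nu>\<in>insert \<mu> M. y \<nu>) - v"
        using finM by (subst sum_subtractf) (subst sum.delta, auto)
      finally show ?thesis using vs by simp
    qed
    have yE: "y \<nu> \<in> ?E \<nu>" for \<nu> using y CmE by blast
    have "(if \<nu> = \<mu> then y \<nu> - v else y \<nu>) \<in> ?E \<nu>" for \<nu>
      using yE v subspace_diff[OF subspace_gen_eigenspace[OF T]] by simp
    then have "(if \<mu> = \<mu> then y \<mu> - v else y \<mu>) = 0"
      by (intro gen_eigenspace_independent[OF T _ _ 0]) (use finM in auto)
    then have "y \<mu> - v = 0" by simp
    then have "v = y \<mu>" by simp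
    moreover have "\<mu> \<in> M" if "y \<mu> \<noteq> 0"
    proof (rule ccontr)
      assume "\<mu> \<notin> M"
      then have "Cm \<mu> = {}" by (auto simp: Cm_def M_def)
      then show False using that by (simp add: y_def)
    qed
    ultimately show ?thesis using y by auto
  qed
  interpret vp: vector_space_pair scale scale ..
  obtain D where D: "Vector_Spaces.linear scale scale D" "\<And>c. c \<in> C \<Longrightarrow> D c = scale (\<phi> (ev c)) c"
    using vp.linear_independent_extend[OF C(2), of "\<lambda>c. scale (\<phi> (ev c)) c"] by blast
  interpret D: Vector_Spaces.linear scale scale D by (rule D(1))
  have DE: "D v = scale (\<phi> \<mu>) v" if "v \<in> ?E \<mu>" for v \<mu>
    using E_Cm[OF that, THEN conjunct1]
  proof (induction rule: span_induct_alt)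
    case (step c x y)
    then have "D x = scale (\<phi> \<mu>) x" using D(2)[of x] by (auto simp: Cm_def)
    then show ?case using step by (simp add: D.add D.scale scale_right_distrib mult.commute)
  qed (simp add: D.zero)
  have TE: "T v \<in> ?E \<mu>" if "v \<in> ?E \<mu>" for v \<mu>
    using gen_eigenspace_eig_diff[OF T that, of 0] by (simp add: eig_diff_def)
  have indCm: "independent (Cm \<mu>)" "finite (Cm \<mu>)" for \<mu>
    using C(2) finC independent_mono[of C "Cm \<mu>"] by (auto simp: Cm_def)
  have tr: "trace_on (Cm \<mu>) T = of_nat (card (Cm \<mu>)) * \<mu>" for \<mu>
  proof -
    let ?N = "eig_diff T \<mu>"
    have N: "Vector_Spaces.linear scale scale ?N" by (rule linear_eig_diff[OF T])
    have "\<exists>m. \<forall>c\<in>Cm \<mu>. (?N ^^ m) c = 0"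
    proof -
      have "\<forall>c\<in>Cm \<mu>. \<exists>m. (?N ^^ m) c = 0"
        using CmE[of \<mu>] span_base by (fastforce simp: gen_eigenspace_def)
      then obtain m where m: "\<And>c. c \<in> Cm \<mu> \<Longrightarrow> (?N ^^ m c) c = 0" by metis
      have "(?N ^^ Max (m ` Cm \<mu>)) c = 0" if "c \<in> Cm \<mu>" for c
        using gen_eigenspace_mono[OF T m[OF that]] that indCm(2) by simp
      then show ?thesis by blast
    qed
    then obtain m where m: "\<And>c. c \<in> Cm \<mu> \<Longrightarrow> (?N ^^ m) c = 0" by blast
    interpret Nm: Vector_Spaces.linear scale scale "?N ^^ m" by (rule linear_funpow[OF N])
    have nil: "(?N ^^ m) v = 0" if "v \<in> span (Cm \<mu>)" for v
      using that by (induction rule: span_induct_alt) (auto simp: Nm.zero Nm.add Nm.scale m)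
    have "?N c \<in> span (Cm \<mu>)" if "c \<in> Cm \<mu>" for c
      using E_Cm gen_eigenspace_eig_diff[OF T] CmE[of \<mu>] span_base[OF that] by blast
    then have 0: "trace_on (Cm \<mu>) ?N = 0"
      by (intro trace_on_nilpotent[OF indCm N _ nil]) auto
    have "representation (Cm \<mu>) (T c) c = representation (Cm \<mu>) (?N c) c + \<mu>" if "c \<in> Cm \<mu>" for c
    proof -
      have "T c = ?N c + scale \<mu> c" by (simp add: eig_diff_def)
      then show ?thesis
        using that span_base[OF that] \<open>\<And>c. c \<in> Cm \<mu> \<Longrightarrow> ?N c \<in> span (Cm \<mu>)\<close>
        by (simp add: representation_add representation_scale indCm span_scale representation_basis)
    qed
    then have "trace_on (Cm \<mu>) T = (\<Sum>c\<in>Cm \<mu>. representation (Cm \<mu>) (?N c) c + \<mu>)"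
      unfolding trace_on_def by (intro sum.cong) auto
    then show ?thesis using 0 by (simp add: trace_on_def sum.distrib)
  qed
  have "trace_on B (\<lambda>x. D (T x)) = trace_on C (\<lambda>x. D (T x))"
    by (rule trace_basis[OF C(2) spanC]) (unfold_locales; simp add: D.add D.scale T.add T.scale)
  also have "\<dots> = (\<Sum>\<mu>\<in>M. \<Sum>c\<in>Cm \<mu>. representation C (D (T c)) c)"
    unfolding M_def Cm_def trace_on_def by (rule sum.image_gen[OF finC])
  also have "\<dots> = (\<Sum>\<mu>\<in>M. of_nat (card (Cm \<mu>)) * \<phi> \<mu> * \<mu>)"
  proof (rule sum.cong)
    fix \<mu>
    have "(\<Sum>c\<in>Cm \<mu>. representation C (D (T c)) c) = (\<Sum>c\<in>Cm \<mu>. \<phi> \<mu> * representation (Cm \<mu>) (T c) c)"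
    proof (rule sum.cong)
      fix c assume c: "c \<in> Cm \<mu>"
      have Tc: "T c \<in> ?E \<mu>" using TE CmE[of \<mu>] span_base[OF c] by blast
      have "representation C (T c) = representation (Cm \<mu>) (T c)"
        by (rule representation_extend[OF C(2)]) (use E_Cm[OF Tc] in \<open>auto simp: Cm_def\<close>)
      then show "representation C (D (T c)) c = \<phi> \<mu> * representation (Cm \<mu>) (T c) c"
        by (simp add: DE[OF Tc] representation_scale C(2) spanC)
    qed simp
    also have "\<dots> = \<phi> \<mu> * trace_on (Cm \<mu>) T" by (simp add: trace_on_def sum_distrib_left)
    finally show "(\<Sum>c\<in>Cm \<mu>. representation C (D (T c)) c) = of_nat (card (Cm \<mu>)) * \<phi> \<mu> * \<mu>"
      by (simp add: tr)
  qed simp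
  finally have "trace_on B (\<lambda>x. D (T x)) = (\<Sum>\<mu>\<in>M. of_nat (card (Cm \<mu>)) * \<phi> \<mu> * \<mu>)" .
  moreover have "card (Cm \<mu>) \<noteq> 0" if "\<mu> \<in> M" for \<mu>
    using that indCm(2)[of \<mu>] by (auto simp: M_def Cm_def)
  moreover have "\<mu> \<in> M" if "v \<in> ?E \<mu>" "v \<noteq> 0" for \<mu> v
    using E_Cm that by blast
  ultimately show ?thesis using D(1) DE finM by (intro exI[of _ D] exI[of _ M] exI[of _ "\<lambda>\<mu>. card (Cm \<mu>)"]) blast
qed

text \<open>
  The group enters only through the set of operators by which it acts.
\<close>

locale alg_ops = fin_vect_space scale Basis + nonassoc_algebra scale mul
  for scale :: "'f::{alg_closed_field, field_char_0} \<Rightarrow> 'a::ab_group_add \<Rightarrow> 'a"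
    and Basis :: "'a set" and mul :: "'a \<Rightarrow> 'a \<Rightarrow> 'a" (infixl \<open>\<star>\<close> 70) +
  fixes Ops :: "('a \<Rightarrow> 'a) set"
  assumes op_id: "(\<lambda>x. x) \<in> Ops"
    and op_comp: "g \<in> Ops \<Longrightarrow> h \<in> Ops \<Longrightarrow> (\<lambda>x. g (h x)) \<in> Ops"
    and op_inv: "g \<in> Ops \<Longrightarrow> \<exists>h\<in>Ops. (\<forall>x. h (g x) = x) \<and> (\<forall>x. g (h x) = x)"
    and op_linear: "g \<in> Ops \<Longrightarrow> Vector_Spaces.linear scale scale g"
    and op_mul: "g \<in> Ops \<Longrightarrow> (\<forall>x y. g (x \<star> y) = g x \<star> g y) \<or> (\<forall>x y. g (x \<star> y) = g y \<star> g x)"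
    and assoc_or_lie: "assoc_algebra scale mul \<or> lie_algebra scale mul"
begin

sublocale ml: Vector_Spaces.linear scale scale "\<lambda>x. x \<star> y" for y by (rule linear_mul_left)
sublocale mr: Vector_Spaces.linear scale scale "\<lambda>y. x \<star> y" for x by (rule linear_mul_right)

definition G_ideal :: "'a set \<Rightarrow> bool" where
  "G_ideal I \<longleftrightarrow> two_sided_ideal scale mul I \<and> (\<forall>g\<in>Ops. g ` I \<subseteq> I)"

lemma G_idealI:
  assumes "subspace I" "\<And>a x. x \<in> I \<Longrightarrow> a \<star> x \<in> I" "\<And>a x. x \<in> I \<Longrightarrow> x \<star> a \<in> I"
    "\<And>g x. g \<in> Ops \<Longrightarrow> x \<in> I \<Longrightarrow> g x \<in> I"
  shows "G_ideal I"
  using assms by (auto simp: G_ideal_def two_sided_ideal_def)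

lemma G_idealD:
  assumes "G_ideal I"
  shows "subspace I" "x \<in> I \<Longrightarrow> a \<star> x \<in> I" "x \<in> I \<Longrightarrow> x \<star> a \<in> I" "g \<in> Ops \<Longrightarrow> x \<in> I \<Longrightarrow> g x \<in> I"
  using assms by (auto simp: G_ideal_def two_sided_ideal_def image_subset_iff)

lemma lie_anticomm: "lie_algebra scale mul \<Longrightarrow> y \<star> x = - (x \<star> y)"
proof -
  assume "lie_algebra scale mul"
  then interpret l: lie_algebra scale mul .
  have "(x + y) \<star> (x + y) = 0" by (rule l.mul_self)
  then have "x \<star> y + y \<star> x = 0"
    using l.mul_self[of x] l.mul_self[of y] by (simp add: ml.add mr.add add.commute)
  then show ?thesis by (simp add: eq_neg_iff_add_eq_0 add.commute)
qed

lemma lie_bracket_mul: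
  assumes "lie_algebra scale mul"
  shows "(x \<star> y) \<star> z = x \<star> (y \<star> z) - y \<star> (x \<star> z)"
proof -
  interpret l: lie_algebra scale mul by (rule assms)
  have "x \<star> (y \<star> z) + y \<star> (z \<star> x) + z \<star> (x \<star> y) = 0" by (rule l.jacobi)
  moreover have "z \<star> (x \<star> y) = - ((x \<star> y) \<star> z)" "y \<star> (z \<star> x) = - (y \<star> (x \<star> z))"
    using lie_anticomm[OF assms, of z "x \<star> y"] lie_anticomm[OF assms, of z x] by (simp_all add: mr.neg)
  ultimately show ?thesis by (simp add: algebra_simps)
qed

lemma assoc: "assoc_algebra scale mul \<Longrightarrow> (x \<star> y) \<star> z = x \<star> (y \<star> z)"
  by (rule assoc_algebra.mul_assoc)

text \<open>
  For a Lie algebra this is twice the Killing form. Both multiplications occur because an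
  anti-automorphism exchanges them.
\<close>

definition trace_form :: "'a \<Rightarrow> 'a \<Rightarrow> 'f" where
  "trace_form u v = trace (\<lambda>x. u \<star> (v \<star> x)) + trace (\<lambda>x. (x \<star> v) \<star> u)"

lemma linear_comp:
  "Vector_Spaces.linear scale scale S \<Longrightarrow> Vector_Spaces.linear scale scale T \<Longrightarrow>
    Vector_Spaces.linear scale scale (\<lambda>x. S (T x))"
  using Vector_Spaces.linear_compose[of scale scale T scale S] by (simp add: o_def)

lemma trace_form_sym: "trace_form u v = trace_form v u"
  unfolding trace_form_def
  using trace_commute[OF linear_mul_right linear_mul_right, of u v]
    trace_commute[OF linear_mul_left linear_mul_left, of u v] by simp

lemma trace_form_linear: "Vector_Spaces.linear scale (*) (\<lambda>u. trace_form u v)"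
  by unfold_locales (auto simp: trace_form_def ml.add mr.add ml.scale mr.scale trace_add trace_scale algebra_simps)

lemma trace_form_lie: "lie_algebra scale mul \<Longrightarrow> trace_form u v = 2 * trace (\<lambda>x. u \<star> (v \<star> x))"
proof -
  assume l: "lie_algebra scale mul"
  have "(x \<star> v) \<star> u = u \<star> (v \<star> x)" for x
    using lie_anticomm[OF l, of x v] lie_anticomm[OF l, of "v \<star> x" u] by (simp add: ml.neg)
  then show ?thesis by (simp add: trace_form_def)
qed

text \<open>
  This is the invariance of the trace under cyclic permutations of a product of operators.
\<close>

lemma trace_form_mul: "trace_form (x \<star> y) z = trace_form x (y \<star> z)"
  using assoc_or_lie
proof
  assume a: "assoc_algebra scale mul"
  have "trace (\<lambda>w. (w \<star> z) \<star> (x \<star> y)) = trace (\<lambda>w. ((w \<star> z) \<star> x) \<star> y)"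
    by (simp add: assoc[OF a])
  also have "\<dots> = trace (\<lambda>w. ((w \<star> y) \<star> z) \<star> x)"
    by (rule trace_commute[OF linear_mul_left linear_comp[OF linear_mul_left linear_mul_left]])
  finally show ?thesis by (simp add: trace_form_def assoc[OF a])
next
  assume l: "lie_algebra scale mul"
  have "trace (\<lambda>w. y \<star> (x \<star> (z \<star> w))) = trace (\<lambda>w. x \<star> (z \<star> (y \<star> w)))"
    by (rule trace_commute[OF linear_mul_right linear_comp[OF linear_mul_right linear_mul_right]])
  then show ?thesis
    by (simp add: trace_form_lie[OF l] lie_bracket_mul[OF l] mr.diff trace_diff)
qed

lemma trace_conjugate:
  assumes "g \<in> Ops" "h \<in> Ops" "\<And>x. h (g x) = x" and T: "Vector_Spaces.linear scale scale T"
  shows "trace (\<lambda>x. g (T (h x))) = trace T"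
  using trace_commute[OF op_linear[OF assms(1)] linear_comp[OF T op_linear[OF assms(2)]]] assms(3) by simp

lemma trace_form_op:
  assumes g: "g \<in> Ops"
  shows "trace_form (g u) (g v) = trace_form u v"
proof -
  obtain h where h: "h \<in> Ops" "\<And>x. h (g x) = x" "\<And>x. g (h x) = x" using op_inv[OF g] by blast
  note tc = trace_conjugate[OF g h(1,2)]
  note LL = linear_comp[OF linear_mul_right linear_mul_right] and RR = linear_comp[OF linear_mul_left linear_mul_left]
  from op_mul[OF g] show ?thesis
  proof
    assume m: "\<forall>x y. g (x \<star> y) = g x \<star> g y"
    have "g u \<star> (g v \<star> x) = g (u \<star> (v \<star> h x))" "(x \<star> g v) \<star> g u = g ((h x \<star> v) \<star> u)" for x
      by (simp_all add: m h)
    then show ?thesis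
      using tc[OF LL, of u v] tc[OF RR, of v u] by (simp add: trace_form_def)
  next
    assume m: "\<forall>x y. g (x \<star> y) = g y \<star> g x"
    have "g u \<star> (g v \<star> x) = g ((h x \<star> v) \<star> u)" "(x \<star> g v) \<star> g u = g (u \<star> (v \<star> h x))" for x
      by (simp_all add: m h)
    then show ?thesis
      using tc[OF LL, of u v] tc[OF RR, of v u] by (simp add: trace_form_def)
  qed
qed

definition radical :: "'a set" where
  "radical = {x. \<forall>y. trace_form x y = 0}"

lemma orthogonal_G_ideal:
  assumes I: "G_ideal I"
  shows "G_ideal {x. \<forall>y\<in>I. trace_form x y = 0}"
proof -
  interpret f: Vector_Spaces.linear scale "(*)" "\<lambda>u. trace_form u v" for v by (rule trace_form_linear)
  note D = G_idealD[OF I]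
  show ?thesis
  proof (rule G_idealI)
    show "subspace {x. \<forall>y\<in>I. trace_form x y = 0}"
      by (rule subspaceI) (auto simp: f.add f.scale)
    fix a x assume x: "x \<in> {x. \<forall>y\<in>I. trace_form x y = 0}"
    show "x \<star> a \<in> {x. \<forall>y\<in>I. trace_form x y = 0}" using x D by (simp add: trace_form_mul)
    have "trace_form (a \<star> x) y = 0" if "y \<in> I" for y
      using x D(3)[OF that] by (metis (mono_tags, lifting) mem_Collect_eq trace_form_mul trace_form_sym)
    then show "a \<star> x \<in> {x. \<forall>y\<in>I. trace_form x y = 0}" by simp
  next
    fix g x assume g: "g \<in> Ops" and x: "x \<in> {x. \<forall>y\<in>I. trace_form x y = 0}"
    obtain h where h: "h \<in> Ops" "\<And>x. h (g x) = x" "\<And>x. g (h x) = x" using op_inv[OF g] by blast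
    have "trace_form (g x) y = 0" if "y \<in> I" for y
      using trace_form_op[OF g, of x "h y"] x D(4)[OF h(1) that] h by simp
    then show "g x \<in> {x. \<forall>y\<in>I. trace_form x y = 0}" by simp
  qed
qed

lemma G_ideal_UNIV: "G_ideal UNIV"
  by (rule G_idealI) auto

lemma G_ideal_radical: "G_ideal radical"
  using orthogonal_G_ideal[OF G_ideal_UNIV] by (simp add: radical_def)

end

section \<open>Degenerate trace forms produce abelian ideals\<close>

context alg_ops
begin

subsection \<open>Associative algebras\<close>

lemma assoc_mul_funpow:
  assumes A: "assoc_algebra scale mul"
  shows "(((\<star>) x ^^ i) x) \<star> w = ((\<star>) x ^^ Suc i) w"
  by (induction i) (simp_all add: assoc[OF A])

text \<open>
  \<open>B\<close> is a polynomial in \<open>T\<close>, the left multiplication by \<open>x\<close>. It arises by solving an annihilating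
  relation of \<open>x\<close> for its term of lowest degree.
\<close>

lemma assoc_fitting_operator:
  fixes x
  assumes A: "assoc_algebra scale mul"
  defines "P \<equiv> \<lambda>B. Vector_Spaces.linear scale scale B \<and> (\<forall>u w. B u \<star> w = B (u \<star> w)) \<and>
      (\<forall>u. B (x \<star> u) = x \<star> B u) \<and> (\<forall>I. G_ideal I \<longrightarrow> (\<forall>u\<in>I. B u \<in> I))"
  shows "\<exists>i B. P B \<and> ((\<star>) x ^^ i) x = ((\<star>) x ^^ Suc i) (B x)"
proof -
  let ?T = "(\<star>) x"
  have Tp: "P (?T ^^ j)" for j
    unfolding P_def
  proof (intro conjI allI ballI impI)
    show "Vector_Spaces.linear scale scale (?T ^^ j)"
      by (rule linear_funpow) (rule linear_mul_right)
    show "(?T ^^ j) u \<star> w = (?T ^^ j) (u \<star> w)" for u w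
      by (induction j) (auto simp: assoc[OF A])
    show "(?T ^^ j) (x \<star> u) = x \<star> (?T ^^ j) u" for u
      by (induction j) auto
    show "(?T ^^ j) u \<in> I" if "G_ideal I" "u \<in> I" for I u
      by (induction j) (auto intro: G_idealD that)
  qed
  have Ps: "P (\<lambda>u. \<Sum>j\<in>J. scale (c j) ((?T ^^ j) u))" if "finite J" for J c
    using that
  proof (induction J rule: finite_induct)
    case empty
    show ?case unfolding P_def
      by (auto simp: Vector_Spaces.linear_iff vector_space_axioms ml.zero mr.zero subspace_0 dest: G_idealD(1))
  next
    case (insert j J)
    then show ?case using Tp[of j] unfolding P_def
      by (auto simp: Vector_Spaces.linear_iff ml.add mr.add ml.scale mr.scale scale_right_distrib mult.commute add_ac
          intro!: subspace_add subspace_scale dest: G_idealD(1))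
  qed
  obtain q where q: "q \<noteq> 0" "poly_at ?T q x = 0" using exists_annihilator[OF linear_mul_right] by blast
  define i where "i = (LEAST i. coeff q i \<noteq> 0)"
  have ci: "coeff q i \<noteq> 0"
    unfolding i_def using q(1) by (metis (mono_tags, lifting) LeastI leading_coeff_0_iff)
  have low: "coeff q j = 0" if "j < i" for j using not_less_Least[OF that[unfolded i_def]] by simp
  let ?d = "degree q"
  define B where "B u = (\<Sum>j\<le>?d. scale (- coeff q (Suc i + j) / coeff q i) ((?T ^^ j) u))" for u
  have "P B" unfolding B_def by (rule Ps) simp
  moreover have "(?T ^^ i) x = (?T ^^ Suc i) (B x)"
  proof -
    interpret Tp: Vector_Spaces.linear scale scale "?T ^^ k" for k
      by (rule linear_funpow) (rule linear_mul_right)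
    have "0 = (\<Sum>k\<le>Suc i + ?d. scale (coeff q k) ((?T ^^ k) x))"
      using q(2) poly_at_bound[OF linear_mul_right, of q "Suc i + ?d" x] by simp
    also have "\<dots> = (\<Sum>k\<in>{i..Suc i + ?d}. scale (coeff q k) ((?T ^^ k) x))"
      by (rule sum.mono_neutral_right) (auto simp: low not_le)
    also have "\<dots> = scale (coeff q i) ((?T ^^ i) x) + (\<Sum>k\<in>{Suc i..Suc i + ?d}. scale (coeff q k) ((?T ^^ k) x))"
      by (subst sum.atLeast_Suc_atMost) auto
    also have "(\<Sum>k\<in>{Suc i..Suc i + ?d}. scale (coeff q k) ((?T ^^ k) x)) =
        (\<Sum>j\<le>?d. scale (coeff q (Suc i + j)) ((?T ^^ Suc i) ((?T ^^ j) x)))"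
      by (rule sum.reindex_bij_witness[of _ "\<lambda>j. Suc i + j" "\<lambda>k. k - Suc i"])
        (auto simp: funpow_add[symmetric, unfolded o_def, THEN fun_cong] simp del: funpow.simps)
    also have "\<dots> = scale (- coeff q i) ((?T ^^ Suc i) (B x))"
      unfolding B_def using ci by (simp add: Tp.sum Tp.scale Tp.neg sum_negf scale_sum_right del: funpow.simps)
    finally have "scale (coeff q i) ((?T ^^ i) x) = scale (coeff q i) ((?T ^^ Suc i) (B x))"
      by (simp del: funpow.simps)
    then show ?thesis using ci by (simp del: funpow.simps)
  qed
  ultimately show ?thesis by blast
qed

text \<open>
  If \<open>x\<close> is not nilpotent, a power \<open>z\<close> of \<open>x\<close> is nonzero and satisfies \<open>z e = z\<close> for an idempotent \<open>e\<close> that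
  is a polynomial in \<open>x\<close> without constant term. Then \<open>e\<close> lies in the radical, but the trace form at
  \<open>(e, e)\<close> is the sum of the ranks of the two multiplications by \<open>e\<close>, which is not \<open>0\<close> in
  characteristic \<open>0\<close>.
\<close>

lemma assoc_radical_nilpotent:
  assumes A: "assoc_algebra scale mul" and x: "x \<in> radical"
  shows "\<exists>m. \<forall>u. ((\<star>) x ^^ m) u = 0"
proof -
  let ?T = "(\<star>) x"
  from assoc_fitting_operator[OF A, of x] obtain i B where
    B0: "Vector_Spaces.linear scale scale B" "\<forall>u w. B u \<star> w = B (u \<star> w)"
    "\<forall>u. B (x \<star> u) = x \<star> B u" "\<forall>I. G_ideal I \<longrightarrow> (\<forall>u\<in>I. B u \<in> I)"
    and Bx: "(?T ^^ i) x = (?T ^^ Suc i) (B x)"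
    by (elim exE conjE) (rule that)
  note B = B0(1) B0(2-4)[rule_format]
  have BT: "B ((?T ^^ k) u) = (?T ^^ k) (B u)" for k u by (induction k) (auto simp: B(3))
  have iter: "(?T ^^ i) x = (?T ^^ (i + k)) ((B ^^ k) x)" for k
  proof (induction k)
    case (Suc k)
    have BkT: "(B ^^ k) ((?T ^^ l) u) = (?T ^^ l) ((B ^^ k) u)" for l u by (induction k) (auto simp: BT)
    have "(?T ^^ (i + Suc k)) ((B ^^ Suc k) x) = (?T ^^ k) ((?T ^^ Suc i) ((B ^^ k) (B x)))"
      by (simp add: funpow_Suc_right[of k B] funpow_add[symmetric, unfolded o_def, THEN fun_cong] add.commute del: funpow.simps)
    also have "\<dots> = (?T ^^ k) ((B ^^ k) ((?T ^^ Suc i) (B x)))" by (simp only: BkT)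
    also have "\<dots> = (?T ^^ k) ((B ^^ k) ((?T ^^ i) x))" by (simp only: Bx)
    also have "\<dots> = (?T ^^ (i + k)) ((B ^^ k) x)"
      by (simp add: BkT funpow_add[symmetric, unfolded o_def, THEN fun_cong] add.commute)
    finally show ?case using Suc by simp
  qed simp
  define z where "z = (?T ^^ i) x"
  \<comment> \<open>\<open>z\<close> is the power of \<open>x\<close> with exponent \<open>Suc i\<close>, so left multiplication by \<open>z\<close> is the same power of \<open>T\<close>.\<close>
  define e where "e = (B ^^ Suc i) z"
  have zm: "z \<star> w = (?T ^^ Suc i) w" for w unfolding z_def by (rule assoc_mul_funpow[OF A])
  have Bk: "(B ^^ k) u \<star> w = (B ^^ k) (u \<star> w)" "(B ^^ k) ((?T ^^ l) u) = (?T ^^ l) ((B ^^ k) u)" for k l u w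
    by (induction k) (auto simp: B(2) BT)
  have "z = (?T ^^ (Suc i + i)) ((B ^^ Suc i) x)"
    using iter[of "Suc i"] by (simp add: z_def add.commute)
  also have "\<dots> = (?T ^^ Suc i) ((?T ^^ i) ((B ^^ Suc i) x))"
    by (simp only: funpow_add o_apply)
  also have "(?T ^^ i) ((B ^^ Suc i) x) = e" unfolding e_def z_def by (simp only: Bk(2))
  finally have ze: "z \<star> e = z" using zm[of e] by metis
  have ee: "e \<star> e = e"
    using Bk(1)[of "Suc i" z e] by (simp only: ze e_def[symmetric])
  have "z = 0"
  proof (rule ccontr)
    assume "z \<noteq> 0"
    then have e0: "e \<noteq> 0" using ze mr.zero by auto
    have "z \<in> radical" unfolding z_def
      by (induction i) (auto intro: G_idealD[OF G_ideal_radical] x)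
    then have "(B ^^ k) z \<in> radical" for k
      by (induction k) (auto intro: B(4)[OF G_ideal_radical])
    then have "e \<in> radical" unfolding e_def .
    then have 0: "trace_form e e = 0" by (auto simp: radical_def)
    have l: "trace (\<lambda>w. e \<star> w) = of_nat (dim (range (\<lambda>w. e \<star> w)))"
      by (rule trace_idempotent[OF linear_mul_right]) (simp add: assoc[OF A, symmetric] ee)
    have r: "trace (\<lambda>w. w \<star> e) = of_nat (dim (range (\<lambda>w. w \<star> e)))"
      by (rule trace_idempotent[OF linear_mul_left]) (simp add: assoc[OF A] ee)
    have "trace_form e e = trace (\<lambda>w. e \<star> w) + trace (\<lambda>w. w \<star> e)"
      unfolding trace_form_def by (simp add: assoc[OF A]) (simp add: assoc[OF A, symmetric] ee)
    then have "(of_nat (dim (range (\<lambda>w. e \<star> w)) + dim (range (\<lambda>w. w \<star> e))) :: 'f) = 0"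
      using 0 l r by simp
    then have "dim (range (\<lambda>w. e \<star> w)) = 0" by (simp only: of_nat_eq_0_iff add_is_0)
    then have "e \<star> e = 0" by (simp only: dim_eq_0) blast
    then show False using ee e0 by simp
  qed
  then have "(?T ^^ Suc i) w = 0" for w using zm[of w] by (simp add: ml.zero)
  then show ?thesis by blast
qed

subsection \<open>Lie algebras\<close>

text \<open>
  \<open>T - (\<mu> + \<nu>)\<close> acts on a product by the Leibniz rule, with \<open>T - \<mu>\<close> on the first factor and \<open>T - \<nu>\<close> on
  the second.
\<close>

lemma lie_gen_eigenspace_mul:
  assumes L: "lie_algebra scale mul"
  assumes "a \<in> gen_eigenspace ((\<star>) x) \<mu>" "b \<in> gen_eigenspace ((\<star>) x) \<nu>"
  shows "a \<star> b \<in> gen_eigenspace ((\<star>) x) (\<mu> + \<nu>)"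
proof -
  let ?N = "eig_diff ((\<star>) x)" and ?E = "gen_eigenspace ((\<star>) x)"
  obtain m n where "(?N \<mu> ^^ m) a = 0" "(?N \<nu> ^^ n) b = 0"
    using assms(2,3) by (auto simp: gen_eigenspace_def)
  then show ?thesis
  proof (induction "m + n" arbitrary: m n a b)
    case 0
    then show ?case using subspace_0[OF subspace_gen_eigenspace[OF linear_mul_right]] by (simp add: ml.zero)
  next
    case (Suc k)
    note sub = subspace_gen_eigenspace[OF linear_mul_right[of x], of "\<mu> + \<nu>"]
    show ?case
    proof (cases "m = 0 \<or> n = 0")
      case True
      then show ?thesis using Suc.prems subspace_0[OF sub] by (auto simp: ml.zero mr.zero)
    next
      case False
      then obtain m' n' where mn: "m = Suc m'" "n = Suc n'" by (metis not0_implies_Suc)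
      have "?N \<mu> a \<star> b \<in> ?E (\<mu> + \<nu>)"
        by (rule Suc.hyps(1)[of m' n]) (use Suc.prems Suc.hyps(2) mn in \<open>auto simp: funpow_swap1\<close>)
      moreover have "a \<star> ?N \<nu> b \<in> ?E (\<mu> + \<nu>)"
        by (rule Suc.hyps(1)[of m n']) (use Suc.prems Suc.hyps(2) mn in \<open>auto simp: funpow_swap1\<close>)
      moreover have "?N (\<mu> + \<nu>) (a \<star> b) = ?N \<mu> a \<star> b + a \<star> ?N \<nu> b"
        using lie_bracket_mul[OF L, of x a b]
        by (simp add: eig_diff_def ml.diff mr.diff ml.scale mr.scale scale_left_distrib algebra_simps)
      ultimately have "?N (\<mu> + \<nu>) (a \<star> b) \<in> ?E (\<mu> + \<nu>)"
        using sub by (simp add: subspace_add)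
      then show ?thesis by (simp only: gen_eigenspace_eig_diff_iff[OF linear_mul_right])
    qed
  qed
qed

text \<open>
  The core of Cartan's criterion. Suppose that \<open>ad x\<close> has an eigenvalue \<open>\<mu> \<noteq> 0\<close>, let \<open>f\<close> be a rational
  linear functional on the field with \<open>f \<mu> = 1\<close>, and let \<open>D\<close> act by \<open>f \<nu>\<close> on the generalized
  eigenspace of \<open>\<nu>\<close>. As \<open>f\<close> is additive, \<open>D\<close> is a derivation. For \<open>y\<close> in the radical,
  \<open>tr (D (ad [y, z])) = tr (ad (D y) (ad z)) = 0\<close>, because \<open>D y\<close> is again in the radical. Hence
  \<open>tr (D (ad x)) = 0\<close>, that is, the sum of \<open>n \<nu> f \<nu> \<nu>\<close> over the eigenvalues is \<open>0\<close>. Applying \<open>f\<close> once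
  more gives a vanishing sum of squares of rational numbers, contrary to \<open>f \<mu> = 1\<close>.
\<close>

lemma lie_radical_commutators_nilpotent:
  assumes L: "lie_algebra scale mul" and x: "x \<in> span {y \<star> z | y z. y \<in> radical}"
  shows "\<exists>m. \<forall>u. ((\<star>) x ^^ m) u = 0"
proof -
  let ?T = "(\<star>) x" and ?K = radical
  let ?E = "gen_eigenspace ?T"
  note K = G_idealD[OF G_ideal_radical]
  have T: "Vector_Spaces.linear scale scale ?T" by (rule linear_mul_right)
  have fvs: "finite_dimensional_vector_space scale Basis" ..
  have fv: "fin_vect_space scale Basis" ..
  have zero_eig: "\<mu> = 0" if v: "v \<in> ?E \<mu>" "v \<noteq> 0" for \<mu> v
  proof (rule ccontr)
    assume "\<mu> \<noteq> 0"
    from exists_rational_functional[OF this] obtain f :: "'f \<Rightarrow> rat" where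
      f0: "\<forall>a b. f (a + b) = f a + f b" "\<forall>r a. f (of_rat r * a) = r * f a" "f \<mu> = 1"
      by (elim exE conjE) (rule that)
    note f = f0(1,2)[rule_format] f0(3)
    obtain D M n where D: "Vector_Spaces.linear scale scale D"
      "\<And>\<mu> v. v \<in> ?E \<mu> \<Longrightarrow> D v = scale (of_rat (f \<mu>)) v"
      and M: "finite M" "\<And>\<mu>. \<mu> \<in> M \<Longrightarrow> n \<mu> \<noteq> (0::nat)" "\<And>\<mu> v. v \<in> ?E \<mu> \<Longrightarrow> v \<noteq> 0 \<Longrightarrow> \<mu> \<in> M"
      and tr: "trace (\<lambda>u. D (x \<star> u)) = (\<Sum>\<mu>\<in>M. of_nat (n \<mu>) * of_rat (f \<mu>) * \<mu>)"
      using eigenvalue_scaling[OF fv T, of "\<lambda>\<mu>. of_rat (f \<mu>)"] by blast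
    interpret D: Vector_Spaces.linear scale scale D by (rule D(1))
    have all: "u \<in> span (\<Union>\<mu>. ?E \<mu>)" for u
      using span_gen_eigenspaces[OF fvs T, of UNIV u] by simp
    have D_deriv: "D (a \<star> b) = D a \<star> b + a \<star> D b" for a b
      using all[of a]
    proof (induction rule: span_induct_alt)
      case (step c a a')
      then obtain \<mu> where a: "a \<in> ?E \<mu>" by blast
      have "D (a \<star> b) = D a \<star> b + a \<star> D b"
        using all[of b]
      proof (induction rule: span_induct_alt)
        case (step c b b')
        then obtain \<nu> where b: "b \<in> ?E \<nu>" by blast
        have "D (a \<star> b) = D a \<star> b + a \<star> D b"
          using D(2)[OF lie_gen_eigenspace_mul[OF L a b]] D(2)[OF a] D(2)[OF b]
          by (simp add: f(1) of_rat_add ml.scale mr.scale scale_left_distrib)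
        then show ?case using step
          by (simp add: D.add D.scale mr.add mr.scale scale_right_distrib algebra_simps)
      qed (simp add: mr.zero D.zero)
      then show ?case using step
        by (simp add: D.add D.scale ml.add ml.scale scale_right_distrib algebra_simps)
    qed (simp add: ml.zero D.zero)
    have xK: "x \<in> ?K"
    proof -
      have "span {y \<star> z | y z. y \<in> ?K} \<subseteq> ?K"
        by (rule span_minimal) (use K in auto)
      then show ?thesis using x by blast
    qed
    have DK: "D y \<in> ?K" if "y \<in> ?K" for y
    proof -
      have "y \<in> span (\<Union>\<mu>. ?E \<mu> \<inter> ?K)"
        by (rule span_gen_eigenspaces[OF fvs T K(1) _ that]) (use K in auto)
      then show ?thesis
        by (induction rule: span_induct_alt)
          (auto simp: D.zero D.add D.scale D(2) intro!: subspace_0 subspace_add subspace_scale K(1))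
    qed
    have tr0: "trace (\<lambda>u. D (w \<star> u)) = 0" if "w \<in> span {y \<star> z | y z. y \<in> ?K}" for w
      using that
    proof (induction rule: span_induct_alt)
      case base
      show ?case by (simp add: ml.zero D.zero trace_zero)
    next
      case (step c w w')
      then obtain y z where yz: "w = y \<star> z" "y \<in> ?K" by blast
      have "trace (\<lambda>u. D (z \<star> (y \<star> u))) = trace (\<lambda>u. y \<star> (D (z \<star> u)))"
        by (rule trace_commute[OF linear_comp[OF D(1) linear_mul_right] linear_mul_right])
      then have "trace (\<lambda>u. D (w \<star> u)) = trace (\<lambda>u. D (y \<star> (z \<star> u))) - trace (\<lambda>u. y \<star> (D (z \<star> u)))"
        by (simp add: yz lie_bracket_mul[OF L] D.diff trace_diff)
      also have "\<dots> = trace (\<lambda>u. D y \<star> (z \<star> u))"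
        by (simp add: trace_diff[symmetric] D_deriv)
      also have "\<dots> = 0"
        using DK[OF yz(2)] trace_form_lie[OF L, of "D y" z] by (simp add: radical_def)
      finally have "trace (\<lambda>u. D (w \<star> u)) = 0" .
      then show ?case using step
        by (simp add: ml.add ml.scale D.add D.scale trace_add trace_scale)
    qed
    have "(\<Sum>\<mu>\<in>M. of_nat (n \<mu>) * of_rat (f \<mu>) * \<mu>) = 0" using tr0[OF x] tr by simp
    then have "f (\<Sum>\<mu>\<in>M. of_rat (of_nat (n \<mu>) * f \<mu>) * \<mu>) = 0"
      using f(2)[of 0 0] by (simp add: of_rat_mult)
    moreover have "f (\<Sum>\<mu>\<in>M. h \<mu>) = (\<Sum>\<mu>\<in>M. f (h \<mu>))" for h
      using M(1) by (induction M rule: finite_induct) (use f(1) f(2)[of 0 0] in auto)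
    ultimately have "(\<Sum>\<mu>\<in>M. of_nat (n \<mu>) * f \<mu> * f \<mu>) = 0" by (simp add: f(2))
    then have "\<forall>\<mu>\<in>M. of_nat (n \<mu>) * f \<mu> * f \<mu> = 0"
      by (subst (asm) sum_nonneg_eq_0_iff) (auto simp: M(1) mult.assoc)
    then show False using M(2,3) v f(3) by force
  qed
  have in0: "u \<in> ?E 0" for u
  proof -
    have "u \<in> span (\<Union>\<mu>. ?E \<mu>)" using span_gen_eigenspaces[OF fvs T, of UNIV u] by simp
    moreover have "(\<Union>\<mu>. ?E \<mu>) \<subseteq> ?E 0"
      using zero_eig subspace_0[OF subspace_gen_eigenspace[OF T]] by (metis UN_least subsetI)
    ultimately show ?thesis using span_minimal[OF _ subspace_gen_eigenspace[OF T]] by blast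
  qed
  have E0: "eig_diff ?T 0 = ?T" by (auto simp: eig_diff_def)
  have "\<forall>b\<in>Basis. \<exists>m. (?T ^^ m) b = 0" using in0 by (auto simp: gen_eigenspace_def E0)
  then obtain m where m: "\<And>b. b \<in> Basis \<Longrightarrow> (?T ^^ m b) b = 0" by metis
  interpret Tm: Vector_Spaces.linear scale scale "?T ^^ k" for k by (rule linear_funpow[OF T])
  have "(?T ^^ Max (m ` Basis)) u = 0" for u
  proof -
    have "u \<in> span Basis" by (simp add: span_Basis)
    then show ?thesis
    proof (induction rule: span_induct_alt)
      case (step c b y)
      then have "(?T ^^ Max (m ` Basis)) b = 0"
        using gen_eigenspace_mono[OF T, of _ 0, unfolded E0, OF m[of b]] finite_Basis by simp
      then show ?case using step by (simp add: Tm.add Tm.scale)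
    qed (simp add: Tm.zero)
  qed
  then show ?thesis by blast
qed

subsection \<open>The annihilator of an ideal acting nilpotently\<close>

text \<open>
  By Engel's theorem long products of elements of \<open>N\<close> vanish. A nonzero product of maximal length
  annihilates \<open>N\<close> on both sides, so the two-sided annihilator of \<open>N\<close> in \<open>N\<close> is not \<open>0\<close>.
\<close>

lemma abelian_ideal_of_nilpotent:
  assumes N: "G_ideal N" "N \<noteq> {0}" and nil: "\<And>x. x \<in> N \<Longrightarrow> \<exists>m. \<forall>u. ((\<star>) x ^^ m) u = 0"
  shows "\<exists>J. G_ideal J \<and> J \<noteq> {0} \<and> (\<forall>x\<in>J. \<forall>y\<in>J. x \<star> y = 0)"
proof -
  interpret fs: vector_space "fun_scale :: 'f \<Rightarrow> ('a \<Rightarrow> 'a) \<Rightarrow> _" by (rule vector_space_fun_scale)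
  note ND = G_idealD[OF N(1)]
  let ?S = "(\<star>) ` N"
  have lin: "Vector_Spaces.linear scale fun_scale (\<star>)"
    by unfold_locales (auto simp: fun_eq_iff ml.add ml.scale)
  have sub: "fs.subspace ?S"
  proof -
    interpret l: Vector_Spaces.linear scale fun_scale "(\<star>)" by (rule lin)
    show ?thesis by (rule l.subspace_image[OF ND(1)])
  qed
  have span: "?S \<subseteq> fs.span ((\<star>) ` Basis)"
  proof -
    interpret l: Vector_Spaces.linear scale fun_scale "(\<star>)" by (rule lin)
    show ?thesis using l.span_image[of Basis] by (auto simp: span_Basis)
  qed
  have comm: "commutator P Q \<in> ?S" if PQ: "P \<in> ?S" "Q \<in> ?S" for P Q
  proof -
    obtain x y where xy: "x \<in> N" "y \<in> N" "P = (\<star>) x" "Q = (\<star>) y" using PQ by blast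
    from assoc_or_lie show ?thesis
    proof
      assume A: "assoc_algebra scale mul"
      have "commutator P Q = (\<star>) (x \<star> y - y \<star> x)"
        by (auto simp: commutator_def xy fun_eq_iff ml.diff assoc[OF A])
      moreover have "x \<star> y - y \<star> x \<in> N" using xy ND by (simp add: subspace_diff)
      ultimately show ?thesis by blast
    next
      assume L: "lie_algebra scale mul"
      have "commutator P Q = (\<star>) (x \<star> y)"
        by (auto simp: commutator_def xy fun_eq_iff lie_bracket_mul[OF L])
      then show ?thesis using xy ND by blast
    qed
  qed
  obtain m where m: "products_vanish m ?S"
    using engel[OF sub _ span _ comm] finite_Basis linear_mul_right nil by blast
  define J where "J = {z\<in>N. \<forall>n\<in>N. n \<star> z = 0 \<and> z \<star> n = 0}"
  have "G_ideal J"
  proof (rule G_idealI)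
    show "subspace J"
      unfolding J_def by (rule subspaceI)
        (auto simp: ml.zero mr.zero ml.add mr.add ml.scale mr.scale intro: subspace_0 subspace_add subspace_scale ND(1))
    fix a z assume z: "z \<in> J"
    have "a \<star> z \<in> J \<and> z \<star> a \<in> J"
      using assoc_or_lie
    proof
      assume A: "assoc_algebra scale mul"
      have "n \<star> (a \<star> z) = 0 \<and> (a \<star> z) \<star> n = 0 \<and> n \<star> (z \<star> a) = 0 \<and> (z \<star> a) \<star> n = 0" if "n \<in> N" for n
        using z that ND(2)[OF that, of a] ND(3)[OF that, of a]
        by (simp add: J_def assoc[OF A] mr.zero) (simp add: assoc[OF A, symmetric] ml.zero)
      then show ?thesis using z ND by (auto simp: J_def)
    next
      assume L: "lie_algebra scale mul"
      have 1: "n \<star> (a \<star> z) = 0" if "n \<in> N" for n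
        using lie_bracket_mul[OF L, of n a z] z that ND(3)[OF that, of a] by (simp add: J_def mr.zero)
      have 2: "(a \<star> z) \<star> n = 0" "n \<star> (z \<star> a) = 0" "(z \<star> a) \<star> n = 0" if "n \<in> N" for n
        using 1[OF that] lie_anticomm[OF L, of n "a \<star> z"] lie_anticomm[OF L, of z a]
        by (simp_all add: ml.neg mr.neg)
      show ?thesis using z ND 1 2 by (auto simp: J_def)
    qed
    then show "a \<star> z \<in> J" "z \<star> a \<in> J" by auto
  next
    fix g z assume g: "g \<in> Ops" and z: "z \<in> J"
    obtain h where h: "h \<in> Ops" "\<And>x. h (g x) = x" "\<And>x. g (h x) = x" using op_inv[OF g] by blast
    interpret g: Vector_Spaces.linear scale scale g by (rule op_linear[OF g])
    have "n \<star> g z = 0 \<and> g z \<star> n = 0" if n: "n \<in> N" for n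
    proof -
      have "h n \<in> N" using ND(4) h n by blast
      then have "g (h n \<star> z) = 0" "g (z \<star> h n) = 0" using z by (auto simp: J_def g.zero)
      then show ?thesis using op_mul[OF g] h(3) by auto
    qed
    then show "g z \<in> J" using z ND(4)[OF g] by (auto simp: J_def)
  qed
  moreover have "\<forall>x\<in>J. \<forall>y\<in>J. x \<star> y = 0" by (auto simp: J_def)
  moreover have "J \<noteq> {0}"
  proof -
    define Q where "Q j \<longleftrightarrow> (\<exists>ns y. set ns \<subseteq> N \<and> length ns = j \<and> y \<in> N \<and> foldr (\<star>) ns y \<noteq> 0)" for j
    have fold: "foldr (\<star>) ns y = foldr id (map (\<star>) ns) y" for ns y by (induction ns) auto
    have "j < m" if "Q j" for j
    proof (rule ccontr)
      assume "\<not> j < m"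
      from that obtain ns y where ns: "set ns \<subseteq> N" "length ns = j" "foldr (\<star>) ns y \<noteq> 0" by (auto simp: Q_def)
      then show False using products_vanishD[OF m, of "map (\<star>) ns" y] \<open>\<not> j < m\<close> by (auto simp: fold)
    qed
    moreover have "Q 0"
    proof -
      obtain y where "y \<in> N" "y \<noteq> 0" using N(2) subspace_0[OF ND(1)] by blast
      then show ?thesis by (auto simp: Q_def)
    qed
    ultimately obtain j where j: "Q j" "\<And>k. Q k \<Longrightarrow> k \<le> j"
      using ex_has_greatest_nat[of Q 0 id m] by auto
    obtain ns y where ns: "set ns \<subseteq> N" "length ns = j" "y \<in> N" "foldr (\<star>) ns y \<noteq> 0"
      using j(1) by (auto simp: Q_def)
    let ?z = "foldr (\<star>) ns y"
    have long: "foldr (\<star>) ns' y' = 0" if "set ns' \<subseteq> N" "length ns' = Suc j" "y' \<in> N" for ns' y'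
      using j(2)[of "Suc j"] that by (auto simp: Q_def)
    have z: "?z \<in> N" using ns(1,3) by (induction ns) (auto intro: ND)
    have nz: "n \<star> ?z = 0" if "n \<in> N" for n using long[of "n # ns" y] ns that by simp
    have zn: "?z \<star> n = 0" if "n \<in> N" for n
      using assoc_or_lie
    proof
      assume A: "assoc_algebra scale mul"
      have "foldr (\<star>) ns' y \<star> n = foldr (\<star>) (ns' @ [y]) n" for ns'
        by (induction ns') (auto simp: assoc[OF A])
      then show ?thesis using long[of "ns @ [y]" n] ns that by simp
    next
      assume L: "lie_algebra scale mul"
      then show ?thesis using nz[OF that] lie_anticomm[OF L, of n ?z] by simp
    qed
    have "?z \<in> J" using z nz zn by (auto simp: J_def)
    then show ?thesis using ns(4) by auto
  qed
  ultimately show ?thesis by blast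
qed

text \<open>
  In the associative case the radical of the form acts nilpotently. In the Lie case its products
  with \<open>A\<close> span an ideal that acts nilpotently; if this ideal is \<open>0\<close>, the radical itself is abelian.
\<close>

theorem abelian_ideal_or_nondegenerate:
  "(\<exists>J. G_ideal J \<and> J \<noteq> {0} \<and> (\<forall>x\<in>J. \<forall>y\<in>J. x \<star> y = 0)) \<or> radical = {0}"
proof (cases "radical = {0}")
  case False
  note K = G_idealD[OF G_ideal_radical]
  from assoc_or_lie show ?thesis
  proof
    assume "assoc_algebra scale mul"
    then show ?thesis
      using abelian_ideal_of_nilpotent[OF G_ideal_radical False] assoc_radical_nilpotent by blast
  next
    assume L: "lie_algebra scale mul"
    let ?N = "span {y \<star> z | y z. y \<in> radical}"
    have NK: "?N \<subseteq> radical" by (rule span_minimal) (use K in auto)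
    have N: "G_ideal ?N"
    proof (rule G_idealI)
      fix a x assume "x \<in> ?N"
      then have "x \<in> radical" using NK by blast
      then show xa: "x \<star> a \<in> ?N" by (blast intro: span_base)
      then show "a \<star> x \<in> ?N" using lie_anticomm[OF L, of a x] by (simp add: span_neg)
    next
      fix g x assume g: "g \<in> Ops" and "x \<in> ?N"
      interpret g: Vector_Spaces.linear scale scale g by (rule op_linear[OF g])
      from \<open>x \<in> ?N\<close> show "g x \<in> ?N"
      proof (induction rule: span_induct_alt)
        case (step c x y)
        then obtain u v where uv: "x = u \<star> v" "u \<in> radical" by blast
        have gu: "g u \<in> radical" using K(4)[OF g uv(2)] .
        then have "g u \<star> g v \<in> ?N" by (blast intro: span_base)
        then have "g x \<in> ?N"
          using op_mul[OF g] lie_anticomm[OF L, of "g v" "g u"] span_neg[of "g u \<star> g v"] uv(1) by auto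
        then show ?case using step by (simp add: g.add g.scale span_add span_scale)
      qed (simp add: g.zero span_zero)
    qed simp
    show ?thesis
    proof (cases "?N = {0}")
      case True
      have "x \<star> y = 0" if "x \<in> radical" for x y
      proof -
        have "x \<star> y \<in> ?N" using that by (blast intro: span_base)
        then show ?thesis using True by simp
      qed
      then show ?thesis using False G_ideal_radical by blast
    next
      case False
      then show ?thesis
        using abelian_ideal_of_nilpotent[OF N] lie_radical_commutators_nilpotent[OF L] by blast
    qed
  qed
qed simp

end

section \<open>Multilinear functions\<close>

context alg_ops
begin

text \<open>
  The functions of the family of arguments \<open>a\<close> that are nonassociative products of the values \<open>a v\<close>,
  \<open>v \<in> S\<close>, each value occurring once and moved by an operator. The type of the variables is arbitrary
  since variables are adjoined and renamed below.
\<close>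

inductive ml_monomial :: "'v set \<Rightarrow> (('v \<Rightarrow> 'a) \<Rightarrow> 'a) \<Rightarrow> bool" where
  var: "g \<in> Ops \<Longrightarrow> ml_monomial {v} (\<lambda>a. g (a v))"
| prod: "ml_monomial S p \<Longrightarrow> ml_monomial T q \<Longrightarrow> S \<inter> T = {} \<Longrightarrow> ml_monomial (S \<union> T) (\<lambda>a. p a \<star> q a)"

lemma ml_monomial_cong: "ml_monomial S p \<Longrightarrow> (\<And>v. v \<in> S \<Longrightarrow> a v = b v) \<Longrightarrow> p a = p b"
proof (induction rule: ml_monomial.induct)
  case (prod S p T q)
  then have "p a = p b" "q a = q b" by blast+
  then show ?case by simp
qed auto

lemma ml_monomial_op: "ml_monomial S p \<Longrightarrow> g \<in> Ops \<Longrightarrow> ml_monomial S (\<lambda>a. g (p a))"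
proof (induction rule: ml_monomial.induct)
  case (var h v)
  then show ?case using ml_monomial.var[OF op_comp[of g h]] by simp
next
  case (prod S p T q)
  note 1 = prod.IH(1)[OF prod.prems] and 2 = prod.IH(2)[OF prod.prems]
  from op_mul[OF prod.prems] show ?case
  proof
    assume "\<forall>x y. g (x \<star> y) = g x \<star> g y"
    then show ?thesis using ml_monomial.prod[OF 1 2 prod.hyps(3)] by simp
  next
    assume "\<forall>x y. g (x \<star> y) = g y \<star> g x"
    then show ?thesis using ml_monomial.prod[OF 2 1] prod.hyps(3) by (simp add: Un_commute Int_commute)
  qed
qed

lemma ml_monomial_linear:
  "ml_monomial S p \<Longrightarrow> v \<in> S \<Longrightarrow> Vector_Spaces.linear scale scale (\<lambda>x. p (a(v := x)))"
proof (induction rule: ml_monomial.induct)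
  case (var g w)
  then show ?case by (simp add: op_linear)
next
  case (prod S p T q)
  show ?case
  proof (cases "v \<in> S")
    case True
    then have eq: "q (a(v := x)) = q a" for x
      by (intro ml_monomial_cong[OF prod.hyps(2)]) (use prod.hyps(3) in auto)
    show ?thesis
      unfolding eq by (rule linear_comp[OF linear_mul_left prod.IH(1)[OF True]])
  next
    case False
    then have vT: "v \<in> T" using prod.prems by auto
    have eq: "p (a(v := x)) = p a" for x
      by (intro ml_monomial_cong[OF prod.hyps(1)]) (use False in auto)
    show ?thesis
      unfolding eq by (rule linear_comp[OF linear_mul_right prod.IH(2)[OF vT]])
  qed
qed

lemma ml_monomial_rename:
  "ml_monomial S p \<Longrightarrow> inj_on h S \<Longrightarrow> ml_monomial (h ` S) (\<lambda>a. p (a \<circ> h))"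
proof (induction rule: ml_monomial.induct)
  case (var g v)
  then show ?case using ml_monomial.var[of g "h v"] by simp
next
  case (prod S p T q)
  have "inj_on h S" "inj_on h T" "h ` S \<inter> h ` T = {}"
    using prod.prems prod.hyps(3) by (auto simp: inj_on_Un inj_on_def)
  then show ?case using ml_monomial.prod[of "h ` S" _ "h ` T"] prod.IH by (simp add: image_Un)
qed

lemma ml_monomial_subst:
  assumes p: "ml_monomial S p" and q: "ml_monomial T q"
  shows "v \<in> S \<Longrightarrow> T \<inter> (S - {v}) = {} \<Longrightarrow> ml_monomial ((S - {v}) \<union> T) (\<lambda>a. p (a(v := q a)))"
  using p
proof (induction rule: ml_monomial.induct)
  case (var g w)
  then show ?case using ml_monomial_op[OF q, of g] by simp
next
  case (prod S1 p1 S2 p2)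
  show ?case
  proof (cases "v \<in> S1")
    case True
    then have v2: "v \<notin> S2" using prod.hyps by auto
    have eq: "p2 (a(v := q a)) = p2 a" for a
      by (intro ml_monomial_cong[OF prod.hyps(2)]) (use v2 in auto)
    have "ml_monomial ((S1 - {v}) \<union> T \<union> S2) (\<lambda>a. p1 (a(v := q a)) \<star> p2 a)"
      by (intro ml_monomial.prod prod.IH(1) prod.hyps(2)) (use True v2 prod.prems prod.hyps(3) in auto)
    moreover have "(S1 - {v}) \<union> T \<union> S2 = (S1 \<union> S2 - {v}) \<union> T" using v2 by auto
    ultimately show ?thesis by (simp only: eq)
  next
    case False
    then have v2: "v \<in> S2" using prod.prems by auto
    have eq: "p1 (a(v := q a)) = p1 a" for a
      by (intro ml_monomial_cong[OF prod.hyps(1)]) (use False in auto)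
    have "ml_monomial (S1 \<union> ((S2 - {v}) \<union> T)) (\<lambda>a. p1 a \<star> p2 (a(v := q a)))"
      by (intro ml_monomial.prod prod.IH(2) prod.hyps(1)) (use False v2 prod.prems prod.hyps(3) in auto)
    moreover have "S1 \<union> ((S2 - {v}) \<union> T) = (S1 \<union> S2 - {v}) \<union> T" using False by auto
    ultimately show ?thesis by (simp only: eq)
  qed
qed

inductive ml_poly :: "'v set \<Rightarrow> (('v \<Rightarrow> 'a) \<Rightarrow> 'a) \<Rightarrow> bool" for S where
  mono: "ml_monomial S p \<Longrightarrow> ml_poly S p"
| zero: "ml_poly S (\<lambda>a. 0)"
| add: "ml_poly S p \<Longrightarrow> ml_poly S q \<Longrightarrow> ml_poly S (\<lambda>a. p a + q a)"
| scale: "ml_poly S p \<Longrightarrow> ml_poly S (\<lambda>a. scale c (p a))"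

lemma ml_poly_cong:
  assumes "ml_poly S p" "\<And>v. v \<in> S \<Longrightarrow> a v = b v"
  shows "p a = p b"
  using assms(1)
proof induction
  case (mono p)
  then show ?case using assms(2) by (rule ml_monomial_cong)
qed simp_all

lemma ml_poly_linear:
  assumes "ml_poly S p" "v \<in> S"
  shows "Vector_Spaces.linear scale scale (\<lambda>x. p (a(v := x)))"
  using assms(1)
proof induction
  case (mono p)
  show ?case by (rule ml_monomial_linear[OF mono assms(2)])
qed (auto simp: Vector_Spaces.linear_iff vector_space_axioms scale_right_distrib mult.commute algebra_simps)

lemma ml_poly_rename:
  assumes "ml_poly S p" "inj_on h S"
  shows "ml_poly (h ` S) (\<lambda>a. p (a \<circ> h))"
  using assms(1)
proof induction
  case (mono p)
  show ?case by (rule ml_poly.mono[OF ml_monomial_rename[OF mono assms(2)]])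
qed (rule ml_poly.zero ml_poly.add ml_poly.scale; assumption)+

lemma ml_poly_subst:
  assumes "ml_poly S p" "ml_monomial T q" "v \<in> S" "T \<inter> (S - {v}) = {}"
  shows "ml_poly ((S - {v}) \<union> T) (\<lambda>a. p (a(v := q a)))"
  using assms(1)
proof induction
  case (mono p)
  show ?case by (rule ml_poly.mono[OF ml_monomial_subst[OF mono assms(2-)]])
qed (rule ml_poly.zero ml_poly.add ml_poly.scale; assumption)+

lemma ml_poly_sum:
  assumes "\<And>i. i \<in> I \<Longrightarrow> ml_poly S (p i)"
  shows "ml_poly S (\<lambda>a. \<Sum>i\<in>I. p i a)"
  using assms by (induction I rule: infinite_finite_induct) (auto intro: ml_poly.intros)

lemma ml_poly_span: "{p. ml_poly S p} = module.span fun_scale {p. ml_monomial S p}"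
proof -
  interpret fs: vector_space "fun_scale :: 'f \<Rightarrow> (('v \<Rightarrow> 'a) \<Rightarrow> 'a) \<Rightarrow> _" by (rule vector_space_fun_scale)
  have 1: "p \<in> fs.span {p. ml_monomial S p}" if "ml_poly S p" for p
    using that
  proof induction
    case (mono p)
    then show ?case by (intro fs.span_base CollectI)
  next
    case zero
    show ?case using fs.span_zero[of "{p. ml_monomial S p}"] unfolding zero_fun_def .
  next
    case (add p q)
    show ?case using fs.span_add[OF add.IH] unfolding plus_fun_def .
  next
    case (scale p c)
    show ?case using fs.span_scale[OF scale.IH, of c] unfolding fun_scale_def[of c] .
  qed
  have 2: "ml_poly S p" if "p \<in> fs.span {p. ml_monomial S p}" for p
    using that
  proof (induction rule: fs.span_induct_alt)
    case base
    show ?case using ml_poly.zero unfolding zero_fun_def .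
  next
    case (step c p q)
    then show ?case
      using ml_poly.add[OF ml_poly.scale[OF ml_poly.mono, of S p c] step(2)]
      unfolding plus_fun_def fun_scale_def mem_Collect_eq by blast
  qed
  show ?thesis using 1 2 by blast
qed

text \<open>
  Expansion in one variable of \<open>X\<close> after the other; the arguments outside \<open>X\<close> stay fixed.
\<close>

lemma multilinear_eq_0:
  assumes fin: "finite X" and lin: "\<And>v a. v \<in> X \<Longrightarrow> Vector_Spaces.linear scale scale (\<lambda>x. F (a(v := x)))"
    and C: "span C = UNIV"
    and zero: "\<And>b. (\<And>v. v \<in> X \<Longrightarrow> b v \<in> C) \<Longrightarrow> (\<And>v. v \<notin> X \<Longrightarrow> b v = a v) \<Longrightarrow> F b = 0"
  shows "F a = 0"
  using assms(1,2,4)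
proof (induction X arbitrary: a rule: finite_induct)
  case empty
  show ?case by (rule empty.prems(2)) auto
next
  case (insert v X)
  interpret l: Vector_Spaces.linear scale scale "\<lambda>x. F (a(v := x))" by (rule insert.prems(1)) simp
  have base: "F (a(v := c)) = 0" if "c \<in> C" for c
  proof (rule insert.IH)
    show "Vector_Spaces.linear scale scale (\<lambda>x. F (b(u := x)))" if "u \<in> X" for u b
      by (rule insert.prems(1)) (use that in simp)
    fix b assume b: "\<And>u. u \<in> X \<Longrightarrow> b u \<in> C" "\<And>u. u \<notin> X \<Longrightarrow> b u = (a(v := c)) u"
    then have "b v = c" using insert.hyps(2) by simp
    then show "F b = 0" using b that by (intro insert.prems(2)) auto
  qed
  have "F (a(v := x)) = 0" if "x \<in> span C" for x
    using that by (induction rule: span_induct_alt) (simp_all add: l.zero l.add l.scale base del: fun_upd_apply)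
  from this[of "a v"] show ?case by (simp add: C)
qed

subsection \<open>Alternating functions and traces\<close>

definition alternating :: "'v set \<Rightarrow> (('v \<Rightarrow> 'a) \<Rightarrow> 'a) \<Rightarrow> bool" where
  "alternating X F \<longleftrightarrow> (\<forall>a. \<forall>i\<in>X. \<forall>j\<in>X. i \<noteq> j \<longrightarrow> a i = a j \<longrightarrow> F a = 0)"

lemma alternating_swap:
  assumes alt: "alternating X F" and lin: "\<And>v a. v \<in> X \<Longrightarrow> Vector_Spaces.linear scale scale (\<lambda>x. F (a(v := x)))"
    and ij: "i \<in> X" "j \<in> X" "i \<noteq> j"
  shows "F (a(i := x, j := y)) = - F (a(i := y, j := x))"
proof -
  interpret li: Vector_Spaces.linear scale scale "\<lambda>x. F (c(i := x))" for c by (rule lin[OF ij(1)])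
  interpret lj: Vector_Spaces.linear scale scale "\<lambda>x. F (c(j := x))" for c by (rule lin[OF ij(2)])
  have z: "F (a(i := z, j := z)) = 0" for z
    using alt ij unfolding alternating_def by (metis fun_upd_same fun_upd_other)
  have sw: "a(i := u, j := v) = a(j := v, i := u)" for u v using ij(3) by (auto simp: fun_upd_twist)
  have "0 = F (a(i := x + y, j := x + y))" using z by simp
  also have "\<dots> = F (a(i := x + y, j := x)) + F (a(i := x + y, j := y))" by (simp add: lj.add)
  also have "\<dots> = F (a(i := x, j := y)) + F (a(i := y, j := x))"
    by (simp only: sw li.add) (simp only: sw[symmetric] z, simp)
  finally have sum0: "0 = F (a(i := x, j := y)) + F (a(i := y, j := x))" .
  show ?thesis by (rule iffD2[OF eq_neg_iff_add_eq_0 sum0[symmetric]])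
qed

text \<open>
  Both sides are multilinear and alternating in \<open>dim A\<close> arguments, so they may be compared at the
  permutations of a basis, where the \<open>i\<close>-th summand picks out a diagonal entry of \<open>T\<close>.
\<close>

theorem alternating_trace:
  fixes F :: "('v \<Rightarrow> 'a) \<Rightarrow> 'a"
  assumes alt: "alternating X F" and lin: "\<And>v a. v \<in> X \<Longrightarrow> Vector_Spaces.linear scale scale (\<lambda>x. F (a(v := x)))"
    and X: "finite X" "card X = card Basis" and T: "Vector_Spaces.linear scale scale T"
  shows "(\<Sum>i\<in>X. F (a(i := T (a i)))) = scale (trace T) (F a)"
proof -
  interpret T: Vector_Spaces.linear scale scale T by (rule T)
  define H where "H a = (\<Sum>i\<in>X. F (a(i := T (a i)))) - scale (trace T) (F a)" for a
  have upd: "F (a(v := x, i := y)) = F (a(i := y, v := x))" if "v \<noteq> i" for a v x i y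
    using that by (simp add: fun_upd_twist)
  have Fadd: "F (a(v := x + y)) = F (a(v := x)) + F (a(v := y))" and Fsc: "F (a(v := scale c x)) = scale c (F (a(v := x)))"
    if "v \<in> X" for a v x y c
    using lin[OF that] by (auto simp: Vector_Spaces.linear_iff)
  have "H a = 0"
  proof (rule multilinear_eq_0[where F = H and a = a, OF X(1) _ span_Basis])
    fix v a assume v: "v \<in> X"
    have lin_summand: "Vector_Spaces.linear scale scale (\<lambda>x. F (a(v := x, i := T ((a(v := x)) i))))" if "i \<in> X" for i
    proof (cases "i = v")
      case True
      then show ?thesis using linear_comp[OF lin[OF v] T] by simp
    next
      case False
      then show ?thesis using lin[OF v, of "a(i := T (a i))"] by (simp add: upd)
    qed
    have "Vector_Spaces.linear scale scale (\<lambda>x. \<Sum>i\<in>X. F (a(v := x, i := T ((a(v := x)) i))))"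
      using X(1) lin_summand
      by (auto simp: Vector_Spaces.linear_iff vector_space_axioms sum.distrib scale_sum_right simp del: fun_upd_apply intro!: sum.cong)
    then show "Vector_Spaces.linear scale scale (\<lambda>x. H (a(v := x)))"
      using lin[OF v, of a] unfolding H_def
      by (auto simp: Vector_Spaces.linear_iff scale_right_distrib scale_right_diff_distrib mult.commute algebra_simps)
  next
    fix b assume b: "\<And>v. v \<in> X \<Longrightarrow> b v \<in> Basis"
    show "H b = 0"
    proof (cases "inj_on b X")
      case True
      then have bij: "bij_betw b X Basis"
        using b X finite_Basis by (simp add: bij_betw_def card_image card_subset_eq image_subsetI)
      have "F (b(i := T (b i))) = scale (representation Basis (T (b i)) (b i)) (F b)" if i: "i \<in> X" for i
      proof -
        interpret Fi: Vector_Spaces.linear scale scale "\<lambda>x. F (b(i := x))" by (rule lin[OF i])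
        have exp: "T (b i) = (\<Sum>c\<in>Basis. scale (representation Basis (T (b i)) c) c)"
          by (simp add: sum_representation_eq finite_Basis independent_Basis span_Basis)
        have z: "F (b(i := c)) = 0" if c: "c \<in> Basis" "c \<noteq> b i" for c
        proof -
          obtain j where j: "j \<in> X" "b j = c" using bij c(1) by (auto simp: bij_betw_def)
          then show ?thesis using alt i c(2) unfolding alternating_def by (metis fun_upd_other fun_upd_same)
        qed
        have "F (b(i := T (b i))) = (\<Sum>c\<in>Basis. scale (representation Basis (T (b i)) c) (F (b(i := c))))"
          by (subst exp) (simp only: Fi.sum Fi.scale)
        also have "\<dots> = (\<Sum>c\<in>{b i}. scale (representation Basis (T (b i)) c) (F (b(i := c))))"
          by (rule sum.mono_neutral_right) (use finite_Basis z b[OF i] in auto)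
        finally show ?thesis by simp
      qed
      then have "(\<Sum>i\<in>X. F (b(i := T (b i)))) = scale (\<Sum>i\<in>X. representation Basis (T (b i)) (b i)) (F b)"
        by (simp add: scale_sum_left)
      also have "(\<Sum>i\<in>X. representation Basis (T (b i)) (b i)) = trace T"
        unfolding trace_on_def by (rule sum.reindex_bij_betw[OF bij])
      finally show ?thesis unfolding H_def by (simp del: fun_upd_apply)
    next
      case False
      then obtain i j where ij: "i \<in> X" "j \<in> X" "i \<noteq> j" "b i = b j" by (auto simp: inj_on_def)
      have "F b = 0" using alt ij unfolding alternating_def by blast
      moreover have "F (b(k := T (b k))) = 0" if "k \<in> X - {i, j}" for k
        using alt ij that unfolding alternating_def by (metis DiffD2 fun_upd_other insertCI)
      then have "(\<Sum>k\<in>X. F (b(k := T (b k)))) = (\<Sum>k\<in>{i, j}. F (b(k := T (b k))))"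
        by (intro sum.mono_neutral_right) (use X ij in auto)
      moreover have "F (b(i := T (b i), j := b j)) = - F (b(i := b j, j := T (b i)))"
        by (rule alternating_swap[OF alt lin ij(1-3)])
      then have "F (b(i := T (b i))) = - F (b(j := T (b j)))"
        using ij by (simp add: fun_upd_idem)
      ultimately show ?thesis using ij(3) by (simp add: H_def)
    qed
  qed
  then show ?thesis by (simp add: H_def)
qed

text \<open>
  Razmyslov's trick: by the preceding theorem, multiplication by the trace form can be realized by
  the substitutions of \<open>u (v x)\<close> and of \<open>(x v) u\<close> for each of the alternating arguments \<open>x\<close>.
\<close>

lemma trace_form_times_alternating:
  assumes F: "ml_poly S F" "alternating X F" and X: "X \<subseteq> S" "finite X" "card X = card Basis"
    and uv: "u \<notin> S" "v \<notin> S" "u \<noteq> v"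
  shows "ml_poly (insert u (insert v S)) (\<lambda>a. scale (trace_form (a u) (a v)) (F a))"
proof -
  have v: "ml_monomial {w} (\<lambda>a. a w)" for w :: 'c by (rule ml_monomial.var[OF op_id])
  have lin: "Vector_Spaces.linear scale scale (\<lambda>x. F (a(w := x)))" if "w \<in> X" for w a
    by (rule ml_poly_linear[OF F(1)]) (use that X in auto)
  have 1: "ml_poly (insert u (insert v S)) (\<lambda>a. F (a(i := a u \<star> (a v \<star> a i))))" if i: "i \<in> X" for i
  proof -
    have "ml_poly ((S - {i}) \<union> ({u} \<union> ({v} \<union> {i}))) (\<lambda>a. F (a(i := a u \<star> (a v \<star> a i))))"
      by (rule ml_poly_subst[OF F(1)], intro ml_monomial.prod v) (use i X uv in auto)
    moreover have "(S - {i}) \<union> ({u} \<union> ({v} \<union> {i})) = insert u (insert v S)" using i X by auto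
    ultimately show ?thesis by simp
  qed
  have 2: "ml_poly (insert u (insert v S)) (\<lambda>a. F (a(i := (a i \<star> a v) \<star> a u)))" if i: "i \<in> X" for i
  proof -
    have "ml_poly ((S - {i}) \<union> (({i} \<union> {v}) \<union> {u})) (\<lambda>a. F (a(i := (a i \<star> a v) \<star> a u)))"
      by (rule ml_poly_subst[OF F(1)], intro ml_monomial.prod v) (use i X uv in auto)
    moreover have "(S - {i}) \<union> (({i} \<union> {v}) \<union> {u}) = insert u (insert v S)" using i X by auto
    ultimately show ?thesis by simp
  qed
  have eq: "(\<lambda>a. scale (trace_form (a u) (a v)) (F a)) =
      (\<lambda>a. (\<Sum>i\<in>X. F (a(i := a u \<star> (a v \<star> a i)))) + (\<Sum>i\<in>X. F (a(i := (a i \<star> a v) \<star> a u))))"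
  proof
    fix a
    show "scale (trace_form (a u) (a v)) (F a) =
        (\<Sum>i\<in>X. F (a(i := a u \<star> (a v \<star> a i)))) + (\<Sum>i\<in>X. F (a(i := (a i \<star> a v) \<star> a u)))"
      using alternating_trace[OF F(2) lin X(2,3) linear_comp[OF linear_mul_right linear_mul_right], where a = a, of "a u" "a v"]
        alternating_trace[OF F(2) lin X(2,3) linear_comp[OF linear_mul_left linear_mul_left], where a = a, of "a v" "a u"]
      by (simp add: trace_form_def scale_left_distrib del: fun_upd_apply)
  qed
  show ?thesis unfolding eq by (intro ml_poly.add ml_poly_sum 1 2)
qed

lemma trace_forms_times_alternating:
  assumes F: "ml_poly S F" "alternating X F" and X: "X \<subseteq> S" "finite X" "card X = card Basis"
    and I: "finite I" and uv: "inj_on u I" "inj_on v I" "u ` I \<inter> v ` I = {}" "u ` I \<inter> S = {}" "v ` I \<inter> S = {}"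
  shows "ml_poly (S \<union> u ` I \<union> v ` I) (\<lambda>a. scale (\<Prod>i\<in>I. trace_form (a (u i)) (a (v i))) (F a))"
  using I uv
proof (induction I rule: finite_induct)
  case empty
  then show ?case using F(1) by simp
next
  case (insert i I)
  let ?S = "S \<union> u ` I \<union> v ` I"
  let ?F = "\<lambda>a. scale (\<Prod>i\<in>I. trace_form (a (u i)) (a (v i))) (F a)"
  have IH: "ml_poly ?S ?F" using insert by auto
  have alt: "alternating X ?F" using F(2) by (auto simp: alternating_def)
  have "ml_poly (insert (u i) (insert (v i) ?S)) (\<lambda>a. scale (trace_form (a (u i)) (a (v i))) (?F a))"
    by (rule trace_form_times_alternating[OF IH alt _ X(2,3)]) (use X insert in auto)
  moreover have "insert (u i) (insert (v i) ?S) = S \<union> u ` insert i I \<union> v ` insert i I" by auto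
  ultimately show ?case using insert.hyps by simp
qed

end

section \<open>Dimensions of spaces of multilinear functions\<close>

context alg_ops
begin

definition ml_dim :: "nat \<Rightarrow> nat" where
  "ml_dim n = vector_space.dim fun_scale {p :: (nat \<Rightarrow> 'a) \<Rightarrow> 'a. ml_poly {1..n} p}"

text \<open>
  The words in the alphabet \<open>C\<close>, with one letter for each variable, at which some monomial does not vanish.
  A multilinear function is determined by its values at these words when \<open>C\<close> spans \<open>A\<close>.
\<close>

definition nonvanishing_words :: "'v set \<Rightarrow> 'a set \<Rightarrow> ('v \<Rightarrow> 'a) set" where
  "nonvanishing_words S C = {w \<in> S \<rightarrow>\<^sub>E C. \<exists>p. ml_monomial S p \<and> p w \<noteq> 0}"

text \<open>
  Were there more functions than coordinates of values at the nonvanishing words, a nonzero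
  combination of them would vanish at all words.
\<close>

lemma ml_independent_bound:
  fixes X :: "(('v \<Rightarrow> 'a) \<Rightarrow> 'a) set"
  assumes S: "finite S" and C: "span C = UNIV" "finite C"
    and X: "\<not> module.dependent fun_scale X" "\<And>p. p \<in> X \<Longrightarrow> ml_poly S p"
  shows "finite X \<and> card X \<le> card (nonvanishing_words S C) * card Basis"
proof -
  interpret fs: vector_space "fun_scale :: 'f \<Rightarrow> (('v \<Rightarrow> 'a) \<Rightarrow> 'a) \<Rightarrow> _" by (rule vector_space_fun_scale)
  let ?W = "nonvanishing_words S C" and ?N = "card (nonvanishing_words S C) * card Basis"
  have finW: "finite ?W"
    by (rule finite_subset[of _ "S \<rightarrow>\<^sub>E C"]) (auto simp: nonvanishing_words_def intro: finite_PiE S C)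
  have small: "card Y \<le> ?N" if Y: "Y \<subseteq> X" "finite Y" for Y
  proof (rule ccontr)
    assume less: "\<not> card Y \<le> ?N"
    let ?l = "\<lambda>(w, b) p. representation Basis (p w) b"
    have "\<exists>p\<in>fs.span Y. p \<noteq> 0 \<and> (\<forall>\<omega>\<in>?W \<times> Basis. ?l \<omega> p = 0)"
    proof (rule fs.common_kernel)
      show "finite (?W \<times> Basis)" using finW finite_Basis by simp
      show "fs.independent Y" using X(1) Y(1) by (rule fs.independent_mono)
      show "finite Y" by (rule Y)
      show "card (?W \<times> Basis) < card Y" using less by (simp add: card_cartesian_product)
      show "Vector_Spaces.linear fun_scale (*) (?l \<omega>)" for \<omega>
        by (cases \<omega>) (unfold_locales, auto simp: representation_add representation_scale independent_Basis span_Basis algebra_simps)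
    qed
    then obtain p where p: "p \<in> fs.span Y" "p \<noteq> 0" "\<And>w b. w \<in> ?W \<Longrightarrow> b \<in> Basis \<Longrightarrow> representation Basis (p w) b = 0"
      by fastforce
    have "fs.span Y \<subseteq> fs.span {p. ml_poly S p}" by (rule fs.span_mono) (use X(2) Y(1) in auto)
    then have "p \<in> fs.span {p. ml_monomial S p}" using p(1) by (auto simp: ml_poly_span fs.span_span)
    then have mp: "ml_poly S p" using ml_poly_span by blast
    have "p a = 0" for a
    proof (rule multilinear_eq_0[where F = p and a = a, OF S _ C(1)])
      show "Vector_Spaces.linear scale scale (\<lambda>x. p (a(v := x)))" if "v \<in> S" for v a
        by (rule ml_poly_linear[OF mp that])
      fix b assume b: "\<And>v. v \<in> S \<Longrightarrow> b v \<in> C"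
      let ?w = "restrict b S"
      have "p b = p ?w" by (rule ml_poly_cong[OF mp]) auto
      also have "p ?w = 0"
      proof (cases "?w \<in> ?W")
        case True
        then show ?thesis using p(3)[OF True] sum_representation_eq[of Basis "p ?w" Basis]
          by (simp add: finite_Basis independent_Basis span_Basis)
      next
        case False
        have "?w \<in> S \<rightarrow>\<^sub>E C" using b by auto
        then have 0: "\<And>q. ml_monomial S q \<Longrightarrow> q ?w = 0" using False by (auto simp: nonvanishing_words_def)
        from mp show ?thesis
        proof induction
          case (mono p)
          then show ?case by (rule 0)
        qed simp_all
      qed
      finally show "p b = 0" .
    qed
    then show False using p(2) by (auto simp: fun_eq_iff)
  qed
  have "finite X"
  proof (rule ccontr)
    assume "infinite X"
    then obtain Y where Y: "finite Y" "card Y = Suc ?N" "Y \<subseteq> X" using infinite_arbitrarily_large by blast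
    then show False using small[OF Y(3,1)] by simp
  qed
  then show ?thesis using small by blast
qed

lemma ml_basis:
  assumes "finite S"
  obtains X where "finite X" "\<not> module.dependent fun_scale X" "\<And>p. p \<in> X \<Longrightarrow> ml_poly S p"
    "module.span fun_scale X = {p. ml_poly S p}"
    "card X = vector_space.dim fun_scale {p :: ('v \<Rightarrow> 'a) \<Rightarrow> 'a. ml_poly S p}"
proof -
  interpret fs: vector_space "fun_scale :: 'f \<Rightarrow> (('v \<Rightarrow> 'a) \<Rightarrow> 'a) \<Rightarrow> _" by (rule vector_space_fun_scale)
  let ?V = "{p :: ('v \<Rightarrow> 'a) \<Rightarrow> 'a. ml_poly S p}"
  have sub: "fs.subspace ?V" unfolding ml_poly_span by (rule fs.subspace_span)
  obtain X where X: "X \<subseteq> ?V" "fs.independent X" "?V \<subseteq> fs.span X" "card X = fs.dim ?V"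
    using fs.basis_exists[of ?V] by blast
  have "finite X" using ml_independent_bound[OF assms span_Basis finite_Basis X(2)] X(1) by blast
  moreover have "fs.span X = ?V" using X fs.span_minimal[OF X(1) sub] by blast
  ultimately show ?thesis using that X by blast
qed

lemma ml_dim_le:
  assumes "span C = UNIV" "finite C"
  shows "ml_dim n \<le> card (nonvanishing_words {1..n} C) * card Basis"
proof -
  obtain X where X: "finite X" "\<not> module.dependent fun_scale X" "\<And>p. p \<in> X \<Longrightarrow> ml_poly {1..n} p" "card X = ml_dim n"
    using ml_basis[of "{1..n}"] unfolding ml_dim_def by (metis finite_atLeastAtMost)
  then show ?thesis using ml_independent_bound[OF _ assms X(2)] by auto
qed

text \<open>
  The matrix of values of the functions \<open>f w\<close> at the points \<open>pt w\<close> is diagonal without zeros on the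
  diagonal, so the functions are linearly independent.
\<close>

lemma ml_dim_ge:
  assumes finW: "finite W" and S: "finite S" "card S = n" and f: "\<And>w. w \<in> W \<Longrightarrow> ml_poly S (f w)"
    and diag: "\<And>w w'. w \<in> W \<Longrightarrow> w' \<in> W \<Longrightarrow> f w (pt w') \<noteq> 0 \<longleftrightarrow> w = w'"
  shows "card W \<le> ml_dim n"
proof -
  interpret fs: vector_space "fun_scale :: 'f \<Rightarrow> ((nat \<Rightarrow> 'a) \<Rightarrow> 'a) \<Rightarrow> _" by (rule vector_space_fun_scale)
  obtain h where h: "bij_betw h S {1..n}" using S by (metis card_atLeastAtMost diff_Suc_1 finite_atLeastAtMost finite_same_card_bij)
  define F where "F w = (\<lambda>a. f w (a \<circ> h))" for w
  define Pt where "Pt w = pt w \<circ> inv_into S h" for w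
  have Fml: "ml_poly {1..n} (F w)" if "w \<in> W" for w
    using ml_poly_rename[OF f[OF that], of h] h by (simp add: F_def bij_betw_def)
  have dg: "F w (Pt w') \<noteq> 0 \<longleftrightarrow> w = w'" if "w \<in> W" "w' \<in> W" for w w'
  proof -
    have "F w (Pt w') = f w (pt w')"
      unfolding F_def Pt_def by (rule ml_poly_cong[OF f[OF that(1)]]) (use h in \<open>simp add: bij_betw_def\<close>)
    then show ?thesis using diag that by simp
  qed
  have inj: "inj_on F W" using dg by (metis inj_onI)
  have ind: "fs.independent (F ` W)"
  proof
    assume "fs.dependent (F ` W)"
    then have "\<exists>u. (\<exists>v\<in>F ` W. u v \<noteq> 0) \<and> (\<Sum>v\<in>F ` W. fun_scale (u v) v) = 0"
      using fs.dependent_finite[of "F ` W"] finW by simp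
    then obtain u p where p: "p \<in> F ` W" "u p \<noteq> 0" and s: "(\<Sum>q\<in>F ` W. fun_scale (u q) q) = 0"
      by (elim exE conjE bexE) (rule that)
    obtain w where w: "w \<in> W" "p = F w" using p(1) by blast
    have "0 = (\<Sum>q\<in>F ` W. fun_scale (u q) q) (Pt w)" by (simp only: s zero_fun_apply)
    also have "\<dots> = (\<Sum>q\<in>F ` W. scale (u q) (q (Pt w)))"
    proof -
      have "(\<Sum>q\<in>A. fun_scale (u q) q) (Pt w) = (\<Sum>q\<in>A. scale (u q) (q (Pt w)))" if "finite A" for A
        using that by (induction A rule: finite_induct) auto
      then show ?thesis using finW by blast
    qed
    also have "\<dots> = (\<Sum>q\<in>{p}. scale (u q) (q (Pt w)))"
    proof (rule sum.mono_neutral_right)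
      show "\<forall>q\<in>F ` W - {p}. scale (u q) (q (Pt w)) = 0"
      proof
        fix q assume "q \<in> F ` W - {p}"
        then obtain w' where "w' \<in> W" "q = F w'" "w' \<noteq> w" using w by blast
        then show "scale (u q) (q (Pt w)) = 0" using dg[of w' w] w(1) by simp
      qed
    qed (use p finW in auto)
    finally have "scale (u p) (F w (Pt w)) = 0" unfolding w(2) by simp
    then show False using dg[OF w(1) w(1)] p(2) by simp
  qed
  obtain X where X: "finite X" "fs.span X = {p. ml_poly {1..n} p}" "card X = ml_dim n"
    using ml_basis[of "{1..n}"] unfolding ml_dim_def by (metis finite_atLeastAtMost)
  have "card (F ` W) \<le> card X"
    using fs.independent_span_bound[OF X(1) ind] Fml X(2) by auto
  then show ?thesis using X(3) card_image[OF inj] by simp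
qed

text \<open>
  Since products span \<open>A\<close>, the substitution of the product of the last variable with a new one for
  the last variable is injective.
\<close>

lemma ml_dim_mono:
  assumes sp: "span {x \<star> y | x y. True} = UNIV" and n: "1 \<le> n" "n \<le> m"
  shows "ml_dim n \<le> ml_dim m"
  using n(2)
proof (induction m rule: dec_induct)
  case (step m)
  interpret fs: vector_space "fun_scale :: 'f \<Rightarrow> ((nat \<Rightarrow> 'a) \<Rightarrow> 'a) \<Rightarrow> _" by (rule vector_space_fun_scale)
  interpret vp: vector_space_pair "fun_scale :: 'f \<Rightarrow> ((nat \<Rightarrow> 'a) \<Rightarrow> 'a) \<Rightarrow> _" "fun_scale :: 'f \<Rightarrow> ((nat \<Rightarrow> 'a) \<Rightarrow> 'a) \<Rightarrow> _" ..
  have m: "m \<in> {1..m}" using step n by auto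
  define Th where "Th p = (\<lambda>a. p (a(m := a m \<star> a (Suc m))))" for p :: "(nat \<Rightarrow> 'a) \<Rightarrow> 'a"
  have lin: "Vector_Spaces.linear fun_scale fun_scale Th"
    by unfold_locales (auto simp: Th_def fun_eq_iff)
  obtain X where X: "finite X" "fs.independent X" "\<And>p. p \<in> X \<Longrightarrow> ml_poly {1..m} p"
    "fs.span X = {p. ml_poly {1..m} p}" "card X = ml_dim m"
    using ml_basis[of "{1..m}"] unfolding ml_dim_def by (metis finite_atLeastAtMost)
  have v: "ml_monomial {w} (\<lambda>a. a w)" for w :: nat by (rule ml_monomial.var[OF op_id])
  have Thp: "ml_poly {1..Suc m} (Th p)" if "ml_poly {1..m} p" for p
  proof -
    have "ml_poly (({1..m} - {m}) \<union> ({m} \<union> {Suc m})) (Th p)"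
      unfolding Th_def by (rule ml_poly_subst[OF that], intro ml_monomial.prod v) (use m in auto)
    moreover have "({1..m} - {m}) \<union> ({m} \<union> {Suc m}) = {1..Suc m}" using m by auto
    ultimately show ?thesis by simp
  qed
  have inj: "inj_on Th (fs.span X)"
    unfolding vp.linear_inj_on_iff_eq_0[OF lin fs.subspace_span]
  proof (intro ballI impI)
    fix p assume "p \<in> fs.span X" and Th0: "Th p = 0"
    then have p: "ml_poly {1..m} p" using X(4) by auto
    show "p = 0"
    proof
      fix a
      interpret l: Vector_Spaces.linear scale scale "\<lambda>x. p (a(m := x))" by (rule ml_poly_linear[OF p m])
      have 0: "p (a(m := x \<star> y)) = 0" for x y
      proof -
        have "p (a(m := x \<star> y)) = Th p (a(m := x, Suc m := y))"
          unfolding Th_def by (rule ml_poly_cong[OF p]) auto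
        then show ?thesis using Th0 by simp
      qed
      have "p (a(m := z)) = 0" if "z \<in> span {x \<star> y | x y. True}" for z
        using that by (induction rule: span_induct_alt) (auto simp: l.zero l.add l.scale 0 simp del: fun_upd_apply)
      moreover have "a m \<in> span {x \<star> y | x y. True}" by (simp only: sp UNIV_I)
      ultimately have "p (a(m := a m)) = 0" by blast
      then show "p a = 0 a" by simp
    qed
  qed
  have ind: "fs.independent (Th ` X)"
    using vp.linear_independent_injective_image[OF lin X(2) inj] .
  obtain Y where Y: "finite Y" "fs.span Y = {p. ml_poly {1..Suc m} p}" "card Y = ml_dim (Suc m)"
    using ml_basis[of "{1..Suc m}"] unfolding ml_dim_def by (metis finite_atLeastAtMost)
  have "card (Th ` X) \<le> card Y"
    using fs.independent_span_bound[OF Y(1) ind] Thp X(3) Y(2) by auto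
  moreover have "card (Th ` X) = card X"
    using inj fs.span_superset by (metis card_image inj_on_subset)
  ultimately show ?case using step X(5) Y(3) by simp
qed simp

lemma ml_dim_upper: "ml_dim n \<le> card Basis ^ n * card Basis"
proof -
  have "card (nonvanishing_words {1..n} Basis) \<le> card ({1..n} \<rightarrow>\<^sub>E Basis)"
    by (rule card_mono) (auto simp: nonvanishing_words_def intro: finite_PiE finite_Basis)
  then have "card (nonvanishing_words {1..n} Basis) \<le> card Basis ^ n" by (simp add: card_PiE)
  then show ?thesis
    using ml_dim_le[OF span_Basis finite_Basis, of n] by (meson le_trans mult_le_mono1)
qed

subsection \<open>Algebras that are not simple\<close>

definition simple :: bool where
  "simple \<longleftrightarrow> span {x \<star> y | x y. True} \<noteq> {0} \<and> (\<forall>I. G_ideal I \<longrightarrow> I = {0} \<or> I = UNIV)"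

lemma ml_monomial_ideal:
  "ml_monomial S p \<Longrightarrow> G_ideal J \<Longrightarrow> v \<in> S \<Longrightarrow> a v \<in> J \<Longrightarrow> p a \<in> J"
proof (induction rule: ml_monomial.induct)
  case (var g w)
  then show ?case by (auto intro: G_idealD)
next
  case (prod S p T q)
  then show ?case by (auto intro: G_idealD)
qed

lemma ml_monomial_abelian:
  assumes J: "G_ideal J" "\<And>x y. x \<in> J \<Longrightarrow> y \<in> J \<Longrightarrow> x \<star> y = 0"
  shows "ml_monomial S p \<Longrightarrow> u \<in> S \<Longrightarrow> v \<in> S \<Longrightarrow> u \<noteq> v \<Longrightarrow> a u \<in> J \<Longrightarrow> a v \<in> J \<Longrightarrow> p a = 0"
proof (induction rule: ml_monomial.induct)
  case (prod S p T q)
  consider "u \<in> S" "v \<in> S" | "u \<in> T" "v \<in> T" | "u \<in> S" "v \<in> T" | "u \<in> T" "v \<in> S"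
    using prod.prems by blast
  then show ?case
  proof cases
    case 1
    then show ?thesis using prod by (simp add: ml.zero)
  next
    case 2
    then show ?thesis using prod by (simp add: mr.zero)
  next
    case 3
    then show ?thesis
      using ml_monomial_ideal[OF prod.hyps(1) J(1), of u a] ml_monomial_ideal[OF prod.hyps(2) J(1), of v a] prod.prems J(2) by simp
  next
    case 4
    then show ?thesis
      using ml_monomial_ideal[OF prod.hyps(1) J(1), of v a] ml_monomial_ideal[OF prod.hyps(2) J(1), of u a] prod.prems J(2) by simp
  qed
qed auto

text \<open>
  Let the basis contain an element \<open>c0\<close> of \<open>J\<close>. A word in which \<open>c0\<close> occurs twice contributes nothing. Give
  a word the weight \<open>1/2\<close> for each occurrence of \<open>c0\<close>: the contributing words have weight at least \<open>1/2\<close>,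
  and the weights of all words add up to \<open>(d - 1/2)^n\<close>.
\<close>

lemma words_abelian_ideal:
  assumes J: "G_ideal J" "J \<noteq> {0}" "\<And>x y. x \<in> J \<Longrightarrow> y \<in> J \<Longrightarrow> x \<star> y = 0"
  shows "\<exists>C. span C = UNIV \<and> finite C \<and>
    (\<forall>n. real (card (nonvanishing_words {1..n} C)) \<le> 2 * (real (card Basis) - 1 / 2) ^ n)"
proof -
  obtain c0 where c0: "c0 \<in> J" "c0 \<noteq> 0" using J(2) subspace_0[OF G_idealD(1)[OF J(1)]] by blast
  then have ind0: "independent {c0}" by simp
  define C where "C = extend_basis {c0}"
  have C: "independent C" "span C = UNIV" "c0 \<in> C"
    using independent_extend_basis[OF ind0] span_extend_basis[OF ind0] extend_basis_superset[OF ind0]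
    by (auto simp: C_def)
  have fin: "finite C" using C(1) by (rule finiteI_independent)
  have card: "card C = card Basis" using C(1,2) by (metis dim_UNIV dim_eq_card_independent dim_span)
  have "real (card (nonvanishing_words {1..n} C)) \<le> 2 * (real (card Basis) - 1 / 2) ^ n" for n
  proof -
    let ?W = "nonvanishing_words {1..n} C"
    define z :: "'a \<Rightarrow> real" where "z c = (if c = c0 then 1 / 2 else 1)" for c
    have z: "1 / 2 \<le> (\<Prod>i\<in>{1..n}. z (w i))" if w: "w \<in> ?W" for w
    proof -
      obtain p where p: "ml_monomial {1..n} p" "p w \<noteq> 0" using w by (auto simp: nonvanishing_words_def)
      have eq: "u = v" if "u \<in> {i\<in>{1..n}. w i = c0}" "v \<in> {i\<in>{1..n}. w i = c0}" for u v
        using ml_monomial_abelian[OF J(1,3) p(1), of u v w] p(2) that c0(1) by auto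
      define I where "I = {i\<in>{1..n}. w i = c0}"
      have "finite I" by (simp add: I_def)
      then have "card I \<le> Suc 0" using eq by (subst card_le_Suc0_iff_eq) (auto simp: I_def)
      moreover have "(\<Prod>i\<in>{1..n}. z (w i)) = (1 / 2) ^ card I"
      proof -
        have "I = {1..n} \<inter> {i. w i = c0}" by (auto simp: I_def)
        then show ?thesis unfolding z_def by (simp add: prod.If_cases)
      qed
      ultimately show ?thesis by (cases "card I") auto
    qed
    have finP: "finite ({1..n} \<rightarrow>\<^sub>E C)" by (intro finite_PiE) (auto simp: fin)
    have "real (card ?W) * (1 / 2) = (\<Sum>w\<in>?W. 1 / 2)" by simp
    also have "\<dots> \<le> (\<Sum>w\<in>?W. \<Prod>i\<in>{1..n}. z (w i))" by (rule sum_mono) (rule z)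
    also have "\<dots> \<le> (\<Sum>w\<in>{1..n} \<rightarrow>\<^sub>E C. \<Prod>i\<in>{1..n}. z (w i))"
      by (rule sum_mono2[OF finP]) (auto simp: nonvanishing_words_def z_def intro!: prod_nonneg)
    also have "\<dots> = (\<Prod>i\<in>{1..n}. \<Sum>c\<in>C. z c)"
      by (rule prod_sum_PiE[symmetric]) (auto simp: fin)
    also have "(\<Sum>c\<in>C. z c) = real (card Basis) - 1 / 2"
    proof -
      have "(\<Sum>c\<in>C. z c) = z c0 + (\<Sum>c\<in>C - {c0}. z c)" by (rule sum.remove[OF fin C(3)])
      also have "(\<Sum>c\<in>C - {c0}. z c) = (\<Sum>c\<in>C - {c0}. 1)" by (rule sum.cong) (auto simp: z_def)
      also have "card C \<ge> 1" using fin C(3) by (metis One_nat_def Suc_leI card_gt_0_iff empty_iff)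
      ultimately show ?thesis using C(3) fin by (simp add: z_def card card_Diff_singleton of_nat_diff)
    qed
    finally show ?thesis by simp
  qed
  then show ?thesis using C fin by blast
qed

text \<open>
  Let \<open>T x\<close> collect the values of the form at \<open>x\<close> and the elements of a basis of \<open>I\<close>. By assumption \<open>T\<close> is
  injective on \<open>I\<close>, hence maps \<open>I\<close> onto itself, and \<open>T i = T a\<close> for some \<open>i\<close> in \<open>I\<close>.
\<close>

lemma orthogonal_complement_spans:
  assumes I: "subspace I" and disj: "\<And>x. x \<in> I \<Longrightarrow> \<forall>y\<in>I. trace_form x y = 0 \<Longrightarrow> x = 0"
  shows "\<exists>i\<in>I. \<forall>y\<in>I. trace_form (a - i) y = 0"
proof -
  interpret f: Vector_Spaces.linear scale "(*)" "\<lambda>u. trace_form u v" for v by (rule trace_form_linear)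
  obtain C where C: "finite C" "C \<subseteq> I" "independent C" "span C = I" "card C = dim I"
    using basis_subspace_exists[OF I] by metis
  define T where "T x = (\<Sum>c\<in>C. scale (trace_form x c) c)" for x
  have linT: "Vector_Spaces.linear scale scale T"
    by unfold_locales (auto simp: T_def f.add f.scale scale_left_distrib sum.distrib scale_sum_right)
  interpret T: Vector_Spaces.linear scale scale T by (rule linT)
  interpret vp: finite_dimensional_vector_space_pair_1 scale Basis scale ..
  have T0: "\<forall>y\<in>I. trace_form x y = 0" if "T x = 0" for x
  proof
    have c: "trace_form x c = 0" if "c \<in> C" for c
      using C(1,3) \<open>T x = 0\<close> that unfolding T_def independent_explicit by auto
    have c': "trace_form c x = 0" if "c \<in> C" for c using c[OF that] by (metis trace_form_sym)
    fix y assume "y \<in> I"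
    then have "y \<in> span C" using C(4) by simp
    then have "trace_form y x = 0"
      by (induction rule: span_induct_alt) (auto simp: f.add f.scale c')
    then show "trace_form x y = 0" by (simp add: trace_form_sym)
  qed
  have TI: "T x \<in> I" for x
    unfolding T_def using I C(2) by (intro subspace_sum subspace_scale) auto
  have inj: "inj_on T (span I)"
  proof (rule inj_onI)
    fix x y assume xy: "x \<in> span I" "y \<in> span I" "T x = T y"
    then have "x - y \<in> I" using I by (metis span_diff span_eq_iff)
    moreover have "T (x - y) = 0" using xy by (simp add: T.diff)
    ultimately have "x - y = 0" using disj T0 by blast
    then show "x = y" by simp
  qed
  have "dim (T ` I) = dim I" using vp.dim_image_eq[OF linT inj] .
  then have "T ` I = I"
    using subspace_dim_equal[of "T ` I" I] T.subspace_image[OF I] I TI by fastforce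
  then obtain i where i: "i \<in> I" "T i = T a" using TI by (metis imageE)
  then show ?thesis using T0[of "a - i"] by (auto simp: T.diff)
qed

text \<open>
  The product of two elements in the intersection of \<open>I\<close> and its orthogonal complement \<open>I'\<close> is orthogonal to
  \<open>A\<close>, so the intersection is abelian and therefore \<open>0\<close>. Thus \<open>A\<close> is the direct sum of the ideals \<open>I\<close> and \<open>I'\<close>.
  A word with letters from both contributes nothing, as its values lie in the intersection.
\<close>

lemma words_two_ideals:
  assumes nd: "radical = {0}" and I: "G_ideal I" "I \<noteq> {0}" "I \<noteq> UNIV"
    and noab: "\<And>J. G_ideal J \<Longrightarrow> J \<noteq> {0} \<Longrightarrow> \<exists>x\<in>J. \<exists>y\<in>J. x \<star> y \<noteq> 0"
  shows "\<exists>C. span C = UNIV \<and> finite C \<and>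
    (\<forall>n\<ge>1. real (card (nonvanishing_words {1..n} C)) \<le> 2 * (real (card Basis) - 1 / 2) ^ n)"
proof -
  define I' where "I' = {x. \<forall>y\<in>I. trace_form x y = 0}"
  have I': "G_ideal I'" unfolding I'_def by (rule orthogonal_G_ideal[OF I(1)])
  note D = G_idealD[OF I(1)] and D' = G_idealD[OF I']
  have int: "I \<inter> I' = {0}"
  proof (rule ccontr)
    assume ne: "I \<inter> I' \<noteq> {0}"
    have "G_ideal (I \<inter> I')"
      by (rule G_idealI) (auto intro: D D' subspace_inter)
    from noab[OF this ne] obtain x y where xy: "x \<in> I \<inter> I'" "y \<in> I \<inter> I'" "x \<star> y \<noteq> 0" by blast
    have "trace_form (x \<star> y) z = 0" for z
      using xy(1) D(3)[of y z] xy(2) by (simp add: trace_form_mul I'_def)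
    then have "x \<star> y \<in> radical" by (simp add: radical_def)
    then show False using nd xy(3) by simp
  qed
  have spanU: "span (I \<union> I') = UNIV"
  proof -
    have "a \<in> span (I \<union> I')" for a
    proof -
      obtain i where i: "i \<in> I" "\<forall>y\<in>I. trace_form (a - i) y = 0"
        using orthogonal_complement_spans[OF D(1), of a] int by (auto simp: I'_def)
      then have "i + (a - i) \<in> span (I \<union> I')" by (intro span_add span_base) (auto simp: I'_def)
      then show ?thesis by simp
    qed
    then show ?thesis by blast
  qed
  obtain C where C: "C \<subseteq> I \<union> I'" "independent C" "I \<union> I' \<subseteq> span C"
    using maximal_independent_subset by metis
  have spanC: "span C = UNIV"
    using span_minimal[OF C(3) subspace_span] spanU by blast
  have fin: "finite C" using C(2) by (rule finiteI_independent)
  have card: "card C = card Basis" using C(2) spanC by (metis dim_UNIV dim_eq_card_independent dim_span)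
  have prop1: "C \<inter> I \<subset> C"
  proof (rule psubsetI)
    show "C \<inter> I \<noteq> C"
    proof
      assume "C \<inter> I = C"
      then have "span C \<subseteq> I" by (intro span_minimal D(1)) auto
      then show False using spanC I(3) by auto
    qed
  qed auto
  have prop2: "C \<inter> I' \<subset> C"
  proof (rule psubsetI)
    show "C \<inter> I' \<noteq> C"
    proof
      assume "C \<inter> I' = C"
      then have "span C \<subseteq> I'" by (intro span_minimal D'(1)) auto
      then have "trace_form x y = 0" if "y \<in> I" for x y using spanC that by (auto simp: I'_def)
      then have "I \<subseteq> radical" by (auto simp: radical_def) (metis trace_form_sym)
      then show False using nd I(2) subspace_0[OF D(1)] by auto
    qed
  qed auto
  have c1: "card (C \<inter> I) \<le> card Basis - 1" "card (C \<inter> I') \<le> card Basis - 1"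
    using psubset_card_mono[OF fin prop1] psubset_card_mono[OF fin prop2] card by auto
  have "real (card (nonvanishing_words {1..n} C)) \<le> 2 * (real (card Basis) - 1 / 2) ^ n" if n: "1 \<le> n" for n
  proof -
    have sub: "nonvanishing_words {1..n} C \<subseteq> ({1..n} \<rightarrow>\<^sub>E C \<inter> I) \<union> ({1..n} \<rightarrow>\<^sub>E C \<inter> I')"
    proof
      fix w assume w: "w \<in> nonvanishing_words {1..n} C"
      then obtain p where p: "ml_monomial {1..n} p" "p w \<noteq> 0" and wC: "w \<in> {1..n} \<rightarrow>\<^sub>E C"
        by (auto simp: nonvanishing_words_def)
      show "w \<in> ({1..n} \<rightarrow>\<^sub>E C \<inter> I) \<union> ({1..n} \<rightarrow>\<^sub>E C \<inter> I')"
      proof (rule ccontr)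
        assume no: "w \<notin> ({1..n} \<rightarrow>\<^sub>E C \<inter> I) \<union> ({1..n} \<rightarrow>\<^sub>E C \<inter> I')"
        have wi: "w i \<in> C" "w i \<in> I \<or> w i \<in> I'" if "i \<in> {1..n}" for i
          using wC C(1) that by (auto simp: PiE_def Pi_def)
        have "\<exists>i\<in>{1..n}. w i \<notin> I" using no wC wi by (auto simp: PiE_def Pi_def)
        moreover have "\<exists>i\<in>{1..n}. w i \<notin> I'" using no wC wi by (auto simp: PiE_def Pi_def)
        ultimately obtain i j where "i \<in> {1..n}" "w i \<in> I'" "j \<in> {1..n}" "w j \<in> I" using wi by blast
        then have "p w \<in> I \<inter> I'" using ml_monomial_ideal[OF p(1)] I(1) I' by blast
        then show False using int p(2) by blast
      qed
    qed
    have "card (nonvanishing_words {1..n} C) \<le> card ({1..n} \<rightarrow>\<^sub>E C \<inter> I) + card ({1..n} \<rightarrow>\<^sub>E C \<inter> I')"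
      by (rule order_trans[OF card_mono[OF _ sub] card_Un_le]) (auto intro!: finite_PiE simp: fin)
    also have "\<dots> = card (C \<inter> I) ^ n + card (C \<inter> I') ^ n" by (simp add: card_PiE)
    also have "\<dots> \<le> (card Basis - 1) ^ n + (card Basis - 1) ^ n"
      by (intro add_mono power_mono c1) auto
    finally have "card (nonvanishing_words {1..n} C) \<le> 2 * (card Basis - 1) ^ n" by simp
    then have "real (card (nonvanishing_words {1..n} C)) \<le> real (2 * (card Basis - 1) ^ n)"
      by (simp only: of_nat_le_iff)
    then have "real (card (nonvanishing_words {1..n} C)) \<le> 2 * real (card Basis - 1) ^ n" by simp
    also have "\<dots> \<le> 2 * (real (card Basis) - 1 / 2) ^ n"
    proof -
      have "card Basis \<ge> 1" using psubset_card_mono[OF fin prop1] card by simp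
      then show ?thesis by (intro mult_left_mono power_mono) (auto simp: of_nat_diff)
    qed
    finally show ?thesis .
  qed
  then show ?thesis using spanC fin by blast
qed

theorem ml_dim_not_simple:
  assumes ns: "\<not> simple" and ne: "(UNIV :: 'a set) \<noteq> {0}" and n: "1 \<le> n"
  shows "real (ml_dim n) \<le> 2 * real (card Basis) * (real (card Basis) - 1 / 2) ^ n"
proof -
  have "\<exists>C. span C = UNIV \<and> finite C \<and>
    (\<forall>n\<ge>1. real (card (nonvanishing_words {1..n} C)) \<le> 2 * (real (card Basis) - 1 / 2) ^ n)"
  proof (cases "\<exists>J. G_ideal J \<and> J \<noteq> {0} \<and> (\<forall>x\<in>J. \<forall>y\<in>J. x \<star> y = 0)")
    case True
    then obtain J where J: "G_ideal J" "J \<noteq> {0}" "\<And>x y. x \<in> J \<Longrightarrow> y \<in> J \<Longrightarrow> x \<star> y = 0" by blast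
    show ?thesis using words_abelian_ideal[OF J] by blast
  next
    case False
    then have nd: "radical = {0}" using abelian_ideal_or_nondegenerate by blast
    \<comment> \<open>If all products were \<open>0\<close>, the whole algebra would be an abelian ideal.\<close>
    have "span {x \<star> y | x y. True} \<noteq> {0}"
    proof
      assume "span {x \<star> y | x y. True} = {0}"
      then have "x \<star> y = 0" for x y using span_base[of "x \<star> y" "{x \<star> y | x y. True}"] by blast
      then show False using False G_ideal_UNIV ne by blast
    qed
    then obtain I where I: "G_ideal I" "I \<noteq> {0}" "I \<noteq> UNIV" using ns by (auto simp: simple_def)
    show ?thesis by (rule words_two_ideals[OF nd I]) (use False in blast)
  qed
  then obtain C where C: "span C = UNIV" "finite C"
    "real (card (nonvanishing_words {1..n} C)) \<le> 2 * (real (card Basis) - 1 / 2) ^ n" using n by blast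
  have "real (ml_dim n) \<le> real (card (nonvanishing_words {1..n} C)) * real (card Basis)"
    using ml_dim_le[OF C(1,2), of n] by (metis of_nat_le_iff of_nat_mult)
  also have "\<dots> \<le> 2 * (real (card Basis) - 1 / 2) ^ n * real (card Basis)"
    by (rule mult_right_mono[OF C(3)]) simp
  finally show ?thesis by (simp add: mult_ac)
qed

end

section \<open>An alternating function on a simple algebra\<close>

context alg_ops
begin

subsection \<open>Operators of rank one\<close>

inductive_set mult_ops :: "('a \<Rightarrow> 'a) set" where
  op: "g \<in> Ops \<Longrightarrow> g \<in> mult_ops"
| left: "T \<in> mult_ops \<Longrightarrow> (\<lambda>x. a \<star> T x) \<in> mult_ops"
| right: "T \<in> mult_ops \<Longrightarrow> (\<lambda>x. T x \<star> a) \<in> mult_ops"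

definition mult_alg :: "('a \<Rightarrow> 'a) set" where
  "mult_alg = module.span fun_scale mult_ops"

lemma mult_ops_linear: "T \<in> mult_ops \<Longrightarrow> Vector_Spaces.linear scale scale T"
  by (induction rule: mult_ops.induct)
    (auto intro: op_linear linear_comp[OF linear_mul_right] linear_comp[OF linear_mul_left])

lemma mult_ops_op: "T \<in> mult_ops \<Longrightarrow> g \<in> Ops \<Longrightarrow> (\<lambda>x. g (T x)) \<in> mult_ops"
proof (induction rule: mult_ops.induct)
  case (op h)
  then show ?case using mult_ops.op[OF op_comp[of g h]] by simp
next
  case (left T a)
  from op_mul[OF left.prems] show ?case
    using mult_ops.left[OF left.IH[OF left.prems], of "g a"] mult_ops.right[OF left.IH[OF left.prems], of "g a"] by auto
next
  case (right T a)
  from op_mul[OF right.prems] show ?case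
    using mult_ops.left[OF right.IH[OF right.prems], of "g a"] mult_ops.right[OF right.IH[OF right.prems], of "g a"] by auto
qed

lemma mult_ops_comp: "S \<in> mult_ops \<Longrightarrow> T \<in> mult_ops \<Longrightarrow> (\<lambda>x. S (T x)) \<in> mult_ops"
  by (induction rule: mult_ops.induct) (auto intro: mult_ops_op mult_ops.intros)

lemma mult_alg_induct [consumes 1, case_names zero add ops]:
  assumes T: "T \<in> mult_alg" and 0: "P (\<lambda>x. 0)"
    and add: "\<And>c S T. S \<in> mult_ops \<Longrightarrow> P S \<Longrightarrow> T \<in> mult_alg \<Longrightarrow> P T \<Longrightarrow> P (\<lambda>x. scale c (S x) + T x)"
    and ops: "\<And>S. S \<in> mult_ops \<Longrightarrow> P S"
  shows "P T"
proof -
  interpret fs: vector_space "fun_scale :: 'f \<Rightarrow> ('a \<Rightarrow> 'a) \<Rightarrow> _" by (rule vector_space_fun_scale)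
  have "T \<in> mult_alg \<and> P T"
    using T unfolding mult_alg_def
  proof (induction rule: fs.span_induct_alt)
    case base
    show ?case using fs.span_zero 0 unfolding zero_fun_def by blast
  next
    case (step c S T)
    then have "T \<in> mult_alg" "P T" unfolding mult_alg_def by blast+
    then have P: "P (\<lambda>x. scale c (S x) + T x)" by (rule add[OF step(1) ops[OF step(1)]])
    have eq: "fun_scale c S + T = (\<lambda>x. scale c (S x) + T x)" by (auto simp: fun_eq_iff)
    have "fun_scale c S + T \<in> fs.span mult_ops"
      by (rule fs.span_add[OF fs.span_scale[OF fs.span_base[OF step(1)]] conjunct1[OF step(2)]])
    moreover have "P (fun_scale c S + T)" unfolding eq by (rule P)
    ultimately show ?case ..
  qed
  then show ?thesis ..
qed

lemma mult_alg_ops: "T \<in> mult_ops \<Longrightarrow> T \<in> mult_alg"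
proof -
  interpret fs: vector_space "fun_scale :: 'f \<Rightarrow> ('a \<Rightarrow> 'a) \<Rightarrow> _" by (rule vector_space_fun_scale)
  show "T \<in> mult_ops \<Longrightarrow> T \<in> mult_alg" unfolding mult_alg_def by (rule fs.span_base)
qed

lemma mult_alg_lincomb: "S \<in> mult_alg \<Longrightarrow> T \<in> mult_alg \<Longrightarrow> (\<lambda>x. scale c (S x) + T x) \<in> mult_alg"
proof -
  interpret fs: vector_space "fun_scale :: 'f \<Rightarrow> ('a \<Rightarrow> 'a) \<Rightarrow> _" by (rule vector_space_fun_scale)
  assume "S \<in> mult_alg" "T \<in> mult_alg"
  then have "fun_scale c S + T \<in> mult_alg" unfolding mult_alg_def by (intro fs.span_add fs.span_scale)
  then show ?thesis by (simp add: plus_fun_def fun_scale_def)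
qed

lemma mult_alg_zero: "(\<lambda>x. 0) \<in> mult_alg"
proof -
  interpret fs: vector_space "fun_scale :: 'f \<Rightarrow> ('a \<Rightarrow> 'a) \<Rightarrow> _" by (rule vector_space_fun_scale)
  show ?thesis using fs.span_zero[of mult_ops] by (simp add: mult_alg_def zero_fun_def)
qed

lemma mult_alg_linear:
  assumes "T \<in> mult_alg"
  shows "Vector_Spaces.linear scale scale T"
  using assms
proof (induction rule: mult_alg_induct)
  case zero
  show ?case by (simp add: Vector_Spaces.linear_iff vector_space_axioms)
next
  case (add c S T)
  then show ?case
    by (auto simp: Vector_Spaces.linear_iff scale_right_distrib mult.commute algebra_simps)
qed (rule mult_ops_linear)

lemma mult_alg_comp:
  assumes S: "S \<in> mult_alg" and T: "T \<in> mult_alg"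
  shows "(\<lambda>x. S (T x)) \<in> mult_alg"
  using S
proof (induction rule: mult_alg_induct)
  case zero
  show ?case by (rule mult_alg_zero)
next
  case (add c S S')
  then show ?case by (intro mult_alg_lincomb)
next
  case (ops S)
  interpret S: Vector_Spaces.linear scale scale S by (rule mult_ops_linear[OF ops])
  show ?case using T
  proof (induction rule: mult_alg_induct)
    case zero
    show ?case using mult_alg_zero by (simp add: S.zero)
  next
    case (add c R T)
    then show ?case using mult_alg_lincomb[of "\<lambda>x. S (R x)" "\<lambda>x. S (T x)" c] by (simp add: S.add S.scale)
  next
    case (ops T)
    then show ?case using mult_ops_comp \<open>S \<in> mult_ops\<close> mult_alg_ops by blast
  qed
qed

text \<open>
  The orbit of \<open>x\<close> is a \<open>G\<close>-invariant ideal.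
\<close>

lemma mult_alg_transitive:
  assumes simple: "\<And>I. G_ideal I \<Longrightarrow> I = {0} \<or> I = UNIV" and x: "x \<noteq> 0"
  shows "\<exists>T\<in>mult_alg. T x = y"
proof -
  let ?I = "(\<lambda>T. T x) ` mult_alg"
  have 0: "(\<lambda>x. 0) \<in> mult_alg" by (rule mult_alg_zero)
  have "G_ideal ?I"
  proof (rule G_idealI)
    show "subspace ?I"
    proof (rule subspaceI)
      show "0 \<in> ?I" using 0 by (rule rev_image_eqI) simp
      fix u v assume "u \<in> ?I" "v \<in> ?I"
      then obtain S T where ST: "S \<in> mult_alg" "T \<in> mult_alg" "u = S x" "v = T x" by blast
      show "u + v \<in> ?I"
        by (rule rev_image_eqI[OF mult_alg_lincomb[OF ST(1,2), of 1]]) (simp add: ST)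
    next
      fix c u assume "u \<in> ?I"
      then obtain S where S: "S \<in> mult_alg" "u = S x" by blast
      show "scale c u \<in> ?I"
        by (rule rev_image_eqI[OF mult_alg_lincomb[OF S(1) 0, of c]]) (simp add: S)
    qed
    fix a u assume "u \<in> ?I"
    then obtain S where S: "S \<in> mult_alg" "u = S x" by blast
    have L: "(\<lambda>y. a \<star> y) \<in> mult_alg" "(\<lambda>y. y \<star> a) \<in> mult_alg"
      using mult_ops.left[OF mult_ops.op[OF op_id]] mult_ops.right[OF mult_ops.op[OF op_id]] mult_alg_ops by auto
    show "a \<star> u \<in> ?I" using mult_alg_comp[OF L(1) S(1)] S(2) by (intro rev_image_eqI) auto
    show "u \<star> a \<in> ?I" using mult_alg_comp[OF L(2) S(1)] S(2) by (intro rev_image_eqI) auto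
  next
    fix g u assume g: "g \<in> Ops" "u \<in> ?I"
    then obtain S where S: "S \<in> mult_alg" "u = S x" by blast
    show "g u \<in> ?I" using mult_alg_comp[OF mult_alg_ops[OF mult_ops.op[OF g(1)]] S(1)] S(2)
      by (intro rev_image_eqI) auto
  qed
  moreover have "x \<in> ?I" using mult_alg_ops[OF mult_ops.op[OF op_id]] by (rule rev_image_eqI) simp
  ultimately have "?I = UNIV" using simple x by blast
  then have "y \<in> ?I" by simp
  then show ?thesis by blast
qed

lemma exists_eigenvector:
  assumes T: "Vector_Spaces.linear scale scale T" and U: "subspace U" "T ` U \<subseteq> U" "U \<noteq> {0}"
  shows "\<exists>v\<in>U. \<exists>\<mu>. v \<noteq> 0 \<and> T v = scale \<mu> v"
proof -
  have fvs: "finite_dimensional_vector_space scale Basis" ..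
  obtain u where u: "u \<in> U" "u \<noteq> 0" using U subspace_0 by blast
  have "\<exists>\<mu>. \<exists>v \<in> gen_eigenspace T \<mu> \<inter> U. v \<noteq> 0"
  proof (rule ccontr)
    assume no: "\<not> ?thesis"
    then have "(\<Union>\<mu>. gen_eigenspace T \<mu> \<inter> U) \<subseteq> {0}" by blast
    then have "span (\<Union>\<mu>. gen_eigenspace T \<mu> \<inter> U) \<subseteq> {0}" by (metis span_empty span_insert_0 span_mono)
    then show False using span_gen_eigenspaces[OF fvs T U(1,2) u(1)] u(2) by blast
  qed
  then obtain \<mu> v where v: "v \<in> gen_eigenspace T \<mu>" "v \<in> U" "v \<noteq> 0" by blast
  then obtain m where "(eig_diff T \<mu> ^^ m) v = 0" by (auto simp: gen_eigenspace_def)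
  then show ?thesis using v(2,3)
  proof (induction m arbitrary: v)
    case (Suc m)
    show ?case
    proof (cases "eig_diff T \<mu> v = 0")
      case True
      then have "T v = scale \<mu> v" by (simp add: eig_diff_def)
      then show ?thesis using Suc.prems by blast
    next
      case False
      have "eig_diff T \<mu> v \<in> U"
        using Suc.prems U by (auto simp: eig_diff_def intro!: subspace_diff subspace_scale)
      then show ?thesis using Suc.IH[of "eig_diff T \<mu> v"] Suc.prems(1) False by (simp add: funpow_swap1)
    qed
  qed simp
qed

text \<open>
  The argument of Lomonosov and Rosenthal for Burnside's theorem. Among the nonzero operators, let
  \<open>T\<close> have a kernel of maximal dimension. If \<open>T x1\<close> and \<open>T x2\<close> were independent, choose \<open>S\<close> with
  \<open>S (T x1) = x2\<close> and an eigenvalue \<open>\<mu>\<close> of \<open>T S\<close> on the range of \<open>T\<close>. Then \<open>T S T - \<mu> T\<close> has a larger kernel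
  than \<open>T\<close>, but it does not vanish at \<open>x1\<close>.
\<close>

theorem rank_one_operators:
  assumes simple: "\<And>I. G_ideal I \<Longrightarrow> I = {0} \<or> I = UNIV" and ne: "(UNIV :: 'a set) \<noteq> {0}"
  shows "\<exists>l. Vector_Spaces.linear scale (*) l \<and> (\<exists>x. l x \<noteq> 0) \<and> (\<forall>v. (\<lambda>x. scale (l x) v) \<in> mult_alg)"
proof -
  let ?ker = "\<lambda>T :: 'a \<Rightarrow> 'a. {x. T x = 0}"
  have idm: "(\<lambda>x. x) \<in> mult_alg" by (rule mult_alg_ops[OF mult_ops.op[OF op_id]])
  obtain x0 :: 'a where "x0 \<noteq> 0" using ne by blast
  define good where "good T \<longleftrightarrow> T \<in> mult_alg \<and> (\<exists>x. T x \<noteq> 0)" for T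
  have "good (\<lambda>x. x)" using idm \<open>x0 \<noteq> 0\<close> by (auto simp: good_def)
  moreover have "dim (?ker T) < Suc (card Basis)" for T
    using dim_subset_UNIV[of "?ker T"] by (simp add: dimension_def)
  ultimately obtain T where T: "good T" and max: "\<And>S. good S \<Longrightarrow> dim (?ker S) \<le> dim (?ker T)"
    using ex_has_greatest_nat[of good "\<lambda>x. x" "\<lambda>T. dim (?ker T)" "Suc (card Basis)"] by blast
  have TM: "T \<in> mult_alg" using T good_def by blast
  interpret T: Vector_Spaces.linear scale scale T by (rule mult_alg_linear[OF TM])
  obtain x1 where x1: "T x1 \<noteq> 0" using T good_def by blast
  have rank1: "T x2 \<in> span {T x1}" for x2
  proof (rule ccontr)
    assume x2: "T x2 \<notin> span {T x1}"
    obtain S where S: "S \<in> mult_alg" "S (T x1) = x2" using mult_alg_transitive[OF simple x1] by blast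
    interpret S: Vector_Spaces.linear scale scale S by (rule mult_alg_linear[OF S(1)])
    have "range T \<noteq> {0}" using x1 by blast
    then obtain v \<mu> where v: "v \<in> range T" "v \<noteq> 0" "T (S v) = scale \<mu> v"
      using exists_eigenvector[OF linear_comp[OF mult_alg_linear[OF TM] mult_alg_linear[OF S(1)]], of "range T"]
        T.subspace_image[OF subspace_UNIV] by blast
    obtain u where u: "v = T u" using v(1) by blast
    define T' where "T' = (\<lambda>x. scale (- \<mu>) (T x) + T (S (T x)))"
    have T'M: "T' \<in> mult_alg" unfolding T'_def
      by (rule mult_alg_lincomb[OF TM mult_alg_comp[OF TM mult_alg_comp[OF S(1) TM]]])
    interpret T': Vector_Spaces.linear scale scale T' by (rule mult_alg_linear[OF T'M])
    have "T' x1 \<noteq> 0"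
    proof
      assume "T' x1 = 0"
      then have "T x2 = scale \<mu> (T x1)" by (simp add: T'_def S(2))
      then show False using x2 span_scale[OF span_base, of "T x1" "{T x1}" \<mu>] by simp
    qed
    then have "good T'" using T'M good_def by blast
    then have le: "dim (?ker T') \<le> dim (?ker T)" by (rule max)
    have subs: "?ker T \<subseteq> ?ker T'" by (auto simp: T'_def S.zero T.zero)
    have "u \<in> ?ker T'" "u \<notin> ?ker T" using v u by (auto simp: T'_def)
    then have "?ker T \<noteq> ?ker T'" by blast
    moreover have "?ker T = ?ker T'"
      by (rule subspace_dim_equal[OF T.subspace_kernel T'.subspace_kernel subs le])
    ultimately show False by blast
  qed
  define l where "l x = representation {T x1} (T x) (T x1)" for x
  have ind: "independent {T x1}" using x1 by simp
  have Tl: "T x = scale (l x) (T x1)" for x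
    using sum_representation_eq[OF ind rank1[of x], of "{T x1}"] by (simp add: l_def)
  have lin: "Vector_Spaces.linear scale (*) l"
    by unfold_locales (auto simp: l_def T.add T.scale representation_add[OF ind rank1 rank1] representation_scale[OF ind rank1] algebra_simps)
  have "l x1 \<noteq> 0" using Tl[of x1] x1 by auto
  moreover have "(\<lambda>x. scale (l x) v) \<in> mult_alg" for v
  proof -
    obtain S where S: "S \<in> mult_alg" "S (T x1) = v" using mult_alg_transitive[OF simple x1] by blast
    interpret S: Vector_Spaces.linear scale scale S by (rule mult_alg_linear[OF S(1)])
    have "(\<lambda>x. S (T x)) = (\<lambda>x. scale (l x) v)" by (subst Tl) (simp add: S.scale S(2))
    then show ?thesis using mult_alg_comp[OF S(1) TM] by simp
  qed
  ultimately show ?thesis using lin by blast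
qed

subsection \<open>Multilinear functions with constants\<close>

inductive const_monomial :: "nat set \<Rightarrow> ((nat \<Rightarrow> 'a) \<Rightarrow> 'a) \<Rightarrow> bool" where
  const: "const_monomial {} (\<lambda>x. c)"
| var: "g \<in> Ops \<Longrightarrow> const_monomial {i} (\<lambda>x. g (x i))"
| prod: "const_monomial S p \<Longrightarrow> const_monomial T q \<Longrightarrow> S \<inter> T = {} \<Longrightarrow> const_monomial (S \<union> T) (\<lambda>x. p x \<star> q x)"

inductive const_poly :: "nat set \<Rightarrow> ((nat \<Rightarrow> 'a) \<Rightarrow> 'a) \<Rightarrow> bool" for S where
  mono: "const_monomial S p \<Longrightarrow> const_poly S p"
| zero: "const_poly S (\<lambda>a. 0)"
| lincomb: "const_poly S p \<Longrightarrow> const_poly S q \<Longrightarrow> const_poly S (\<lambda>a. scale c (p a) + q a)"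

lemma const_monomial_op: "const_monomial S p \<Longrightarrow> g \<in> Ops \<Longrightarrow> const_monomial S (\<lambda>x. g (p x))"
proof (induction rule: const_monomial.induct)
  case (const c)
  show ?case by (rule const_monomial.const)
next
  case (var h i)
  then show ?case using const_monomial.var[OF op_comp[of g h]] by simp
next
  case (prod S p T q)
  note 1 = prod.IH(1)[OF prod.prems] and 2 = prod.IH(2)[OF prod.prems]
  from op_mul[OF prod.prems] show ?case
  proof
    assume "\<forall>x y. g (x \<star> y) = g x \<star> g y"
    then show ?thesis using const_monomial.prod[OF 1 2 prod.hyps(3)] by simp
  next
    assume "\<forall>x y. g (x \<star> y) = g y \<star> g x"
    then show ?thesis using const_monomial.prod[OF 2 1] prod.hyps(3) by (simp add: Un_commute Int_commute)
  qed
qed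

lemma const_monomial_mult_ops: "T \<in> mult_ops \<Longrightarrow> const_monomial S p \<Longrightarrow> const_monomial S (\<lambda>x. T (p x))"
proof (induction rule: mult_ops.induct)
  case (op g)
  then show ?case by (simp add: const_monomial_op)
next
  case (left T a)
  then show ?case using const_monomial.prod[OF const_monomial.const[of a], of S "\<lambda>x. T (p x)"] by simp
next
  case (right T a)
  then show ?case using const_monomial.prod[OF _ const_monomial.const[of a], of S "\<lambda>x. T (p x)"] by simp
qed

lemma const_poly_mult_ops:
  assumes "T \<in> mult_ops" "const_poly S p"
  shows "const_poly S (\<lambda>x. T (p x))"
proof -
  interpret T: Vector_Spaces.linear scale scale T by (rule mult_ops_linear[OF assms(1)])
  from assms(2) show ?thesis
    by induction (auto simp: T.zero T.add T.scale intro: const_poly.intros const_monomial_mult_ops[OF assms(1)])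
qed

lemma const_poly_mult_alg: "T \<in> mult_alg \<Longrightarrow> const_poly S p \<Longrightarrow> const_poly S (\<lambda>x. T (p x))"
  by (induction rule: mult_alg_induct) (auto intro: const_poly.zero const_poly.lincomb const_poly_mult_ops)

lemma const_poly_mul_var:
  assumes "const_poly S p" "k \<notin> S"
  shows "const_poly (insert k S) (\<lambda>x. x k \<star> p x)" "const_poly (insert k S) (\<lambda>x. p x \<star> x k)"
proof -
  have v: "const_monomial {k} (\<lambda>x. x k)" by (rule const_monomial.var[OF op_id])
  have 1: "const_monomial (insert k S) (\<lambda>x. x k \<star> p x)" "const_monomial (insert k S) (\<lambda>x. p x \<star> x k)"
    if "const_monomial S p" for p
    using const_monomial.prod[OF v that] const_monomial.prod[OF that v] assms(2) by auto
  from assms(1) show "const_poly (insert k S) (\<lambda>x. x k \<star> p x)"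
    by induction (auto simp: mr.zero mr.add mr.scale intro: const_poly.intros 1)
  from assms(1) show "const_poly (insert k S) (\<lambda>x. p x \<star> x k)"
    by induction (auto simp: ml.zero ml.add ml.scale intro: const_poly.intros 1)
qed

text \<open>
  The constants become values of additional variables. These are chosen above an arbitrary bound \<open>N\<close>,
  which keeps the additional variables of the two factors of a product apart.
\<close>

lemma const_monomial_lift:
  "const_monomial S p \<Longrightarrow> finite S \<and> (\<forall>N. (\<forall>i\<in>S. i < N) \<longrightarrow>
    (\<exists>E q a. finite E \<and> (\<forall>i\<in>E. N \<le> i) \<and> ml_monomial (S \<union> E) q \<and> (\<forall>x. q (\<lambda>i. if i \<in> S then x i else a i) = p x)))"
proof (induction rule: const_monomial.induct)
  case (const c)
  have "ml_monomial {N} (\<lambda>a. a N)" for N by (rule ml_monomial.var[OF op_id])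
  then show ?case by (intro conjI allI impI exI[of _ "{N}" for N] exI[of _ "\<lambda>a. a N" for N] exI[of _ "\<lambda>_. c"]) auto
next
  case (var g i)
  have "ml_monomial ({i} \<union> {}) (\<lambda>a. g (a i))" using ml_monomial.var[OF var] by simp
  then show ?case by (intro conjI allI impI exI[of _ "{}"] exI[of _ "\<lambda>a. g (a i)"] exI[of _ "\<lambda>_. 0"]) auto
next
  case (prod S p T q)
  have "\<exists>E r a. finite E \<and> (\<forall>i\<in>E. N \<le> i) \<and> ml_monomial (S \<union> T \<union> E) r \<and>
      (\<forall>x. r (\<lambda>i. if i \<in> S \<union> T then x i else a i) = p x \<star> q x)" if N: "\<forall>i\<in>S \<union> T. i < N" for N
  proof -
    obtain E1 p' a1 where 1: "finite E1" "\<forall>i\<in>E1. N \<le> i" "ml_monomial (S \<union> E1) p'"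
      "\<And>x. p' (\<lambda>i. if i \<in> S then x i else a1 i) = p x"
      using prod.IH(1) N by blast
    \<comment> \<open>\<open>N2\<close> lies above all variables that stand for the constants of the first factor.\<close>
    define N2 where "N2 = Suc (N + Max (insert 0 E1))"
    have E1: "i < N2" if "i \<in> E1" for i
    proof -
      have "i \<le> Max (insert 0 E1)" using that 1(1) by (intro Max_ge) auto
      then show ?thesis by (simp add: N2_def)
    qed
    have "\<forall>i\<in>T. i < N2" using N by (auto simp: N2_def less_Suc_eq trans_less_add1)
    then obtain E2 q' a2 where 2: "finite E2" "\<forall>i\<in>E2. N2 \<le> i" "ml_monomial (T \<union> E2) q'"
      "\<And>x. q' (\<lambda>i. if i \<in> T then x i else a2 i) = q x"
      using prod.IH(2) by blast
    have NN: "N \<le> N2" by (simp add: N2_def)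
    define a where "a i = (if i \<in> E1 then a1 i else a2 i)" for i
    have old: "i \<notin> S \<union> T" if "i \<in> E1 \<union> E2" for i
    proof
      assume "i \<in> S \<union> T"
      then have "i < N" using N by blast
      moreover have "N \<le> i" using that 1(2) 2(2) NN by (meson UnE order_trans)
      ultimately show False by simp
    qed
    have new: "i \<notin> E1" if "i \<in> E2" for i
      using E1[of i] bspec[OF 2(2) that] by auto
    have disj: "(S \<union> E1) \<inter> (T \<union> E2) = {}"
      using prod.hyps(3) old new by blast
    have "ml_monomial ((S \<union> E1) \<union> (T \<union> E2)) (\<lambda>x. p' x \<star> q' x)"
      by (rule ml_monomial.prod[OF 1(3) 2(3) disj])
    moreover have "(S \<union> E1) \<union> (T \<union> E2) = S \<union> T \<union> (E1 \<union> E2)" by auto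
    moreover have "p' (\<lambda>i. if i \<in> S \<union> T then x i else a i) \<star> q' (\<lambda>i. if i \<in> S \<union> T then x i else a i) = p x \<star> q x" for x
    proof -
      have "p' (\<lambda>i. if i \<in> S \<union> T then x i else a i) = p' (\<lambda>i. if i \<in> S then x i else a1 i)"
        by (rule ml_monomial_cong[OF 1(3)]) (use old in \<open>auto simp: a_def\<close>)
      moreover have "q' (\<lambda>i. if i \<in> S \<union> T then x i else a i) = q' (\<lambda>i. if i \<in> T then x i else a2 i)"
        by (rule ml_monomial_cong[OF 2(3)]) (use old new in \<open>auto simp: a_def\<close>)
      ultimately show ?thesis using 1(4) 2(4) by simp
    qed
    moreover have "\<forall>i\<in>E1 \<union> E2. N \<le> i" using 1(2) 2(2) NN by fastforce
    ultimately show ?thesis using 1(1) 2(1)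
      by (intro exI[of _ "E1 \<union> E2"] exI[of _ "\<lambda>x. p' x \<star> q' x"] exI[of _ a]) simp
  qed
  then show ?case using prod.IH by blast
qed

subsection \<open>Products of functionals\<close>

text \<open>
  Let \<open>z \<noteq> 0\<close> be in the common kernel of the functionals found so far. Because the form is nondegenerate,
  \<open>z u\<close> or \<open>u z\<close> is nonzero for some \<open>u\<close>, and an operator \<open>S\<close> moves it to a vector at which the
  functional \<open>l\<close> of the rank one operators does not vanish. The new functional is
  \<open>x \<mapsto> l (S (x u))\<close> or \<open>x \<mapsto> l (S (u x))\<close>: multiplying the function with value \<open>u\<close> by the new
  variable and applying \<open>S\<close> and a rank one operator produces one more factor and an arbitrary value \<open>v\<close>.
\<close>

lemma triangular_functionals:
  assumes simple: "\<And>I. G_ideal I \<Longrightarrow> I = {0} \<or> I = UNIV" and ne: "(UNIV :: 'a set) \<noteq> {0}"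
    and nd: "radical = {0}" and k: "k \<le> card Basis"
  shows "\<exists>\<phi> y. (\<forall>i<k. Vector_Spaces.linear scale (*) (\<phi> i) \<and> \<phi> i (y i) \<noteq> 0 \<and> (\<forall>j<i. \<phi> j (y i) = 0)) \<and>
    (\<forall>v. const_poly {..<k} (\<lambda>x. scale (\<Prod>i<k. \<phi> i (x i)) v))"
  using k
proof (induction k)
  case 0
  have "const_poly {} (\<lambda>x. v)" for v by (intro const_poly.mono const_monomial.const)
  then show ?case by simp
next
  case (Suc k)
  from Suc.IH[OF Suc_leD[OF Suc.prems]] obtain \<phi> y where
    tri: "\<forall>i<k. Vector_Spaces.linear scale (*) (\<phi> i) \<and> \<phi> i (y i) \<noteq> 0 \<and> (\<forall>j<i. \<phi> j (y i) = 0)"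
    and poly: "\<forall>v. const_poly {..<k} (\<lambda>x. scale (\<Prod>i<k. \<phi> i (x i)) v)"
    by (elim exE conjE) (rule that)
  have IH: "\<And>i. i < k \<Longrightarrow> Vector_Spaces.linear scale (*) (\<phi> i)"
    "\<And>i. i < k \<Longrightarrow> \<phi> i (y i) \<noteq> 0" "\<And>i j. i < k \<Longrightarrow> j < i \<Longrightarrow> \<phi> j (y i) = 0"
    using tri by blast+
  note IH = IH spec[OF poly]
  obtain z where z: "z \<noteq> 0" "\<And>i. i < k \<Longrightarrow> \<phi> i z = 0"
    using common_kernel[of "{..<k}" \<phi> Basis] IH(1) independent_Basis finite_Basis Suc.prems by auto
  from rank_one_operators[OF simple ne] obtain l where l: "Vector_Spaces.linear scale (*) l" "\<exists>x. l x \<noteq> 0"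
    "\<forall>v. (\<lambda>x. scale (l x) v) \<in> mult_alg" by blast
  obtain x0 where x0: "l x0 \<noteq> 0" using l(2) by blast
  obtain u where u: "z \<star> u \<noteq> 0 \<or> u \<star> z \<noteq> 0"
  proof (rule ccontr)
    assume no: "\<not> thesis"
    then have "z \<star> u = 0" "u \<star> z = 0" for u using that by blast+
    then have "trace_form z w = 0" for w by (simp add: trace_form_def trace_zero)
    then show False using nd z(1) by (auto simp: radical_def)
  qed
  define m where "m x = (if z \<star> u \<noteq> 0 then x \<star> u else u \<star> x)" for x
  have mz: "m z \<noteq> 0" using u by (auto simp: m_def)
  have linm: "Vector_Spaces.linear scale scale m"
    unfolding m_def by (cases "z \<star> u \<noteq> 0") (simp_all add: linear_mul_left linear_mul_right)
  obtain S where S: "S \<in> mult_alg" "S (m z) = x0" using mult_alg_transitive[OF simple mz] by blast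
  define \<psi> where "\<psi> x = l (S (m x))" for x
  have lin\<psi>: "Vector_Spaces.linear scale (*) \<psi>"
    using Vector_Spaces.linear_compose[OF linear_comp[OF mult_alg_linear[OF S(1)] linm] l(1)] by (simp add: \<psi>_def[abs_def] o_def)
  have \<psi>z: "\<psi> z \<noteq> 0" using x0 by (simp add: \<psi>_def S(2))
  interpret S: Vector_Spaces.linear scale scale S by (rule mult_alg_linear[OF S(1)])
  interpret l: Vector_Spaces.linear scale "(*)" l by (rule l(1))
  have new: "const_poly {..<Suc k} (\<lambda>x. scale (\<Prod>i<Suc k. (\<phi>(k := \<psi>)) i (x i)) v)" for v
  proof -
    let ?F = "\<lambda>x. scale (\<Prod>i<k. \<phi> i (x i)) u"
    have ins: "insert k {..<k} = {..<Suc k}" by auto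
    have "const_poly {..<Suc k} (\<lambda>x. if z \<star> u \<noteq> 0 then x k \<star> ?F x else ?F x \<star> x k)"
      using const_poly_mul_var[OF IH(4)[of u], of k] unfolding ins by (cases "z \<star> u \<noteq> 0") simp_all
    moreover have "(\<lambda>x. if z \<star> u \<noteq> 0 then x k \<star> ?F x else ?F x \<star> x k) = (\<lambda>x. scale (\<Prod>i<k. \<phi> i (x i)) (m (x k)))"
      by (auto simp: m_def ml.scale mr.scale)
    ultimately have "const_poly {..<Suc k} (\<lambda>x. scale (\<Prod>i<k. \<phi> i (x i)) (m (x k)))" by simp
    from const_poly_mult_alg[OF spec[OF l(3), of v] const_poly_mult_alg[OF S(1) this]]
    have "const_poly {..<Suc k} (\<lambda>x. scale ((\<Prod>i<k. \<phi> i (x i)) * \<psi> (x k)) v)"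
      by (simp add: S.scale l.scale \<psi>_def)
    moreover have "(\<Prod>i<Suc k. (\<phi>(k := \<psi>)) i (x i)) = (\<Prod>i<k. \<phi> i (x i)) * \<psi> (x k)" for x
      by simp
    ultimately show ?thesis by simp
  qed
  show ?case
  proof (intro exI conjI allI impI)
    fix i assume i: "i < Suc k"
    show "Vector_Spaces.linear scale (*) ((\<phi>(k := \<psi>)) i)" using i IH(1) lin\<psi> by (auto simp: less_Suc_eq)
    show "(\<phi>(k := \<psi>)) i ((y(k := z)) i) \<noteq> 0" using i IH(2) \<psi>z by (auto simp: less_Suc_eq)
    show "(\<phi>(k := \<psi>)) j ((y(k := z)) i) = 0" if "j < i" for j
      using i that IH(3) z(2) by (auto simp: less_Suc_eq)
  qed (rule new)
qed

definition alternation :: "nat \<Rightarrow> ((nat \<Rightarrow> 'a) \<Rightarrow> 'a) \<Rightarrow> (nat \<Rightarrow> 'a) \<Rightarrow> 'a" where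
  "alternation d F x = (\<Sum>\<sigma> | \<sigma> permutes {..<d}. scale (of_int (sign \<sigma>)) (F (x \<circ> \<sigma>)))"

text \<open>
  Composition with the transposition of \<open>i\<close> and \<open>j\<close> permutes the summands and reverses their signs.
\<close>

lemma alternating_alternation: "alternating {..<d} (alternation d F)"
  unfolding alternating_def
proof (intro allI ballI impI)
  fix x :: "nat \<Rightarrow> 'a" and i j assume ij: "i \<in> {..<d}" "j \<in> {..<d}" "i \<noteq> j" "x i = x j"
  let ?t = "Transposition.transpose i j" and ?P = "{\<sigma>. \<sigma> permutes {..<d}}"
  have t: "?t permutes {..<d}" using ij by (intro permutes_swap_id)
  have xt: "x \<circ> ?t = x" using ij(4) by (auto simp: fun_eq_iff Transposition.transpose_def)
  have "alternation d F x = (\<Sum>\<sigma>\<in>?P. scale (of_int (sign (?t \<circ> \<sigma>))) (F (x \<circ> (?t \<circ> \<sigma>))))"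
    unfolding alternation_def
    by (rule sum.reindex_bij_witness[of _ "\<lambda>\<sigma>. ?t \<circ> \<sigma>" "\<lambda>\<sigma>. ?t \<circ> \<sigma>"])
      (auto simp: o_assoc intro: permutes_compose t)
  also have "\<dots> = (\<Sum>\<sigma>\<in>?P. - scale (of_int (sign \<sigma>)) (F (x \<circ> \<sigma>)))"
  proof (rule sum.cong)
    fix \<sigma> assume "\<sigma> \<in> ?P"
    then have "permutation \<sigma>" using permutation_permutes by blast
    then have "sign (?t \<circ> \<sigma>) = - sign \<sigma>" using ij(3) by (simp add: sign_compose permutation_swap_id sign_swap_id)
    then show "scale (of_int (sign (?t \<circ> \<sigma>))) (F (x \<circ> (?t \<circ> \<sigma>))) = - scale (of_int (sign \<sigma>)) (F (x \<circ> \<sigma>))"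
      by (simp add: o_assoc xt)
  qed simp
  also have "\<dots> = - alternation d F x" by (simp add: alternation_def sum_negf)
  finally have "scale 2 (alternation d F x) = 0"
    by (metis add.right_inverse one_add_one scale_left_distrib scale_one)
  then show "alternation d F x = 0" by simp
qed

lemma ml_poly_alternation:
  assumes F: "ml_poly S F" and S: "{..<d} \<subseteq> S"
  shows "ml_poly S (alternation d F)"
proof -
  have "ml_poly S (\<lambda>x. F (x \<circ> \<sigma>))" if "\<sigma> permutes {..<d}" for \<sigma>
  proof -
    have "\<sigma> permutes S" using permutes_subset[OF that S] .
    then show ?thesis using ml_poly_rename[OF F, of \<sigma>] by (simp add: permutes_image permutes_inj_on)
  qed
  then show ?thesis
    unfolding alternation_def by (intro ml_poly_sum ml_poly.scale) auto
qed

text \<open>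
  For the triangular system of functionals only the identity permutation contributes to the
  alternation of their product at \<open>y\<close>, so this alternation is not \<open>0\<close>. The product is a combination of
  monomials with constants, one of which must have a nonzero alternation as well.
\<close>

theorem exists_alternating:
  assumes simple: "\<And>I. G_ideal I \<Longrightarrow> I = {0} \<or> I = UNIV" and ne: "(UNIV :: 'a set) \<noteq> {0}"
    and nd: "radical = {0}"
  shows "\<exists>S F a. finite S \<and> {..<card Basis} \<subseteq> S \<and> ml_poly S F \<and> alternating {..<card Basis} F \<and> F a \<noteq> 0"
proof -
  let ?d = "card Basis"
  obtain v0 :: 'a where v0: "v0 \<noteq> 0" using ne by blast
  obtain \<phi> y where \<phi>: "\<And>i. i < ?d \<Longrightarrow> \<phi> i (y i) \<noteq> 0" "\<And>i j. i < ?d \<Longrightarrow> j < i \<Longrightarrow> \<phi> j (y i) = 0"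
    "const_poly {..<?d} (\<lambda>x. scale (\<Prod>i<?d. \<phi> i (x i)) v0)"
    using triangular_functionals[OF simple ne nd order_refl] by blast
  let ?F = "\<lambda>x. scale (\<Prod>i<?d. \<phi> i (x i)) v0"
  have "alternation ?d ?F y = (\<Sum>\<sigma>\<in>{id}. scale (of_int (sign \<sigma>)) (?F (y \<circ> \<sigma>)))"
    unfolding alternation_def
  proof (rule sum.mono_neutral_right)
    show "finite {\<sigma>. \<sigma> permutes {..<?d}}" by (simp add: finite_permutations)
    show "{id} \<subseteq> {\<sigma>. \<sigma> permutes {..<?d}}" by (simp add: permutes_id)
    show "\<forall>\<sigma>\<in>{\<sigma>. \<sigma> permutes {..<?d}} - {id}. scale (of_int (sign \<sigma>)) (?F (y \<circ> \<sigma>)) = 0"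
    proof
      fix \<sigma> assume \<sigma>: "\<sigma> \<in> {\<sigma>. \<sigma> permutes {..<?d}} - {id}"
      then obtain i where i: "i < ?d" "i < \<sigma> i"
        using permutes_natset_le[of \<sigma> "{..<?d}"] by (metis DiffD1 DiffD2 insertI1 lessThan_iff linorder_not_le mem_Collect_eq)
      have "\<sigma> i < ?d" using \<sigma> i(1) permutes_in_image[of \<sigma> "{..<?d}" i] by auto
      then have "\<phi> i (y (\<sigma> i)) = 0" using \<phi>(2) i(2) by blast
      then have "(\<Prod>i<?d. \<phi> i ((y \<circ> \<sigma>) i)) = 0" using i(1) by (intro prod_zero) auto
      then show "scale (of_int (sign \<sigma>)) (?F (y \<circ> \<sigma>)) = 0" by simp
    qed
  qed
  then have alt0: "alternation ?d ?F y \<noteq> 0" using \<phi>(1) v0 by (simp add: sign_id)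
  have "\<exists>p. const_monomial {..<?d} p \<and> alternation ?d p y \<noteq> 0"
  proof (rule ccontr)
    assume "\<not> ?thesis"
    then have no: "\<And>p. const_monomial {..<?d} p \<Longrightarrow> alternation ?d p y = 0" by blast
    have "alternation ?d F y = 0" if "const_poly {..<?d} F" for F
      using that
    proof induction
      case (lincomb p q c)
      have "alternation ?d (\<lambda>a. scale c (p a) + q a) y = scale c (alternation ?d p y) + alternation ?d q y"
        by (simp add: alternation_def scale_right_distrib sum.distrib scale_sum_right mult.commute)
      then show ?case using lincomb by simp
    qed (use no in \<open>auto simp: alternation_def\<close>)
    then show False using alt0 \<phi>(3) by blast
  qed
  then obtain p where p: "const_monomial {..<?d} p" "alternation ?d p y \<noteq> 0" by blast
  have "\<forall>i\<in>{..<?d}. i < ?d" by simp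
  with const_monomial_lift[OF p(1)] obtain E q a where q: "finite E" "\<forall>i\<in>E. ?d \<le> i"
    "ml_monomial ({..<?d} \<union> E) q" and qp: "\<forall>x. q (\<lambda>i. if i \<in> {..<?d} then x i else a i) = p x"
    by blast
  let ?b = "\<lambda>i. if i \<in> {..<?d} then y i else a i"
  have "alternation ?d q ?b = alternation ?d p y"
    unfolding alternation_def
  proof (rule sum.cong)
    fix \<sigma> assume "\<sigma> \<in> {\<sigma>. \<sigma> permutes {..<?d}}"
    then have \<sigma>: "\<sigma> permutes {..<?d}" by simp
    have "?b \<circ> \<sigma> = (\<lambda>i. if i \<in> {..<?d} then (y \<circ> \<sigma>) i else a i)"
    proof
      fix i
      show "(?b \<circ> \<sigma>) i = (if i \<in> {..<?d} then (y \<circ> \<sigma>) i else a i)"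
        using permutes_in_image[OF \<sigma>, of i] permutes_not_in[OF \<sigma>, of i] by auto
    qed
    then show "scale (of_int (sign \<sigma>)) (q (?b \<circ> \<sigma>)) = scale (of_int (sign \<sigma>)) (p (y \<circ> \<sigma>))"
      by (simp only: qp[rule_format])
  qed simp
  then have "alternation ?d q ?b \<noteq> 0" using p(2) by simp
  moreover have "ml_poly ({..<?d} \<union> E) (alternation ?d q)"
    by (rule ml_poly_alternation[OF ml_poly.mono[OF q(3)]]) simp
  ultimately show ?thesis using alternating_alternation q(1) by blast
qed

end

section \<open>Counting independent multilinear functions\<close>

subsection \<open>Words with prescribed letters at each time\<close>

text \<open>
  The pair \<open>(b, i)\<close> stands for the \<open>i\<close>-th argument of the block \<open>b\<close>.
\<close>

definition cells :: "nat \<Rightarrow> nat \<Rightarrow> (nat \<times> nat) set" where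
  "cells K d = {..<K} \<times> {..<d}"

text \<open>
  The blocks start in groups of \<open>s\<close>, and each block takes \<open>d\<close> consecutive times.
\<close>

definition cell_time :: "nat \<Rightarrow> nat \<times> nat \<Rightarrow> nat" where
  "cell_time s = (\<lambda>(b, i). b div s + i)"

text \<open>
  Only cells of equal time may exchange their letters of the standard word \<open>snd\<close>. This leaves
  about \<open>d\<close> choices per cell, and it keeps the letters of each time fixed as a multiset, which makes the functions
  for different words independent.
\<close>

definition shuffles_of_cells :: "nat \<Rightarrow> nat \<Rightarrow> nat \<Rightarrow> (nat \<times> nat \<Rightarrow> nat) set" where
  "shuffles_of_cells K s d = {w \<in> cells K d \<rightarrow>\<^sub>E {..<d}.
    \<exists>\<tau>. \<tau> permutes cells K d \<and> (\<forall>x\<in>cells K d. cell_time s (\<tau> x) = cell_time s x \<and> w (\<tau> x) = snd x)}"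

lemma finite_cells [simp]: "finite (cells K d)"
  by (simp add: cells_def)

text \<open>
  Induction on time. The letters below \<open>i\<close> have already been used by the earlier cells of the block \<open>b\<close>, so the
  cell \<open>(b, i)\<close> carries a letter that is at least \<open>i\<close>. As the letters of one time have a fixed sum, they must all
  be minimal.
\<close>

lemma block_bijective_shuffle:
  assumes w: "w \<in> shuffles_of_cells K s d" and \<tau>: "\<tau> permutes cells K d"
    and time: "\<And>x. x \<in> cells K d \<Longrightarrow> cell_time s (\<tau> x) = cell_time s x"
    and inj: "\<And>b. b < K \<Longrightarrow> inj_on (\<lambda>i. w (\<tau> (b, i))) {..<d}"
    and x: "x \<in> cells K d"
  shows "w (\<tau> x) = snd x"
proof -
  let ?X = "cells K d"
  obtain \<rho> where \<rho>: "\<rho> permutes ?X" "\<And>x. x \<in> ?X \<Longrightarrow> cell_time s (\<rho> x) = cell_time s x"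
    "\<And>x. x \<in> ?X \<Longrightarrow> w (\<rho> x) = snd x" using w by (auto simp: shuffles_of_cells_def)
  define XT where "XT T = {x \<in> ?X. cell_time s x = T}" for T
  have bij: "bij_betw \<pi> (XT T) (XT T)"
    if \<pi>: "\<pi> permutes ?X" "\<And>x. x \<in> ?X \<Longrightarrow> cell_time s (\<pi> x) = cell_time s x" for \<pi> T
  proof -
    have "inj_on \<pi> (XT T)" using permutes_inj[OF \<pi>(1)] by (metis inj_on_subset subset_UNIV)
    moreover have "\<pi> ` XT T \<subseteq> XT T" using \<pi> permutes_in_image[OF \<pi>(1)] by (auto simp: XT_def)
    moreover have "finite (XT T)" by (simp add: XT_def)
    ultimately show ?thesis by (simp add: bij_betw_def endo_inj_surj)
  qed
  have sum: "(\<Sum>x\<in>XT T. w (\<tau> x)) = (\<Sum>x\<in>XT T. snd x)" for T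
  proof -
    have "(\<Sum>x\<in>XT T. w (\<tau> x)) = (\<Sum>x\<in>XT T. w x)" by (rule sum.reindex_bij_betw[OF bij[OF \<tau> time]])
    also have "\<dots> = (\<Sum>x\<in>XT T. w (\<rho> x))" by (rule sum.reindex_bij_betw[OF bij[OF \<rho>(1,2)], symmetric])
    also have "\<dots> = (\<Sum>x\<in>XT T. snd x)" by (rule sum.cong) (auto simp: XT_def \<rho>(3))
    finally show ?thesis .
  qed
  have "\<forall>x\<in>XT T. w (\<tau> x) = snd x" for T
  proof (induction T rule: less_induct)
    case (less T)
    have ge: "snd x \<le> w (\<tau> x)" if x: "x \<in> XT T" for x
    proof (rule ccontr)
      assume lt: "\<not> snd x \<le> w (\<tau> x)"
      obtain b i where bi: "x = (b, i)" "b < K" "i < d" "b div s + i = T"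
        using x by (auto simp: XT_def cells_def cell_time_def)
      let ?j = "w (\<tau> x)"
      have j: "?j < i" using lt bi by simp
      then have mem: "(b, ?j) \<in> XT (b div s + ?j)" using bi by (auto simp: XT_def cells_def cell_time_def)
      have earlier: "b div s + ?j < T" using j bi(4) by linarith
      have e1: "w (\<tau> (b, ?j)) = ?j" by (rule trans[OF bspec[OF less.IH[OF earlier] mem] snd_conv])
      have e2: "?j = w (\<tau> (b, i))" by (simp only: bi(1))
      have "?j = i" by (rule inj_onD[OF inj[OF bi(2)] trans[OF e1 e2]]) (use j bi(3) in auto)
      then show False using j by linarith
    qed
    show ?case
    proof (rule ccontr)
      assume "\<not> ?case"
      then obtain x where x: "x \<in> XT T" "snd x < w (\<tau> x)" using ge by (metis le_neq_implies_less)
      have "(\<Sum>x\<in>XT T. snd x) < (\<Sum>x\<in>XT T. w (\<tau> x))"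
      proof (rule sum_strict_mono_ex1)
        show "finite (XT T)" by (simp add: XT_def)
        show "\<forall>x\<in>XT T. snd x \<le> w (\<tau> x)" using ge by blast
        show "\<exists>x\<in>XT T. snd x < w (\<tau> x)" using x by blast
      qed
      then show False using sum by simp
    qed
  qed
  moreover have "x \<in> XT (cell_time s x)" using x by (simp add: XT_def)
  ultimately show ?thesis by blast
qed

lemma fact_add_ge: "fact n * n ^ k \<le> (fact (n + k) :: nat)"
proof (induction k)
  case (Suc k)
  have "fact n * n ^ Suc k = (fact n * n ^ k) * n" by simp
  also have "\<dots> \<le> fact (n + k) * Suc (n + k)" by (rule mult_mono[OF Suc]) auto
  finally show ?case by (simp add: mult.commute)
qed simp

text \<open>
  A lower bound for the multinomial coefficient \<open>(s d)! / (s!)^d\<close>, by induction on \<open>s\<close>; multiplication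
  avoids the division.
\<close>

lemma balanced_multinomial_bound:
  assumes "1 \<le> s"
  shows "d ^ (s * d) * fact s ^ d \<le> (d * s) ^ d * (fact (s * d) :: nat)"
  using assms
proof (induction s rule: dec_induct)
  case base
  have "d ^ d * 1 \<le> d ^ d * (fact d :: nat)" by (intro mult_le_mono) auto
  then show ?case by simp
next
  case (step s)
  have "d ^ (Suc s * d) * fact (Suc s) ^ d = (d * Suc s) ^ d * (d ^ (s * d) * fact s ^ d)"
  proof -
    have "d ^ (Suc s * d) = d ^ d * d ^ (s * d)" by (simp add: power_add)
    moreover have "fact (Suc s) ^ d = Suc s ^ d * fact s ^ d"
      by (simp only: fact_Suc of_nat_id power_mult_distrib)
    moreover have "(d * Suc s) ^ d = d ^ d * Suc s ^ d" by (rule power_mult_distrib)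
    ultimately show ?thesis by (simp only: mult_ac)
  qed
  also have "\<dots> \<le> (d * Suc s) ^ d * ((d * s) ^ d * fact (s * d))" by (rule mult_le_mono2[OF step.IH])
  also have "\<dots> = (d * Suc s) ^ d * (fact (s * d) * (s * d) ^ d)" by (simp add: mult.commute)
  also have "\<dots> \<le> (d * Suc s) ^ d * fact (s * d + d)" by (rule mult_le_mono2[OF fact_add_ge])
  also have "s * d + d = Suc s * d" by simp
  finally show ?case .
qed

definition balanced_lists :: "nat \<Rightarrow> nat \<Rightarrow> nat list set" where
  "balanced_lists s d = permutations_of_multiset (\<Sum>i<d. replicate_mset s i)"

lemma count_balanced: "count (\<Sum>i<d. replicate_mset s i) (j :: nat) = (if j < d then s else 0)"
  by (induction d) (auto simp: less_Suc_eq)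

lemma card_balanced_lists:
  assumes "1 \<le> s"
  shows "d ^ (s * d) \<le> (d * s) ^ d * card (balanced_lists s d)"
proof -
  let ?M = "\<Sum>i<d. replicate_mset s i"
  have set: "set_mset ?M = {..<d}" using assms by (auto simp: set_mset_def count_balanced)
  have size: "size ?M = s * d" by (induction d) (auto simp: lessThan_Suc)
  have "card (balanced_lists s d) * fact s ^ d = fact (s * d)"
    using card_permutations_of_multiset_aux[of ?M]
    by (simp add: set size count_balanced balanced_lists_def mult.commute)
  then have "d ^ (s * d) * fact s ^ d \<le> (d * s) ^ d * card (balanced_lists s d) * fact s ^ d"
    using balanced_multinomial_bound[OF assms, of d] by (simp add: mult.assoc)
  then show ?thesis by simp
qed

text \<open>
  From the time \<open>d - 1\<close>, when the first blocks end, up to the time \<open>q - 1\<close>, when the last ones start,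
  every letter occurs exactly \<open>s\<close> times in the standard word, so any balanced arrangement may be chosen at each of these
  \<open>q + 1 - d\<close> times.
\<close>

lemma card_shuffles_of_cells:
  assumes s: "1 \<le> s" and d: "1 \<le> d" "d \<le> q"
  shows "card (balanced_lists s d) ^ (Suc q - d) \<le> card (shuffles_of_cells (q * s) s d)"
proof -
  let ?X = "cells (q * s) d" and ?Full = "{d - 1..<q}" and ?L = "balanced_lists s d"
  let ?M = "\<Sum>i<d. replicate_mset s i"
  define XT where "XT T = {x \<in> ?X. cell_time s x = T}" for T
  have letter: "{x \<in> ?X. cell_time s x = T \<and> snd x = i} = (\<lambda>j. ((T - i) * s + j, i)) ` {..<s}"
    if T: "T \<in> ?Full" and i: "i < d" for T i
  proof -
    have iT: "i \<le> T" "T - i < q" using T i by auto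
    have div: "((T - i) * s + j) div s = T - i" if "j < s" for j using that s by simp
    have less: "(T - i) * s + j < q * s" if "j < s" for j
    proof -
      have "(T - i) * s + j < Suc (T - i) * s" using that by simp
      also have "\<dots> \<le> q * s" using iT by (intro mult_le_mono1) auto
      finally show ?thesis .
    qed
    have 1: "x \<in> (\<lambda>j. ((T - i) * s + j, i)) ` {..<s}"
      if x: "x \<in> ?X" "cell_time s x = T" "snd x = i" for x
    proof -
      have "fst x div s = T - i" using x iT by (cases x) (auto simp: cell_time_def)
      then have "fst x = (T - i) * s + fst x mod s" by (metis div_mult_mod_eq)
      then have "x = ((T - i) * s + fst x mod s, i)" using x(3) by (simp add: prod_eq_iff)
      moreover have "fst x mod s < s" using s by simp
      ultimately show ?thesis by blast
    qed
    show ?thesis using 1 iT i div less by (auto simp: cells_def cell_time_def)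
  qed
  have card_letter: "card {x \<in> ?X. cell_time s x = T \<and> snd x = i} = s" if "T \<in> ?Full" "i < d" for T i
    unfolding letter[OF that] by (subst card_image) (auto simp: inj_on_def)
  have card_XT: "card (XT T) = s * d" if T: "T \<in> ?Full" for T
  proof -
    have "XT T = (\<Union>i<d. {x \<in> ?X. cell_time s x = T \<and> snd x = i})"
      by (auto simp: XT_def cells_def)
    then have "card (XT T) = (\<Sum>i<d. card {x \<in> ?X. cell_time s x = T \<and> snd x = i})"
      by (simp only:) (rule card_UN_disjoint, auto)
    then show ?thesis using card_letter[OF T] by simp
  qed
  have "\<exists>h. bij_betw h (XT T) {..<s * d}" if "T \<in> ?Full" for T
    using card_XT[OF that] by (intro finite_same_card_bij) (auto simp: XT_def)
  then obtain idx where idx: "\<And>T. T \<in> ?Full \<Longrightarrow> bij_betw (idx T) (XT T) {..<s * d}" by metis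
  \<comment> \<open>The lists \<open>h T\<close> prescribe the letters at the full times \<open>T\<close>; at the other times the standard letters stay.\<close>
  define word where "word h = (\<lambda>x\<in>?X. if cell_time s x \<in> ?Full
      then (h (cell_time s x) :: nat list) ! idx (cell_time s x) x else snd x)" for h
  have len: "length xs = s * d" and cnt: "count (mset xs) i = (if i < d then s else 0)"
    and letters: "set xs \<subseteq> {..<d}" if "xs \<in> ?L" for xs i
  proof -
    have m: "mset xs = ?M" using that by (simp add: balanced_lists_def permutations_of_multiset_def)
    have "size ?M = s * d" by (induction d) (auto simp: lessThan_Suc)
    then show "length xs = s * d" using m by (metis size_mset)
    show "count (mset xs) i = (if i < d then s else 0)" by (simp add: m count_balanced)
    have "set xs = set_mset ?M" by (simp flip: m)
    then show "set xs \<subseteq> {..<d}" using s by (auto simp: set_mset_def count_balanced split: if_splits)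
  qed
  have word: "word h \<in> shuffles_of_cells (q * s) s d" if h: "h \<in> ?Full \<rightarrow>\<^sub>E ?L" for h
  proof -
    have hT: "h T \<in> ?L" if "T \<in> ?Full" for T using h that by auto
    have idxless: "idx T x < s * d" if "T \<in> ?Full" "x \<in> XT T" for T x
      using idx[OF that(1)] that(2) by (auto simp: bij_betw_def)
    have range: "word h \<in> ?X \<rightarrow>\<^sub>E {..<d}"
    proof (rule PiE_I)
      fix x assume x: "x \<in> ?X"
      show "word h x \<in> {..<d}"
      proof (cases "cell_time s x \<in> ?Full")
        case True
        have "idx (cell_time s x) x < length (h (cell_time s x))"
          using idxless[OF True] x len[OF hT[OF True]] by (simp add: XT_def)
        then have "h (cell_time s x) ! idx (cell_time s x) x \<in> set (h (cell_time s x))" by (rule nth_mem)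
        then show ?thesis using letters[OF hT[OF True]] x True by (auto simp: word_def)
      next
        case False
        then show ?thesis using x by (auto simp: word_def cells_def)
      qed
    qed (auto simp: word_def)
    have fiber: "card {x \<in> ?X. (cell_time s x, word h x) = (T, i)} = card {x \<in> ?X. (cell_time s x, snd x) = (T, i)}" for T i
    proof (cases "T \<in> ?Full")
      case False
      have "{x \<in> ?X. (cell_time s x, word h x) = (T, i)} = {x \<in> ?X. (cell_time s x, snd x) = (T, i)}"
        using False by (auto simp: word_def)
      then show ?thesis by simp
    next
      case T: True
      have "card {x \<in> ?X. (cell_time s x, word h x) = (T, i)} = card {x \<in> XT T. h T ! idx T x = i}"
        using T by (intro arg_cong[where f = card]) (auto simp: word_def XT_def)
      also have "\<dots> = card {k. k < s * d \<and> h T ! k = i}"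
      proof (rule bij_betw_same_card[of "idx T"])
        show "bij_betw (idx T) {x \<in> XT T. h T ! idx T x = i} {k. k < s * d \<and> h T ! k = i}"
          using idx[OF T] by (auto simp: bij_betw_def inj_on_def image_iff)
      qed
      also have "\<dots> = count (mset (h T)) i"
        using len[OF hT[OF T]] by (simp add: count_mset count_list_eq_length_filter length_filter_conv_card conj_commute eq_commute)
      also have "\<dots> = (if i < d then s else 0)" by (rule cnt[OF hT[OF T]])
      also have "\<dots> = card {x \<in> ?X. (cell_time s x, snd x) = (T, i)}"
      proof (cases "i < d")
        case True
        then show ?thesis using card_letter[OF T True] by simp
      next
        case False
        then have "{x \<in> ?X. (cell_time s x, snd x) = (T, i)} = {}" by (auto simp: cells_def)
        then show ?thesis using False by (simp only: card.empty if_False)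
      qed
      finally show ?thesis .
    qed
    have "image_mset (\<lambda>x. (cell_time s x, snd x)) (mset_set ?X) = image_mset (\<lambda>x. (cell_time s x, word h x)) (mset_set ?X)"
    proof (rule multiset_eqI)
      fix z :: "nat \<times> nat"
      have c: "count (image_mset f (mset_set ?X)) z = card {x \<in> ?X. f x = z}" for f :: "nat \<times> nat \<Rightarrow> nat \<times> nat"
      proof -
        have "count (image_mset f (mset_set ?X)) z = (\<Sum>y\<in>f -` {z} \<inter> ?X. count (mset_set ?X) y)"
          by (simp add: count_image_mset)
        also have "\<dots> = (\<Sum>y\<in>f -` {z} \<inter> ?X. 1)" by (rule sum.cong) auto
        also have "f -` {z} \<inter> ?X = {x \<in> ?X. f x = z}" by auto
        finally show ?thesis by simp
      qed
      show "count (image_mset (\<lambda>x. (cell_time s x, snd x)) (mset_set ?X)) z =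
          count (image_mset (\<lambda>x. (cell_time s x, word h x)) (mset_set ?X)) z"
        unfolding c using fiber[of "fst z" "snd z"] by simp
    qed
    then obtain \<tau> where \<tau>: "\<tau> permutes ?X"
      "\<forall>x\<in>?X. (cell_time s x, snd x) = (cell_time s (\<tau> x), word h (\<tau> x))"
      by (rule image_mset_eq_implies_permutes[OF finite_cells])
    then show ?thesis using range by (auto simp: shuffles_of_cells_def intro!: exI[of _ \<tau>])
  qed
  have inj: "inj_on word (?Full \<rightarrow>\<^sub>E ?L)"
  proof (rule inj_onI)
    fix g h assume g: "g \<in> ?Full \<rightarrow>\<^sub>E ?L" and h: "h \<in> ?Full \<rightarrow>\<^sub>E ?L" and eq: "word g = word h"
    show "g = h"
    proof (rule PiE_ext[OF g h])
      fix T assume T: "T \<in> ?Full"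
      then have gT: "g T \<in> ?L" and hT: "h T \<in> ?L" using g h by auto
      show "g T = h T"
      proof (rule nth_equalityI)
        show "length (g T) = length (h T)" using len gT hT by simp
        fix k assume "k < length (g T)"
        then have "k < s * d" using len gT by simp
        then have "k \<in> idx T ` XT T" using idx[OF T] by (simp add: bij_betw_def)
        then obtain x where x: "x \<in> XT T" "idx T x = k" by blast
        then show "g T ! k = h T ! k"
          using fun_cong[OF eq, of x] T by (auto simp: word_def XT_def)
      qed
    qed
  qed
  have "card ?L ^ (Suc q - d) = card (?Full \<rightarrow>\<^sub>E ?L)" using d by (simp add: card_PiE)
  also have "\<dots> = card (word ` (?Full \<rightarrow>\<^sub>E ?L))" using inj by (simp add: card_image)
  also have "\<dots> \<le> card (shuffles_of_cells (q * s) s d)"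
  proof (rule card_mono)
    show "finite (shuffles_of_cells (q * s) s d)"
      by (rule finite_subset[of _ "?X \<rightarrow>\<^sub>E {..<d}"]) (auto simp: shuffles_of_cells_def intro!: finite_PiE)
  qed (use word in auto)
  finally show ?thesis .
qed

subsection \<open>Products of determinants\<close>

context alg_ops
begin

definition gram_det :: "nat \<Rightarrow> (nat \<Rightarrow> 'a) \<Rightarrow> (nat \<Rightarrow> 'a) \<Rightarrow> 'f" where
  "gram_det d u v = Determinant.det (mat d d (\<lambda>(i, j). trace_form (u i) (v j)))"

lemma gram_det_expand:
  "gram_det d u v = (\<Sum>p | p permutes {0..<d}. signof p * (\<Prod>i = 0..<d. trace_form (u i) (v (p i))))"
proof -
  have "gram_det d u v = (\<Sum>p | p permutes {0..<d}. signof p *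
      (\<Prod>i = 0..<d. mat d d (\<lambda>(i, j). trace_form (u i) (v j)) $$ (i, p i)))"
    unfolding gram_det_def by (rule det_def') simp
  also have "\<dots> = (\<Sum>p | p permutes {0..<d}. signof p * (\<Prod>i = 0..<d. trace_form (u i) (v (p i))))"
  proof (rule sum.cong)
    fix p assume "p \<in> {p. p permutes {0..<d}}"
    then have "p i < d" if "i < d" for i using that permutes_in_image[of p "{0..<d}" i] by simp
    then show "signof p * (\<Prod>i = 0..<d. mat d d (\<lambda>(i, j). trace_form (u i) (v j)) $$ (i, p i)) =
        signof p * (\<Prod>i = 0..<d. trace_form (u i) (v (p i)))"
      by (intro arg_cong2[where f = "(*)"] prod.cong) auto
  qed simp
  finally show ?thesis .
qed

text \<open>
  A vector in the kernel of the matrix would give an element orthogonal to a basis.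
\<close>

lemma gram_det_nonzero_iff:
  assumes nd: "radical = {0}" and e: "bij_betw e {..<d} Basis"
    and \<alpha>: "\<And>i. i < d \<Longrightarrow> \<alpha> i < d" and \<beta>: "\<And>i. i < d \<Longrightarrow> \<beta> i < d"
  shows "gram_det d (\<lambda>i. e (\<alpha> i)) (\<lambda>i. e (\<beta> i)) \<noteq> 0 \<longleftrightarrow> inj_on \<alpha> {..<d} \<and> inj_on \<beta> {..<d}"
proof -
  interpret f: Vector_Spaces.linear scale "(*)" "\<lambda>u. trace_form u v" for v by (rule trace_form_linear)
  let ?A = "mat d d (\<lambda>(i, j). trace_form (e (\<alpha> i)) (e (\<beta> j)))"
  have A: "?A \<in> carrier_mat d d" by simp
  have 1: "inj_on \<alpha> {..<d}" if "Determinant.det ?A \<noteq> 0"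
  proof (rule ccontr)
    assume "\<not> inj_on \<alpha> {..<d}"
    then obtain i j where ij: "i < d" "j < d" "i \<noteq> j" "\<alpha> i = \<alpha> j" by (auto simp: inj_on_def)
    have "row ?A i = row ?A j" using ij by (intro eq_vecI) auto
    then show False using det_identical_rows[OF A ij(3,1,2)] that by simp
  qed
  have 2: "inj_on \<beta> {..<d}" if "Determinant.det ?A \<noteq> 0"
  proof (rule ccontr)
    assume "\<not> inj_on \<beta> {..<d}"
    then obtain i j where ij: "i < d" "j < d" "i \<noteq> j" "\<beta> i = \<beta> j" by (auto simp: inj_on_def)
    have "col ?A i = col ?A j" using ij by (intro eq_vecI) auto
    then show False using det_identical_columns[OF A ij(3,1,2)] that by simp
  qed
  have 3: "Determinant.det ?A \<noteq> 0" if inj: "inj_on \<alpha> {..<d}" "inj_on \<beta> {..<d}"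
  proof
    assume "Determinant.det ?A = 0"
    then obtain v where v: "v \<in> carrier_vec d" "v \<noteq> 0\<^sub>v d" "?A *\<^sub>v v = 0\<^sub>v d"
      using det_0_iff_vec_prod_zero_field[OF A] by blast
    have bij\<alpha>: "bij_betw \<alpha> {..<d} {..<d}" and bij\<beta>: "bij_betw \<beta> {..<d} {..<d}"
    proof -
      have "\<alpha> ` {..<d} = {..<d}" by (rule endo_inj_surj) (use inj \<alpha> in auto)
      moreover have "\<beta> ` {..<d} = {..<d}" by (rule endo_inj_surj) (use inj \<beta> in auto)
      ultimately show "bij_betw \<alpha> {..<d} {..<d}" "bij_betw \<beta> {..<d} {..<d}"
        using inj by (simp_all add: bij_betw_def)
    qed
    have be\<alpha>: "bij_betw (\<lambda>i. e (\<alpha> i)) {..<d} Basis" and be\<beta>: "bij_betw (\<lambda>i. e (\<beta> i)) {..<d} Basis"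
      using bij_betw_trans[OF bij\<alpha> e] bij_betw_trans[OF bij\<beta> e] by (simp_all add: o_def)
    define y where "y = (\<Sum>j<d. scale (v $ j) (e (\<beta> j)))"
    have 0: "trace_form y (e (\<alpha> i)) = 0" if "i < d" for i
    proof -
      have "(?A *\<^sub>v v) $ i = (\<Sum>j<d. trace_form (e (\<alpha> i)) (e (\<beta> j)) * v $ j)"
        using that v(1) by (simp add: scalar_prod_def lessThan_atLeast0)
      then have "(\<Sum>j<d. trace_form (e (\<alpha> i)) (e (\<beta> j)) * v $ j) = 0" using v(3) that by simp
      then show ?thesis
        by (simp add: y_def f.sum f.scale trace_form_sym[of "e (\<alpha> i)"] mult.commute)
    qed
    have b0: "trace_form y b = 0" if b: "b \<in> Basis" for b
    proof -
      obtain i where "i < d" "b = e (\<alpha> i)" using be\<alpha> b by (auto simp: bij_betw_def)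
      then show ?thesis using 0 by simp
    qed
    have b0': "trace_form b y = 0" if "b \<in> Basis" for b using b0[OF that] by (metis trace_form_sym)
    have "trace_form y z = 0" for z
    proof -
      have "z \<in> span Basis" by (simp add: span_Basis)
      then have "trace_form z y = 0"
        by (induction rule: span_induct_alt) (auto simp: f.add f.scale b0')
      then show ?thesis by (simp add: trace_form_sym)
    qed
    then have y0: "y = 0" using nd by (auto simp: radical_def)
    define c where "c b = v $ (the_inv_into {..<d} (\<lambda>i. e (\<beta> i)) b)" for b
    have inv: "the_inv_into {..<d} (\<lambda>i. e (\<beta> i)) (e (\<beta> j)) = j" if "j < d" for j
      using be\<beta> that by (intro the_inv_into_f_f) (auto simp: bij_betw_def)
    have "(\<Sum>b\<in>Basis. scale (c b) b) = (\<Sum>j<d. scale (c (e (\<beta> j))) (e (\<beta> j)))"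
      by (rule sum.reindex_bij_betw[OF be\<beta>, symmetric])
    also have "\<dots> = y" unfolding y_def by (rule sum.cong) (auto simp: c_def inv)
    finally have "\<forall>b\<in>Basis. c b = 0" using y0 independent_Basis finite_Basis unfolding independent_explicit by auto
    then have "v $ j = 0" if "j < d" for j
      using inv[OF that] be\<beta> that by (auto simp: c_def bij_betw_def) (metis imageI lessThan_iff)
    then have "v = 0\<^sub>v d" using v(1) by (intro eq_vecI) auto
    then show False using v(2) by simp
  qed
  show ?thesis unfolding gram_det_def using 1 2 3 by blast
qed

text \<open>
  The first summand of the type of variables holds the variables of \<open>F\<close>, the second one the cells.
  The blocks are paired by Gram determinants.
\<close>

definition block_function :: "((nat \<Rightarrow> 'a) \<Rightarrow> 'a) \<Rightarrow> nat \<Rightarrow> (nat + nat \<times> nat \<Rightarrow> 'a) \<Rightarrow> 'a" where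
  "block_function F k a = scale (\<Prod>l<k. gram_det (card Basis) (\<lambda>i. a (Inr (2 * l, i))) (\<lambda>i. a (Inr (Suc (2 * l), i)))) (F (a \<circ> Inl))"

text \<open>
  Each summand of the determinant is a product of values of the trace form on pairs of new
  variables, and \<open>F\<close> provides the alternating variables that allow multiplying by them.
\<close>

lemma ml_poly_block_function:
  assumes F: "ml_poly S F" "alternating {..<card Basis} F" and S: "{..<card Basis} \<subseteq> S"
  shows "ml_poly (Inl ` S \<union> Inr ` cells (2 * k) (card Basis)) (block_function F k)"
proof (induction k)
  case 0
  have "ml_poly (Inl ` S) (\<lambda>a. F (a \<circ> Inl))" by (rule ml_poly_rename[OF F(1)]) simp
  then show ?case by (simp add: block_function_def cells_def)
next
  case (Suc k)
  let ?d = "card Basis" and ?G = "block_function F k"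
  let ?S = "Inl ` S \<union> Inr ` cells (2 * k) (card Basis) :: (nat + nat \<times> nat) set"
  let ?X = "Inl ` {..<?d} :: (nat + nat \<times> nat) set"
  have alt: "alternating ?X ?G"
    unfolding alternating_def
  proof (intro allI ballI impI)
    fix a :: "nat + nat \<times> nat \<Rightarrow> 'a" and i j assume ij: "i \<in> ?X" "j \<in> ?X" "i \<noteq> j" "a i = a j"
    then obtain i' j' where "i = Inl i'" "j = Inl j'" "i' < ?d" "j' < ?d" by auto
    then have "F (a \<circ> Inl) = 0" using F(2) ij unfolding alternating_def by auto
    then show "?G a = 0" by (simp add: block_function_def)
  qed
  have det_term: "ml_poly (Inl ` S \<union> Inr ` cells (2 * Suc k) ?d)
      (\<lambda>a. scale (\<Prod>i\<in>{0..<?d}. trace_form (a (Inr (2 * k, i))) (a (Inr (Suc (2 * k), p i)))) (?G a))"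
    if p: "p permutes {0..<?d}" for p
  proof -
    have "ml_poly (?S \<union> (\<lambda>i. Inr (2 * k, i)) ` {0..<?d} \<union> (\<lambda>i. Inr (Suc (2 * k), p i)) ` {0..<?d})
      (\<lambda>a. scale (\<Prod>i\<in>{0..<?d}. trace_form (a (Inr (2 * k, i))) (a (Inr (Suc (2 * k), p i)))) (?G a))"
    proof (rule trace_forms_times_alternating[OF Suc.IH alt])
      show "inj_on (\<lambda>i. Inr (Suc (2 * k), p i)) {0..<?d}"
        using permutes_inj[OF p] by (auto simp: inj_on_def)
      show "card ?X = ?d" by (simp add: card_image)
    qed (use S in \<open>auto simp: cells_def inj_on_def\<close>)
    moreover have "?S \<union> (\<lambda>i. Inr (2 * k, i)) ` {0..<?d} \<union> (\<lambda>i. Inr (Suc (2 * k), p i)) ` {0..<?d} =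
        Inl ` S \<union> Inr ` cells (2 * Suc k) ?d"
    proof -
      have 1: "(\<lambda>i. Inr (2 * k, i)) ` {0..<?d} = Inr ` ({2 * k} \<times> {0..<?d})" by auto
      have "(\<lambda>i. Inr (Suc (2 * k), p i)) ` {0..<?d} = Inr ` (\<lambda>i. (Suc (2 * k), i)) ` p ` {0..<?d}"
        by (simp only: image_image)
      also have "\<dots> = Inr ` ({Suc (2 * k)} \<times> {0..<?d})" by (simp only: permutes_image[OF p]) auto
      finally have 2: "(\<lambda>i. Inr (Suc (2 * k), p i)) ` {0..<?d} = Inr ` ({Suc (2 * k)} \<times> {0..<?d})" .
      have 3: "cells (2 * Suc k) ?d = cells (2 * k) ?d \<union> {2 * k} \<times> {0..<?d} \<union> {Suc (2 * k)} \<times> {0..<?d}"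
        by (auto simp: cells_def)
      show ?thesis unfolding 1 2 3 by (simp only: image_Un Un_assoc)
    qed
    ultimately show ?thesis by (simp only:)
  qed
  have eq: "block_function F (Suc k) = (\<lambda>a. \<Sum>p | p permutes {0..<?d}. scale (signof p)
      (scale (\<Prod>i\<in>{0..<?d}. trace_form (a (Inr (2 * k, i))) (a (Inr (Suc (2 * k), p i)))) (?G a)))"
  proof
    fix a
    have "block_function F (Suc k) a = scale (gram_det ?d (\<lambda>i. a (Inr (2 * k, i))) (\<lambda>i. a (Inr (Suc (2 * k), i)))) (?G a)"
      by (simp add: block_function_def mult.commute)
    then show "block_function F (Suc k) a = (\<Sum>p | p permutes {0..<?d}. scale (signof p)
      (scale (\<Prod>i\<in>{0..<?d}. trace_form (a (Inr (2 * k, i))) (a (Inr (Suc (2 * k), p i)))) (?G a)))"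
      unfolding gram_det_expand by (simp add: scale_sum_left)
  qed
  show ?case unfolding eq by (intro ml_poly_sum ml_poly.scale det_term) simp
qed

lemma block_function_nonzero_iff:
  assumes nd: "radical = {0}" and e: "bij_betw e {..<card Basis} Basis" and F: "F (a \<circ> Inl) \<noteq> 0"
    and a: "\<And>b i. b < 2 * k \<Longrightarrow> i < card Basis \<Longrightarrow> a (Inr (b, i)) = e (y (b, i))"
    and y: "\<And>b i. b < 2 * k \<Longrightarrow> i < card Basis \<Longrightarrow> y (b, i) < card Basis"
  shows "block_function F k a \<noteq> 0 \<longleftrightarrow> (\<forall>b<2 * k. inj_on (\<lambda>i. y (b, i)) {..<card Basis})"
proof -
  let ?d = "card Basis"
  have cong: "gram_det ?d u v = gram_det ?d u' v'" if "\<And>i. i < ?d \<Longrightarrow> u i = u' i" "\<And>i. i < ?d \<Longrightarrow> v i = v' i" for u v u' v'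
    unfolding gram_det_def by (intro arg_cong[where f = Determinant.det] eq_matI) (auto simp: that)
  have 1: "gram_det ?d (\<lambda>i. a (Inr (2 * l, i))) (\<lambda>i. a (Inr (Suc (2 * l), i))) \<noteq> 0 \<longleftrightarrow>
      inj_on (\<lambda>i. y (2 * l, i)) {..<?d} \<and> inj_on (\<lambda>i. y (Suc (2 * l), i)) {..<?d}" if l: "l < k" for l
  proof -
    have "gram_det ?d (\<lambda>i. a (Inr (2 * l, i))) (\<lambda>i. a (Inr (Suc (2 * l), i))) =
        gram_det ?d (\<lambda>i. e (y (2 * l, i))) (\<lambda>i. e (y (Suc (2 * l), i)))"
      by (rule cong) (use a l in auto)
    then show ?thesis using gram_det_nonzero_iff[OF nd e, of "\<lambda>i. y (2 * l, i)" "\<lambda>i. y (Suc (2 * l), i)"] y l by simp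
  qed
  have "block_function F k a \<noteq> 0 \<longleftrightarrow>
      (\<forall>l<k. inj_on (\<lambda>i. y (2 * l, i)) {..<?d} \<and> inj_on (\<lambda>i. y (Suc (2 * l), i)) {..<?d})"
    using F 1 by (auto simp: block_function_def prod_zero_iff)
  also have "\<dots> \<longleftrightarrow> (\<forall>b<2 * k. inj_on (\<lambda>i. y (b, i)) {..<?d})"
  proof safe
    fix b assume all: "\<forall>l<k. inj_on (\<lambda>i. y (2 * l, i)) {..<?d} \<and> inj_on (\<lambda>i. y (Suc (2 * l), i)) {..<?d}" and b: "b < 2 * k"
    show "inj_on (\<lambda>i. y (b, i)) {..<?d}"
    proof (cases "even b")
      case True
      then show ?thesis using all b by (auto elim!: evenE)
    next
      case False
      then obtain l where "b = Suc (2 * l)" by (auto elim!: oddE)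
      then show ?thesis using all b by auto
    qed
  qed auto
  finally show ?thesis .
qed

text \<open>
  The function for the word \<open>w\<close> is the block function with the cells renamed by the permutation that
  turns \<open>w\<close> into the standard word. At the word \<open>w'\<close> it is nonzero only if the renamed
  word uses every letter once in each block, which forces \<open>w' = w\<close>.
\<close>

theorem ml_dim_ge_shuffles:
  assumes nd: "radical = {0}" and S: "finite S" "{..<card Basis} \<subseteq> S"
    and F: "ml_poly S F" "alternating {..<card Basis} F" "F a0 \<noteq> 0"
  shows "card (shuffles_of_cells (2 * k) s (card Basis)) \<le> ml_dim (card S + 2 * k * card Basis)"
proof -
  let ?d = "card Basis" and ?X = "cells (2 * k) (card Basis)"
  let ?W = "shuffles_of_cells (2 * k) s ?d"
  let ?S = "Inl ` S \<union> Inr ` ?X :: (nat + nat \<times> nat) set"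
  obtain e where e: "bij_betw e {..<?d} Basis"
    using ex_bij_betw_nat_finite[OF finite_Basis] by (auto simp: lessThan_atLeast0)
  have "\<forall>w\<in>?W. \<exists>\<tau>. \<tau> permutes ?X \<and> (\<forall>x\<in>?X. cell_time s (\<tau> x) = cell_time s x \<and> w (\<tau> x) = snd x)"
    by (auto simp: shuffles_of_cells_def)
  from bchoice[OF this] obtain t where
    tt: "\<forall>w\<in>?W. t w permutes ?X \<and> (\<forall>x\<in>?X. cell_time s (t w x) = cell_time s x \<and> w (t w x) = snd x)" ..
  have t: "\<And>w. w \<in> ?W \<Longrightarrow> t w permutes ?X"
    "\<And>w x. w \<in> ?W \<Longrightarrow> x \<in> ?X \<Longrightarrow> cell_time s (t w x) = cell_time s x"
    "\<And>w x. w \<in> ?W \<Longrightarrow> x \<in> ?X \<Longrightarrow> w (t w x) = snd x"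
    using tt by blast+
  define f where "f w = (\<lambda>a. block_function F k (a \<circ> map_sum id (t w)))" for w
  define pt where "pt w = case_sum a0 (\<lambda>x. e (w x))" for w :: "nat \<times> nat \<Rightarrow> nat"
  have inX: "t w x \<in> ?X" if "w \<in> ?W" "x \<in> ?X" for w x
    using permutes_in_image[OF t(1)[OF that(1)]] that(2) by simp
  show ?thesis
  proof (rule ml_dim_ge)
    show "finite ?W"
      by (rule finite_subset[of _ "?X \<rightarrow>\<^sub>E {..<?d}"]) (auto simp: shuffles_of_cells_def intro!: finite_PiE)
    show "finite ?S" using S by simp
    have "card ?S = card (Inl ` S :: (nat + nat \<times> nat) set) + card (Inr ` ?X :: (nat + nat \<times> nat) set)"
      by (rule card_Un_disjoint) (use S in auto)
    then show "card ?S = card S + 2 * k * ?d" by (simp add: card_image cells_def)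
    fix w assume w: "w \<in> ?W"
    have inj: "inj_on (map_sum id (t w)) ?S"
      using permutes_inj[OF t(1)[OF w]] by (auto simp: inj_on_def inj_def)
    have "map_sum id (t w) ` ?S = Inl ` S \<union> Inr ` (t w ` ?X)" by (auto simp: image_Un image_image)
    also have "\<dots> = ?S" using permutes_image[OF t(1)[OF w]] by simp
    finally show "ml_poly ?S (f w)"
      using ml_poly_rename[OF ml_poly_block_function[OF F(1,2) S(2), of k] inj] by (simp add: f_def)
    fix w' assume w': "w' \<in> ?W"
    have range: "w' x < ?d" if "x \<in> ?X" for x using w' that by (auto simp: shuffles_of_cells_def)
    let ?y = "\<lambda>x. w' (t w x)"
    have iff: "f w (pt w') \<noteq> 0 \<longleftrightarrow> (\<forall>b<2 * k. inj_on (\<lambda>i. ?y (b, i)) {..<?d})"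
      unfolding f_def
    proof (rule block_function_nonzero_iff[OF nd e])
      have "pt w' \<circ> map_sum id (t w) \<circ> Inl = a0" by (auto simp: pt_def fun_eq_iff)
      then show "F (pt w' \<circ> map_sum id (t w) \<circ> Inl) \<noteq> 0" using F(3) by simp
      fix b i assume "b < 2 * k" "i < ?d"
      then have "(b, i) \<in> ?X" by (simp add: cells_def)
      then show "w' (t w (b, i)) < ?d" using range inX[OF w] by blast
    qed (simp add: pt_def)
    show "f w (pt w') \<noteq> 0 \<longleftrightarrow> w = w'"
    proof
      assume "f w (pt w') \<noteq> 0"
      then have eq: "w' (t w x) = snd x" if "x \<in> ?X" for x
        using block_bijective_shuffle[OF w' t(1)[OF w] t(2)[OF w] _ that] iff by blast
      show "w = w'"
      proof
        fix x
        show "w x = w' x"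
        proof (cases "x \<in> ?X")
          case True
          then obtain x' where x': "x' \<in> ?X" "x = t w x'" using permutes_image[OF t(1)[OF w]] by blast
          then show ?thesis using eq t(3)[OF w] by simp
        next
          case False
          have "w \<in> ?X \<rightarrow>\<^sub>E {..<?d}" "w' \<in> ?X \<rightarrow>\<^sub>E {..<?d}"
            using w w' unfolding shuffles_of_cells_def by blast+
          from this[THEN PiE_arb, OF False] show ?thesis by (rule trans[OF _ sym])
        qed
      qed
    next
      assume "w = w'"
      then have "?y (b, i) = i" if "b < 2 * k" "i < ?d" for b i
        using t(3)[OF w, of "(b, i)"] that by (simp add: cells_def)
      then have "\<forall>b<2 * k. inj_on (\<lambda>i. ?y (b, i)) {..<?d}" by (auto simp: inj_on_def)
      then show "f w (pt w') \<noteq> 0" using iff by blast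
    qed
  qed
qed

end

section \<open>Growth of the dimensions\<close>

context alg_ops
begin

lemma card_Basis_pos:
  assumes ne: "(UNIV :: 'a set) \<noteq> {0}"
  shows "1 \<le> card Basis"
proof -
  have "dim (UNIV :: 'a set) \<noteq> 0" using ne by (simp add: dim_eq_0 del: dim_UNIV) (use ne in auto)
  then show ?thesis by simp
qed

text \<open>
  The products span a \<open>G\<close>-invariant ideal.
\<close>

lemma simple_products_span:
  assumes simple
  shows "span {x \<star> y | x y. True} = UNIV"
proof -
  let ?P = "{x \<star> y | x y. True}"
  have in1: "x \<star> y \<in> span ?P" for x y by (blast intro: span_base)
  have "G_ideal (span ?P)"
  proof (rule G_idealI)
    fix g x assume g: "g \<in> Ops" and "x \<in> span ?P"
    interpret g: Vector_Spaces.linear scale scale g by (rule op_linear[OF g])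
    from \<open>x \<in> span ?P\<close> show "g x \<in> span ?P"
    proof (induction rule: span_induct_alt)
      case (step c x y)
      then obtain u v where uv: "x = u \<star> v" by blast
      from op_mul[OF g] have "g x = g u \<star> g v \<or> g x = g v \<star> g u" unfolding uv by blast
      then have "g x \<in> span ?P" using in1 by (elim disjE) simp_all
      then show ?case using step by (simp add: g.add g.scale span_add span_scale)
    qed (simp add: g.zero span_zero)
  qed (use in1 in auto)
  then show ?thesis using assms by (auto simp: simple_def)
qed

lemma simple_nondegenerate:
  assumes simple
  shows "radical = {0}"
proof (rule ccontr)
  assume "radical \<noteq> {0}"
  then obtain J where J: "G_ideal J" "J \<noteq> {0}" "\<And>x y. x \<in> J \<Longrightarrow> y \<in> J \<Longrightarrow> x \<star> y = 0"
    using abelian_ideal_or_nondegenerate by blast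
  then have "J = UNIV" using assms by (auto simp: simple_def)
  then have "{x \<star> y | x y. True} \<subseteq> {0}" using J(3) by auto
  then have "span {x \<star> y | x y. True} \<subseteq> {0}" by (metis span_empty span_insert_0 span_mono)
  then show False using assms span_zero by (auto simp: simple_def)
qed

text \<open>
  For given \<open>q\<close>, let \<open>s\<close> be as large as possible such that the variables of \<open>F\<close> and \<open>q s\<close> blocks fit into \<open>n\<close>
  variables. The number \<open>q\<close> is even because the blocks come in pairs.
\<close>

lemma ml_dim_simple_lower:
  assumes simple and ne: "(UNIV :: 'a set) \<noteq> {0}"
  shows "\<exists>c. \<forall>q n. even q \<longrightarrow> card Basis \<le> q \<longrightarrow> c + q * card Basis \<le> n \<longrightarrow>
    0 < ml_dim n \<and>
    real (Suc q - card Basis) * (((real n - real c) / real q - real (card Basis)) * ln (real (card Basis)) -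
      real (card Basis) * ln (real n)) \<le> ln (real (ml_dim n))"
proof -
  let ?d = "card Basis"
  have d: "1 \<le> ?d" by (rule card_Basis_pos[OF ne])
  obtain S F a where SF: "finite S" "{..<?d} \<subseteq> S" "ml_poly S F" "alternating {..<?d} F" "F a \<noteq> 0"
    using exists_alternating[OF _ ne simple_nondegenerate[OF assms(1)]] assms(1) by (auto simp: simple_def)
  let ?c = "card S"
  have "0 < ml_dim n \<and>
    real (Suc q - ?d) * (((real n - real ?c) / real q - real ?d) * ln (real ?d) - real ?d * ln (real n)) \<le> ln (real (ml_dim n))"
    if q: "even q" "?d \<le> q" and n: "?c + q * ?d \<le> n" for q n
  proof -
    define s where "s = (n - ?c) div (q * ?d)"
    have qd: "0 < q * ?d" using q d by simp
    have s1: "1 \<le> s"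
    proof -
      have "q * ?d div (q * ?d) \<le> s" unfolding s_def by (rule div_le_mono) (use n in auto)
      then show ?thesis using qd by simp
    qed
    have sle: "s * (q * ?d) \<le> n - ?c" unfolding s_def by (rule div_times_less_eq_dividend)
    have slt: "n - ?c < Suc s * (q * ?d)" unfolding s_def by (rule dividend_less_div_times[OF qd, THEN order_less_le_trans]) simp
    obtain k where k: "q * s = 2 * k" using q(1) by (metis dvd_mult2 evenE)
    let ?N = "card (balanced_lists s ?d)" and ?m = "Suc q - ?d"
    have "?N ^ ?m \<le> card (shuffles_of_cells (2 * k) s ?d)"
      using card_shuffles_of_cells[OF s1 d q(2)] by (simp add: k)
    also have "\<dots> \<le> ml_dim (?c + 2 * k * ?d)"
      by (rule ml_dim_ge_shuffles[OF simple_nondegenerate[OF assms(1)] SF])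
    also have "\<dots> \<le> ml_dim n"
    proof (rule ml_dim_mono[OF simple_products_span[OF assms(1)]])
      have "2 * k * ?d = s * (q * ?d)" by (simp flip: k)
      then have "?c + 2 * k * ?d = ?c + s * (q * ?d)" by (simp only:)
      also have "\<dots> \<le> n" using sle n by arith
      finally show "?c + 2 * k * ?d \<le> n" .
      have "card {..<?d} \<le> card S" by (rule card_mono[OF SF(1,2)])
      then show "1 \<le> ?c + 2 * k * ?d" using d by simp
    qed
    finally have le: "?N ^ ?m \<le> ml_dim n" .
    have bal: "?d ^ (s * ?d) \<le> (?d * s) ^ ?d * ?N" by (rule card_balanced_lists[OF s1])
    have Npos: "0 < ?N"
    proof (rule ccontr)
      assume "\<not> 0 < ?N"
      then have "?N = 0" by simp
      then have "?d ^ (s * ?d) \<le> 0" using bal by (simp only: mult_0_right)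
      then show False using d by simp
    qed
    have mlpos: "0 < ml_dim n" using le Npos by (metis less_le_trans zero_less_power)
    have dpos: "0 < real ?d" and spos: "0 < real s" using d s1 by auto
    have ds_n: "?d * s \<le> n"
    proof -
      have "?d * s \<le> s * (q * ?d)" using q d by (simp add: mult.commute mult.left_commute)
      also note sle
      also have "n - ?c \<le> n" by simp
      finally show ?thesis .
    qed
    have npos: "0 < real n" using ds_n s1 d by (metis mult_is_0 not_one_le_zero of_nat_0_less_iff le_0_eq neq0_conv)
    have "real ?d ^ (s * ?d) \<le> (real ?d * real s) ^ ?d * real ?N"
      using bal by (metis of_nat_le_iff of_nat_mult of_nat_power)
    then have "ln (real ?d ^ (s * ?d)) \<le> ln ((real ?d * real s) ^ ?d * real ?N)"
      using dpos spos Npos by (subst ln_le_cancel_iff) auto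
    also have "\<dots> = real ?d * ln (real ?d * real s) + ln (real ?N)"
      using dpos spos Npos by (simp add: ln_mult ln_realpow)
    also have "ln (real ?d * real s) \<le> ln (real n)"
    proof -
      have "real ?d * real s \<le> real n" using ds_n by (metis of_nat_le_iff of_nat_mult)
      then show ?thesis using dpos spos npos by (subst ln_le_cancel_iff) auto
    qed
    finally have 1: "real s * real ?d * ln (real ?d) - real ?d * ln (real n) \<le> ln (real ?N)"
      using dpos by (simp add: ln_realpow)
    have "real n - real ?c \<le> real (Suc s) * (real q * real ?d)"
      using slt n by (metis less_imp_le of_nat_diff of_nat_le_iff of_nat_mult add_leD1)
    then have 2: "(real n - real ?c) / real q - real ?d \<le> real s * real ?d"
      using q d by (simp add: field_simps)
    have "((real n - real ?c) / real q - real ?d) * ln (real ?d) \<le> real s * real ?d * ln (real ?d)"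
      by (rule mult_right_mono[OF 2]) (use d in simp)
    then have 3: "((real n - real ?c) / real q - real ?d) * ln (real ?d) - real ?d * ln (real n) \<le> ln (real ?N)"
      using 1 by linarith
    have "real ?m * (((real n - real ?c) / real q - real ?d) * ln (real ?d) - real ?d * ln (real n)) \<le> real ?m * ln (real ?N)"
      by (rule mult_left_mono[OF 3]) simp
    also have "\<dots> = ln (real (?N ^ ?m))" using Npos by (simp add: ln_realpow)
    also have "\<dots> \<le> ln (real (ml_dim n))"
      using le Npos mlpos by (subst ln_le_cancel_iff) auto
    finally show ?thesis using mlpos by blast
  qed
  then show ?thesis by blast
qed

text \<open>
  For fixed \<open>q\<close> the lower bound tends to \<open>(q + 1 - d) / q\<close> times \<open>ln d\<close>, and this is close to \<open>ln d\<close> for large \<open>q\<close>.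
\<close>

lemma ml_dim_simple_ln:
  assumes simple and ne: "(UNIV :: 'a set) \<noteq> {0}"
  shows "(\<lambda>n. ln (real (ml_dim n)) / real n) \<longlonglongrightarrow> ln (real (card Basis))"
    and "\<forall>\<^sub>F n in sequentially. 0 < ml_dim n"
proof -
  let ?d = "card Basis"
  obtain c where c: "\<And>q n. even q \<Longrightarrow> ?d \<le> q \<Longrightarrow> c + q * ?d \<le> n \<Longrightarrow> 0 < ml_dim n"
    "\<And>q n. even q \<Longrightarrow> ?d \<le> q \<Longrightarrow> c + q * ?d \<le> n \<Longrightarrow>
      real (Suc q - ?d) * (((real n - real c) / real q - real ?d) * ln (real ?d) - real ?d * ln (real n))
      \<le> ln (real (ml_dim n))"
    using ml_dim_simple_lower[OF assms] by blast
  show pos: "\<forall>\<^sub>F n in sequentially. 0 < ml_dim n"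
    using c(1)[of "2 * ?d"] by (auto simp: eventually_sequentially)
  have d: "1 \<le> ?d"
  proof -
    obtain n where "0 < ml_dim n" using pos by (auto simp: eventually_sequentially)
    then have "0 < ?d ^ n * ?d" using ml_dim_upper[of n] by linarith
    then show ?thesis by (cases "?d = 0") auto
  qed
  show "(\<lambda>n. ln (real (ml_dim n)) / real n) \<longlonglongrightarrow> ln (real ?d)"
  proof (rule order_tendstoI)
    fix a assume a: "ln (real ?d) < a"
    have "(\<lambda>n. ln (real ?d) + ln (real ?d) * (1 / real n)) \<longlonglongrightarrow> ln (real ?d) + ln (real ?d) * 0"
      by (intro tendsto_intros lim_1_over_n)
    then have "\<forall>\<^sub>F n in sequentially. ln (real ?d) + ln (real ?d) * (1 / real n) < a"
      using a by (auto dest: order_tendstoD(2))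
    then show "\<forall>\<^sub>F n in sequentially. ln (real (ml_dim n)) / real n < a"
      using pos eventually_gt_at_top[of 0]
    proof eventually_elim
      case (elim n)
      have "real (ml_dim n) \<le> real ?d ^ Suc n"
        using ml_dim_upper[of n] by (metis of_nat_le_iff of_nat_power power_Suc2)
      then have "ln (real (ml_dim n)) \<le> ln (real ?d ^ Suc n)"
        using elim d by (subst ln_le_cancel_iff) auto
      also have "\<dots> = (real n + 1) * ln (real ?d)" using d by (simp add: ln_realpow del: power_Suc)
      finally have "ln (real (ml_dim n)) / real n \<le> (real n + 1) * ln (real ?d) / real n"
        by (rule divide_right_mono) simp
      also have "\<dots> = ln (real ?d) + ln (real ?d) * (1 / real n)" using elim by (simp add: field_simps)
      finally show ?case using elim by linarith
    qed
  next
    fix a assume a: "a < ln (real ?d)"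
    let ?e = "ln (real ?d) - a"
    obtain N :: nat where N: "(real ?d - 1) * ln (real ?d) / ?e < real N" using reals_Archimedean2 by blast
    \<comment> \<open>\<open>N\<close> makes the relative loss \<open>(d - 1) / q\<close> small enough; the factor \<open>2\<close> makes \<open>q\<close> even.\<close>
    define q where "q = 2 * (?d + N)"
    have q: "even q" "?d \<le> q" "N \<le> q" "0 < q" using d by (auto simp: q_def)
    let ?m = "real (Suc q - ?d)"
    have m: "?m = real q - (real ?d - 1)" using q by (simp add: of_nat_diff)
    have "(real ?d - 1) * ln (real ?d) / ?e < real q" using N q(3) by linarith
    then have "(real ?d - 1) * ln (real ?d) / real q < ?e" using a q(4) by (simp add: field_simps)
    then have lim_gt: "a < ?m / real q * ln (real ?d)"
      using q(4) by (simp add: m field_simps)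
    have "(\<lambda>n. ?m * (((1 - real c * (1 / real n)) / real q - real ?d * (1 / real n)) * ln (real ?d) - real ?d * (ln (real n) / real n)))
        \<longlonglongrightarrow> ?m * (((1 - real c * 0) / real q - real ?d * 0) * ln (real ?d) - real ?d * 0)"
      by (intro tendsto_intros lim_1_over_n
          filterlim_compose[OF ln_x_over_x_tendsto_0 filterlim_real_sequentially]) (use q in auto)
    then have "\<forall>\<^sub>F n in sequentially.
        a < ?m * (((1 - real c * (1 / real n)) / real q - real ?d * (1 / real n)) * ln (real ?d) - real ?d * (ln (real n) / real n))"
      using lim_gt by (intro order_tendstoD(1)) auto
    then show "\<forall>\<^sub>F n in sequentially. a < ln (real (ml_dim n)) / real n"
      using eventually_ge_at_top[of "c + q * ?d"] eventually_gt_at_top[of 0]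
    proof eventually_elim
      case (elim n)
      have "?m * (((1 - real c * (1 / real n)) / real q - real ?d * (1 / real n)) * ln (real ?d) - real ?d * (ln (real n) / real n)) =
          ?m * (((real n - real c) / real q - real ?d) * ln (real ?d) - real ?d * ln (real n)) / real n"
        using elim(3) q(4) by (simp add: field_simps)
      also have "\<dots> \<le> ln (real (ml_dim n)) / real n"
        by (rule divide_right_mono[OF c(2)[OF q(1,2) elim(2)]]) simp
      finally show ?case using elim(1) by linarith
    qed
  qed
qed

theorem ml_dim_growth:
  assumes ne: "(UNIV :: 'a set) \<noteq> {0}"
  shows "(\<lambda>n. root n (real (ml_dim n))) \<longlonglongrightarrow> real (dim (UNIV :: 'a set)) \<longleftrightarrow> simple"
proof
  let ?d = "card Basis"
  have d: "1 \<le> ?d" by (rule card_Basis_pos[OF ne])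
  assume s: simple
  have "(\<lambda>n. exp (ln (real (ml_dim n)) / real n)) \<longlonglongrightarrow> exp (ln (real ?d))"
    by (intro tendsto_intros ml_dim_simple_ln(1)[OF s ne])
  moreover have "\<forall>\<^sub>F n in sequentially. exp (ln (real (ml_dim n)) / real n) = root n (real (ml_dim n))"
    using ml_dim_simple_ln(2)[OF s ne] eventually_gt_at_top[of 0]
  proof eventually_elim
    case (elim n)
    then have "root n (real (ml_dim n)) = real (ml_dim n) powr (1 / real n)" by (simp add: root_powr_inverse)
    then show ?case using elim by (simp add: powr_def)
  qed
  ultimately have "(\<lambda>n. root n (real (ml_dim n))) \<longlonglongrightarrow> exp (ln (real ?d))"
    by (rule Lim_transform_eventually)
  then show "(\<lambda>n. root n (real (ml_dim n))) \<longlonglongrightarrow> real (dim (UNIV :: 'a set))" using d by simp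
next
  let ?d = "card Basis" and ?r = "real (card Basis) - 1 / 2"
  have d: "1 \<le> ?d" by (rule card_Basis_pos[OF ne])
  assume lim: "(\<lambda>n. root n (real (ml_dim n))) \<longlonglongrightarrow> real (dim (UNIV :: 'a set))"
  show simple
  proof (rule ccontr)
    assume ns: "\<not> simple"
    have "(\<lambda>n. root n (2 * real ?d) * ?r) \<longlonglongrightarrow> 1 * ?r"
      by (intro tendsto_intros LIMSEQ_root_const) (use d in auto)
    moreover have "root n (real (ml_dim n)) \<le> root n (2 * real ?d) * ?r" if n: "1 \<le> n" for n
    proof -
      have "root n (real (ml_dim n)) \<le> root n (2 * real ?d * ?r ^ n)"
        using ml_dim_not_simple[OF ns ne n] n by (intro real_root_le_mono) auto
      also have "\<dots> = root n (2 * real ?d) * ?r"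
        using n d by (simp add: real_root_mult real_root_power_cancel)
      finally show ?thesis .
    qed
    ultimately have "real (dim (UNIV :: 'a set)) \<le> 1 * ?r"
      using lim by (intro LIMSEQ_le[of "\<lambda>n. root n (real (ml_dim n))" _ "\<lambda>n. root n (2 * real ?d) * ?r"]) auto
    then show False by simp
  qed
qed

end

section \<open>Codimensions are dimensions of spaces of multilinear functions\<close>

text \<open>
  Preimages of a basis of the image represent a basis of the quotient by the kernel.
\<close>

lemma quotient_dim_kernel:
  assumes v1: "vector_space s1" and v2: "vector_space s2" and lin: "Vector_Spaces.linear s1 s2 ev"
    and I: "\<And>f. f \<in> module.span s1 S \<Longrightarrow> f \<in> I \<longleftrightarrow> ev f = 0"
  shows "quotient_dim s1 (module.span s1 S) (module.span s1 S \<inter> I) = vector_space.dim s2 (module.span s2 (ev ` S))"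
proof -
  interpret a: vector_space s1 by (rule v1)
  interpret b: vector_space s2 by (rule v2)
  interpret ev: Vector_Spaces.linear s1 s2 ev by (rule lin)
  let ?V = "a.span S" and ?W = "a.span S \<inter> I"
  have W: "?W = {f \<in> ?V. ev f = 0}" using I by blast
  have im: "b.span (ev ` S) = ev ` ?V" by (rule ev.span_image)
  obtain C where C: "C \<subseteq> ev ` ?V" "b.independent C" "ev ` ?V \<subseteq> b.span C" "card C = b.dim (ev ` ?V)"
    using b.basis_exists[of "ev ` ?V"] by blast
  have "\<forall>c\<in>C. \<exists>f. f \<in> ?V \<and> ev f = c" using C(1) by blast
  from bchoice[OF this] obtain r where "\<forall>c\<in>C. r c \<in> ?V \<and> ev (r c) = c" ..
  then have r: "\<And>c. c \<in> C \<Longrightarrow> r c \<in> ?V" "\<And>c. c \<in> C \<Longrightarrow> ev (r c) = c" by blast+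
  let ?B = "r ` C"
  have evB: "ev ` ?B = C" using r(2) by (force simp: image_image)
  have "quotient_basis s1 ?V ?W ?B"
    unfolding quotient_basis_def
  proof (intro conjI allI impI)
    show BV: "?B \<subseteq> ?V" using r(1) by blast
    show "?V \<subseteq> a.span (?B \<union> ?W)"
    proof
      fix f assume f: "f \<in> ?V"
      then have "ev f \<in> b.span (ev ` ?B)" using C(3) evB by auto
      then obtain g where g: "g \<in> a.span ?B" "ev f = ev g" unfolding ev.span_image by blast
      have gV: "g \<in> ?V" using a.span_minimal[OF BV a.subspace_span] g(1) by blast
      have "f - g \<in> ?W" unfolding W using f g gV by (simp add: a.span_diff ev.diff)
      then have "g + (f - g) \<in> a.span (?B \<union> ?W)"
        using g(1) a.span_mono[of ?B "?B \<union> ?W"] by (intro a.span_add) (auto intro: a.span_base)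
      then show "f \<in> a.span (?B \<union> ?W)" by simp
    qed
    fix T u assume T: "finite T" "T \<subseteq> ?B" "(\<Sum>b\<in>T. s1 (u b) b) \<in> ?W"
    then obtain T' where T': "T' \<subseteq> C" "finite T'" "T = r ` T'" by (meson finite_subset_image)
    have inj: "inj_on r T'" using r(2) T'(1) by (metis inj_onI subsetD)
    have "0 = ev (\<Sum>b\<in>T. s1 (u b) b)" using T(3) W by auto
    also have "\<dots> = (\<Sum>b\<in>T. s2 (u b) (ev b))" by (simp add: ev.sum ev.scale)
    also have "\<dots> = (\<Sum>c\<in>T'. s2 (u (r c)) (ev (r c)))" unfolding T'(3) by (simp add: sum.reindex[OF inj])
    also have "\<dots> = (\<Sum>c\<in>T'. s2 (u (r c)) c)" by (rule sum.cong) (use r(2) T'(1) in auto)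
    finally have s: "0 = (\<Sum>c\<in>T'. s2 (u (r c)) c)" .
    have "u (r c) = 0" if "c \<in> T'" for c
      by (rule b.independentD[where u = "\<lambda>c. u (r c)", OF C(2) T'(2,1) s[symmetric] that])
    then show "\<forall>b\<in>T. u b = 0" using T'(3) by blast
  qed
  moreover have "a.subspace ?W" unfolding W
    by (rule a.subspaceI) (auto simp: ev.zero ev.add ev.scale a.span_zero a.span_add a.span_scale)
  ultimately have "quotient_dim s1 ?V ?W = card ?B"
    by (intro a.quotient_dim_eq_card) auto
  also have "card ?B = card C" by (rule card_image) (metis inj_onI r(2))
  finally show ?thesis using C(4) im by simp
qed

lemma multilinear_words_iff:
  "w \<in> multilinear_words G n \<longleftrightarrow> distinct (map fst w) \<and> fst ` set w = {1..n} \<and> snd ` set w \<subseteq> carrier G"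
proof
  assume "w \<in> multilinear_words G n"
  then obtain \<sigma> g where w: "w = map (\<lambda>i. (\<sigma> i, g i)) [1..<Suc n]" "\<sigma> permutes {1..n}" "g \<in> {1..n} \<rightarrow> carrier G"
    by (auto simp: multilinear_words_def)
  have set: "set [1..<Suc n] = {1..n}" by auto
  have "map fst w = map \<sigma> [1..<Suc n]" by (simp add: w(1))
  moreover have "distinct (map \<sigma> [1..<Suc n])"
    using permutes_inj[OF w(2)] by (auto simp: distinct_map inj_on_def inj_def)
  moreover have "fst ` set w = \<sigma> ` {1..n}" by (simp only: w(1) set_map image_image set fst_conv)
  moreover have "snd ` set w \<subseteq> carrier G" using w(3) by (simp only: w(1) set_map image_image set snd_conv) auto
  ultimately show "distinct (map fst w) \<and> fst ` set w = {1..n} \<and> snd ` set w \<subseteq> carrier G"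
    using permutes_image[OF w(2)] by simp
next
  assume w: "distinct (map fst w) \<and> fst ` set w = {1..n} \<and> snd ` set w \<subseteq> carrier G"
  have len: "length w = n"
    using w distinct_card[of "map fst w"] by simp
  define \<sigma> where "\<sigma> i = (if i \<in> {1..n} then fst (w ! (i - 1)) else i)" for i
  define g where "g i = snd (w ! (i - 1))" for i
  have inj: "inj_on \<sigma> {1..n}"
  proof (rule inj_onI)
    fix i j assume ij: "i \<in> {1..n}" "j \<in> {1..n}" "\<sigma> i = \<sigma> j"
    moreover have "i - 1 < length w" "j - 1 < length w" using ij len by auto
    ultimately have "map fst w ! (i - 1) = map fst w ! (j - 1)" by (simp add: \<sigma>_def)
    then have "i - 1 = j - 1"
      using w ij len by (subst (asm) nth_eq_iff_index_eq) auto
    then show "i = j" using ij by auto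
  qed
  have "\<sigma> ` {1..n} \<subseteq> {1..n}"
  proof
    fix x assume "x \<in> \<sigma> ` {1..n}"
    then obtain i where i: "i \<in> {1..n}" "x = fst (w ! (i - 1))" by (auto simp: \<sigma>_def)
    then have "w ! (i - 1) \<in> set w" using len by (intro nth_mem) auto
    then show "x \<in> {1..n}" using w i(2) by blast
  qed
  then have "\<sigma> ` {1..n} = {1..n}" using inj by (simp add: endo_inj_surj)
  then have "\<sigma> permutes {1..n}"
    using inj by (intro bij_imp_permutes) (auto simp: bij_betw_def \<sigma>_def)
  moreover have "g \<in> {1..n} \<rightarrow> carrier G"
  proof
    fix i assume "i \<in> {1..n}"
    then have "w ! (i - 1) \<in> set w" using len by (intro nth_mem) auto
    then show "g i \<in> carrier G" using w by (auto simp: g_def)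
  qed
  moreover have "w = map (\<lambda>i. (\<sigma> i, g i)) [1..<Suc n]"
    by (rule nth_equalityI) (auto simp: len \<sigma>_def g_def simp del: upt_Suc)
  ultimately show "w \<in> multilinear_words G n" by (auto simp: multilinear_words_def)
qed

locale alg_action = alg_ops scale Basis mul "\<rho> ` carrier G"
  for scale :: "'f::{alg_closed_field, field_char_0} \<Rightarrow> 'a::ab_group_add \<Rightarrow> 'a"
    and Basis :: "'a set" and mul :: "'a \<Rightarrow> 'a \<Rightarrow> 'a" (infixl \<open>\<star>\<close> 70)
    and G :: "('g, 'm) monoid_scheme" and \<rho> :: "'g \<Rightarrow> 'a \<Rightarrow> 'a"
begin

definition letter_word :: "nat set \<Rightarrow> (nat \<times> 'g) list \<Rightarrow> bool" where
  "letter_word S w \<longleftrightarrow> w \<noteq> [] \<and> distinct (map fst w) \<and> fst ` set w = S \<and> snd ` set w \<subseteq> carrier G"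

lemma multilinear_words_letter_word:
  assumes "1 \<le> n"
  shows "multilinear_words G n = {w. letter_word {1..n} w}"
proof -
  have "w \<noteq> []" if "fst ` set w = {1..n}" for w :: "(nat \<times> 'g) list" using that assms by auto
  then show ?thesis
    unfolding set_eq_iff mem_Collect_eq multilinear_words_iff letter_word_def by blast
qed

lemma letter_word_subset:
  assumes "letter_word S w"
  shows "set w \<subseteq> G_letters G"
proof
  fix x assume "x \<in> set w"
  then have "snd x \<in> carrier G" using assms by (auto simp: letter_word_def)
  then show "x \<in> G_letters G" by (cases x) (simp add: G_letters_def)
qed

lemma letter_word_single: "letter_word S [x] \<longleftrightarrow> S = {fst x} \<and> snd x \<in> carrier G"
  by (auto simp: letter_word_def)

lemma letter_word_append:
  "letter_word S v \<Longrightarrow> letter_word T w \<Longrightarrow> S \<inter> T = {} \<Longrightarrow> letter_word (S \<union> T) (v @ w)"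
  by (auto simp: letter_word_def)

lemma letter_word_appendD:
  assumes "letter_word S (v @ w)" "v \<noteq> []" "w \<noteq> []"
  shows "letter_word (fst ` set v) v" "letter_word (fst ` set w) w"
    "fst ` set v \<inter> fst ` set w = {}" "S = fst ` set v \<union> fst ` set w"
  using assms by (auto simp: letter_word_def)

lemma ml_monomial_letter:
  assumes "snd x \<in> carrier G"
  shows "ml_monomial {fst x} (\<lambda>a. G_subst \<rho> a x)"
  using ml_monomial.var[of "\<rho> (snd x)" "fst x"] assms by (simp add: G_subst_def case_prod_beta)

lemma Ops_letter:
  assumes "g \<in> \<rho> ` carrier G"
  obtains x where "letter_word {v} [x]" "(\<lambda>a. g (a v)) = (\<lambda>a. G_subst \<rho> a x)"
proof -
  obtain h where "h \<in> carrier G" "g = \<rho> h" using assms by blast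
  then show ?thesis using that[of "(v, h)"] by (simp add: letter_word_single G_subst_def)
qed

subsection \<open>The associative case\<close>

lemma assoc_word_monomial:
  "letter_word S w \<Longrightarrow> ml_monomial S (\<lambda>a. word_val mul (G_subst \<rho> a) w)"
proof (induction w arbitrary: S)
  case (Cons x w)
  show ?case
  proof (cases w)
    case Nil
    then show ?thesis using Cons.prems ml_monomial_letter[of x] by (auto simp: letter_word_single)
  next
    case (Cons y w')
    note D = letter_word_appendD[of S "[x]" w]
    have "ml_monomial (fst ` set [x] \<union> fst ` set w) (\<lambda>a. G_subst \<rho> a x \<star> word_val mul (G_subst \<rho> a) w)"
      using Cons Cons.IH[OF D(2)] Cons.prems D ml_monomial_letter[of x]
      by (intro ml_monomial.prod) (auto simp: letter_word_def)
    then show ?thesis using D(4) Cons Cons.prems by simp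
  qed
qed (simp add: letter_word_def)

lemma assoc_monomial_word:
  assumes A: "assoc_algebra scale mul"
  shows "ml_monomial S p \<Longrightarrow> \<exists>w. letter_word S w \<and> p = (\<lambda>a. word_val mul (G_subst \<rho> a) w)"
proof (induction rule: ml_monomial.induct)
  case (var g v)
  then obtain x where "letter_word {v} [x]" "(\<lambda>a. g (a v)) = (\<lambda>a. G_subst \<rho> a x)" by (rule Ops_letter)
  then show ?case by (intro exI[of _ "[x]"]) simp
next
  case (prod S p T q)
  then obtain v w where vw: "letter_word S v" "p = (\<lambda>a. word_val mul (G_subst \<rho> a) v)"
    "letter_word T w" "q = (\<lambda>a. word_val mul (G_subst \<rho> a) w)" by blast
  have "v \<noteq> []" "w \<noteq> []" using vw by (auto simp: letter_word_def)
  then have "word_val mul (G_subst \<rho> a) (v @ w) = p a \<star> q a" for a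
    using assoc_algebra.word_val_append[OF A] vw by simp
  then show ?case using letter_word_append[OF vw(1,3) prod.hyps(3)] by (intro exI[of _ "v @ w"]) simp
qed

theorem codim_assoc_eq:
  assumes A: "assoc_algebra scale mul" and n: "1 \<le> n"
  shows "codim_assoc scale mul G \<rho> n = ml_dim n"
proof -
  define ev :: "((nat \<times> 'g) list \<Rightarrow>\<^sub>0 'f) \<Rightarrow> (nat \<Rightarrow> 'a) \<Rightarrow> 'a" where
    "ev f = (\<lambda>a. eval_assoc scale mul (G_subst \<rho> a) f)" for f
  let ?S = "(\<lambda>w. Poly_Mapping.single w (1 :: 'f)) ` multilinear_words G n"
  have lin: "Vector_Spaces.linear pm_scale fun_scale ev"
  proof -
    interpret v: Vector_Spaces.linear pm_scale scale "lin_ext scale (word_val mul \<phi>)" for \<phi> :: "nat \<times> 'g \<Rightarrow> 'a"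
      by (rule linear_lin_ext)
    interpret fs: vector_space "fun_scale :: 'f \<Rightarrow> ((nat \<Rightarrow> 'a) \<Rightarrow> 'a) \<Rightarrow> _" by (rule vector_space_fun_scale)
    show ?thesis
      by unfold_locales (auto simp: ev_def eval_assoc_def v.add v.scale fun_eq_iff)
  qed
  have sub: "pm.span ?S \<subseteq> free_assoc (G_letters G)"
  proof (rule pm.span_minimal)
    show "?S \<subseteq> free_assoc (G_letters G)"
    proof (rule image_subsetI)
      fix w assume "w \<in> multilinear_words G n"
      then have w: "letter_word {1..n} w" by (simp add: multilinear_words_letter_word[OF n])
      then have "w \<noteq> []" by (simp add: letter_word_def)
      then show "Poly_Mapping.single w (1 :: 'f) \<in> free_assoc (G_letters G)"
        using letter_word_subset[OF w] by (simp add: free_assoc_def)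
    qed
    show "pm.subspace (free_assoc (G_letters G) :: ((nat \<times> 'g) list \<Rightarrow>\<^sub>0 'f) set)"
    proof (rule pm.subspaceI)
      fix x y :: "(nat \<times> 'g) list \<Rightarrow>\<^sub>0 'f" and c
      assume "x \<in> free_assoc (G_letters G)" "y \<in> free_assoc (G_letters G)"
      then show "x + y \<in> free_assoc (G_letters G)"
        using Poly_Mapping.keys_add[of x y] unfolding free_assoc_def by blast
    next
      fix x :: "(nat \<times> 'g) list \<Rightarrow>\<^sub>0 'f" and c
      assume x: "x \<in> free_assoc (G_letters G)"
      have "Poly_Mapping.keys (pm_scale c x) \<subseteq> Poly_Mapping.keys x" by (auto simp: in_keys_iff)
      then show "pm_scale c x \<in> free_assoc (G_letters G)" using x unfolding free_assoc_def by blast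
    qed (simp add: free_assoc_def)
  qed
  have "codim_assoc scale mul G \<rho> n = vector_space.dim fun_scale (module.span fun_scale (ev ` ?S))"
    unfolding codim_assoc_def P_assoc_def
  proof (rule quotient_dim_kernel[OF _ vector_space_fun_scale lin])
    show "vector_space (pm_scale :: 'f \<Rightarrow> ((nat \<times> 'g) list \<Rightarrow>\<^sub>0 'f) \<Rightarrow> _)" by (rule pm.vector_space_axioms)
    fix f assume "f \<in> pm.span ?S"
    then show "f \<in> Id_assoc scale mul G \<rho> \<longleftrightarrow> ev f = 0" using sub by (auto simp: Id_assoc_def ev_def fun_eq_iff)
  qed
  also have "ev ` ?S = {p. ml_monomial {1..n} p}"
  proof -
    have "ev (Poly_Mapping.single w 1) = (\<lambda>a. word_val mul (G_subst \<rho> a) w)" for w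
      by (simp add: ev_def eval_assoc_def)
    then have "ev ` ?S = (\<lambda>w a. word_val mul (G_subst \<rho> a) w) ` {w. letter_word {1..n} w}"
      by (simp add: image_image multilinear_words_letter_word[OF n])
    also have "\<dots> = {p. ml_monomial {1..n} p}"
      using assoc_word_monomial assoc_monomial_word[OF A] by blast
    finally show ?thesis .
  qed
  also have "module.span fun_scale {p :: (nat \<Rightarrow> 'a) \<Rightarrow> 'a. ml_monomial {1..n} p} = {p. ml_poly {1..n} p}"
    by (rule ml_poly_span[symmetric])
  finally show ?thesis unfolding ml_dim_def .
qed

subsection \<open>The Lie case\<close>

fun left_normed :: "'a list \<Rightarrow> 'a" where
  "left_normed [] = 0"
| "left_normed (x # xs) = foldl (\<star>) x xs"

definition commutator_fun :: "(nat \<times> 'g) list \<Rightarrow> (nat \<Rightarrow> 'a) \<Rightarrow> 'a" where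
  "commutator_fun w = (\<lambda>a. left_normed (map (G_subst \<rho> a) w))"

lemma commutator_fun_snoc: "w \<noteq> [] \<Longrightarrow> commutator_fun (w @ [x]) a = commutator_fun w a \<star> G_subst \<rho> a x"
  by (cases w) (auto simp: commutator_fun_def)

lemma commutator_fun_single: "commutator_fun [x] a = G_subst \<rho> a x"
  by (simp add: commutator_fun_def)

lemma commutator_fun_monomial: "letter_word S w \<Longrightarrow> ml_monomial S (commutator_fun w)"
proof (induction w arbitrary: S rule: rev_induct)
  case (snoc x w)
  show ?case
  proof (cases "w = []")
    case True
    then show ?thesis using snoc.prems ml_monomial_letter[of x]
      by (auto simp: letter_word_single commutator_fun_def)
  next
    case False
    note D = letter_word_appendD[OF snoc.prems False]
    have "ml_monomial (fst ` set w \<union> fst ` set [x]) (\<lambda>a. commutator_fun w a \<star> G_subst \<rho> a x)"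
      using snoc.IH[OF D(1)] D(2,3) ml_monomial_letter[of x]
      by (intro ml_monomial.prod) (auto simp: letter_word_def)
    moreover have "commutator_fun (w @ [x]) = (\<lambda>a. commutator_fun w a \<star> G_subst \<rho> a x)"
      by (rule ext) (rule commutator_fun_snoc[OF False])
    ultimately show ?thesis using D(4) by simp
  qed
qed (simp add: letter_word_def)

inductive commutator_poly :: "nat set \<Rightarrow> ((nat \<Rightarrow> 'a) \<Rightarrow> 'a) \<Rightarrow> bool" for S where
  word: "letter_word S w \<Longrightarrow> commutator_poly S (commutator_fun w)"
| zero: "commutator_poly S (\<lambda>a. 0)"
| lincomb: "commutator_poly S p \<Longrightarrow> commutator_poly S q \<Longrightarrow> commutator_poly S (\<lambda>a. scale c (p a) + q a)"

lemma commutator_poly_letter: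
  assumes "commutator_poly S p" "letter_word T [x]" "S \<inter> T = {}"
  shows "commutator_poly (S \<union> T) (\<lambda>a. p a \<star> G_subst \<rho> a x)"
  using assms(1)
proof induction
  case (word w)
  have "w \<noteq> []" using word by (simp add: letter_word_def)
  then have "(\<lambda>a. commutator_fun w a \<star> G_subst \<rho> a x) = commutator_fun (w @ [x])"
    by (intro ext) (rule commutator_fun_snoc[symmetric])
  then show ?case using commutator_poly.word[OF letter_word_append[OF word assms(2,3)]] by simp
next
  case zero
  show ?case using commutator_poly.zero by (simp add: ml.zero)
next
  case (lincomb p q c)
  then show ?case using commutator_poly.lincomb by (simp add: ml.add ml.scale)
qed

text \<open>
  The identity \<open>[u, [y, z]] = [[u, y], z] - [[u, z], y]\<close> shortens the second factor.
\<close>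

lemma commutator_poly_words:
  assumes L: "lie_algebra scale mul"
  shows "letter_word T v \<Longrightarrow> letter_word S w \<Longrightarrow> S \<inter> T = {} \<Longrightarrow>
    commutator_poly (S \<union> T) (\<lambda>a. commutator_fun w a \<star> commutator_fun v a)"
proof (induction v arbitrary: w S T rule: rev_induct)
  case (snoc x v)
  show ?case
  proof (cases "v = []")
    case True
    then show ?thesis
      using commutator_poly_letter[OF commutator_poly.word[OF snoc.prems(2)], of T x] snoc.prems
      by (simp add: commutator_fun_single)
  next
    case False
    let ?V = "fst ` set v" and ?X = "fst ` set [x]"
    note D = letter_word_appendD[OF snoc.prems(1) False list.distinct(2)]
    have w: "w \<noteq> []" using snoc.prems by (simp add: letter_word_def)
    have dis: "S \<inter> ?V = {}" "S \<inter> ?X = {}" "(S \<union> ?V) \<inter> ?X = {}" "(S \<union> ?X) \<inter> ?V = {}"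
      using snoc.prems(3) D(3,4) by auto
    have x: "letter_word ?X [x]" using D(2) by simp
    have 1: "commutator_poly (S \<union> ?V \<union> ?X) (\<lambda>a. (commutator_fun w a \<star> commutator_fun v a) \<star> G_subst \<rho> a x)"
      by (rule commutator_poly_letter[OF snoc.IH[OF D(1) snoc.prems(2) dis(1)] x dis(3)])
    have 2: "commutator_poly (S \<union> ?X \<union> ?V) (\<lambda>a. commutator_fun (w @ [x]) a \<star> commutator_fun v a)"
      by (rule snoc.IH[OF D(1) letter_word_append[OF snoc.prems(2) x dis(2)] dis(4)])
    have sets: "S \<union> ?V \<union> ?X = S \<union> T" "S \<union> ?X \<union> ?V = S \<union> T" using D(4) by auto
    have jac: "u \<star> (y \<star> z) = scale (- 1) ((u \<star> z) \<star> y) + (u \<star> y) \<star> z" for u y z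
      using lie_bracket_mul[OF L, of u y z] lie_anticomm[OF L, of y "u \<star> z"] by simp
    have "(\<lambda>a. commutator_fun w a \<star> commutator_fun (v @ [x]) a) =
        (\<lambda>a. scale (- 1) (commutator_fun (w @ [x]) a \<star> commutator_fun v a) +
          (commutator_fun w a \<star> commutator_fun v a) \<star> G_subst \<rho> a x)"
      by (rule ext) (simp only: commutator_fun_snoc[OF False] commutator_fun_snoc[OF w] jac)
    then show ?thesis using commutator_poly.lincomb[OF 2[unfolded sets] 1[unfolded sets], of "- 1"] by simp
  qed
qed (simp add: letter_word_def)

lemma commutator_poly_mul:
  assumes L: "lie_algebra scale mul" and p: "commutator_poly S p" and q: "commutator_poly T q" and ST: "S \<inter> T = {}"
  shows "commutator_poly (S \<union> T) (\<lambda>a. p a \<star> q a)"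
  using p
proof induction
  case (word w)
  from q show ?case
  proof induction
    case (word v)
    then show ?case using commutator_poly_words[OF L word \<open>letter_word S w\<close> ST] by simp
  next
    case zero
    show ?case using commutator_poly.zero by (simp add: mr.zero)
  next
    case (lincomb p q c)
    then show ?case using commutator_poly.lincomb by (simp add: mr.add mr.scale)
  qed
next
  case zero
  show ?case using commutator_poly.zero by (simp add: ml.zero)
next
  case (lincomb p q c)
  then show ?case using commutator_poly.lincomb by (simp add: ml.add ml.scale)
qed

lemma ml_monomial_commutator_poly:
  assumes L: "lie_algebra scale mul"
  shows "ml_monomial S p \<Longrightarrow> commutator_poly S p"
proof (induction rule: ml_monomial.induct)
  case (var g v)
  then obtain x where x: "letter_word {v} [x]" "(\<lambda>a. g (a v)) = (\<lambda>a. G_subst \<rho> a x)" by (rule Ops_letter)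
  have "commutator_fun [x] = (\<lambda>a. G_subst \<rho> a x)" by (rule ext) (rule commutator_fun_single)
  then show ?case using commutator_poly.word[OF x(1)] x(2) by simp
next
  case (prod S p T q)
  show ?case by (rule commutator_poly_mul[OF L prod.IH prod.hyps(3)])
qed

text \<open>
  Left-normed commutators span all multilinear functions, since products of them can be
  rewritten in terms of left-normed ones.
\<close>

lemma span_commutator_fun:
  assumes L: "lie_algebra scale mul"
  shows "module.span fun_scale (commutator_fun ` {w. letter_word S w}) = {p. ml_poly S p}"
proof -
  interpret fs: vector_space "fun_scale :: 'f \<Rightarrow> ((nat \<Rightarrow> 'a) \<Rightarrow> 'a) \<Rightarrow> _" by (rule vector_space_fun_scale)
  let ?C = "commutator_fun ` {w. letter_word S w}"
  have 1: "p \<in> fs.span ?C" if "commutator_poly S p" for p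
    using that
  proof induction
    case (word w)
    then show ?case by (intro fs.span_base imageI CollectI)
  next
    case zero
    show ?case using fs.span_zero[of ?C] unfolding zero_fun_def .
  next
    case (lincomb p q c)
    show ?case using fs.span_add[OF fs.span_scale[OF lincomb.IH(1), of c] lincomb.IH(2)]
      unfolding plus_fun_def fun_scale_def[of c] .
  qed
  have "fs.span ?C \<subseteq> fs.span {p. ml_monomial S p}"
    by (rule fs.span_mono) (use commutator_fun_monomial in auto)
  moreover have "fs.span {p. ml_monomial S p} \<subseteq> fs.span ?C"
    by (rule fs.span_minimal) (use 1 ml_monomial_commutator_poly[OF L] in auto)
  ultimately show ?thesis by (simp only: ml_poly_span subset_antisym)
qed

end

lemma subspace_free_lie_on: "fl.subspace (free_lie_on X :: ('x, 'f::field) free_lie set)"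
proof (rule fl.subspaceI)
  show "(0 :: ('x, 'f) free_lie) \<in> free_lie_on X"
    unfolding free_lie_on_def zero_free_lie_def by (rule imageI) simp
  fix f g :: "('x, 'f) free_lie" assume "f \<in> free_lie_on X" "g \<in> free_lie_on X"
  then obtain p q where pq: "f = abs_free_lie p" "g = abs_free_lie q"
    "\<forall>t\<in>Poly_Mapping.keys p. gens t \<subseteq> X" "\<forall>t\<in>Poly_Mapping.keys q. gens t \<subseteq> X"
    by (auto simp: free_lie_on_def)
  have "\<forall>t\<in>Poly_Mapping.keys (p + q). gens t \<subseteq> X" using pq(3,4) Poly_Mapping.keys_add[of p q] by blast
  then show "f + g \<in> free_lie_on X" unfolding pq(1,2) plus_free_lie.abs_eq free_lie_on_def by blast
next
  fix f :: "('x, 'f) free_lie" and c assume "f \<in> free_lie_on X"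
  then obtain p where p: "f = abs_free_lie p" "\<forall>t\<in>Poly_Mapping.keys p. gens t \<subseteq> X"
    by (auto simp: free_lie_on_def)
  have "Poly_Mapping.keys (pm_scale c p) \<subseteq> Poly_Mapping.keys p" by (auto simp: in_keys_iff)
  then have "\<forall>t\<in>Poly_Mapping.keys (pm_scale c p). gens t \<subseteq> X" using p(2) by blast
  then show "fl_scale c f \<in> free_lie_on X" unfolding p(1) fl_scale.abs_eq free_lie_on_def by blast
qed

lemma keys_bilin_ext:
  "Poly_Mapping.keys (bilin_ext op p q :: 'k \<Rightarrow>\<^sub>0 'f::field) \<subseteq>
    {op s t | s t. s \<in> Poly_Mapping.keys p \<and> t \<in> Poly_Mapping.keys q}"
proof -
  have lin: "Poly_Mapping.keys (lin_ext pm_scale v r) \<subseteq> (\<Union>k\<in>Poly_Mapping.keys r. Poly_Mapping.keys (v k))"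
    for v :: "'k \<Rightarrow> 'k \<Rightarrow>\<^sub>0 'f" and r
  proof -
    have "Poly_Mapping.keys (pm_scale c x) \<subseteq> Poly_Mapping.keys x" for c and x :: "'k \<Rightarrow>\<^sub>0 'f"
      by (auto simp: in_keys_iff)
    then show ?thesis unfolding lin_ext_def by (rule_tac order_trans[OF Poly_Mapping.keys_sum]) blast
  qed
  have "Poly_Mapping.keys (bilin_ext op p q) \<subseteq>
      (\<Union>s\<in>Poly_Mapping.keys p. \<Union>t\<in>Poly_Mapping.keys q. Poly_Mapping.keys (Poly_Mapping.single (op s t) (1 :: 'f)))"
    unfolding bilin_ext_def using lin by (meson UN_mono order_trans subset_refl)
  also have "\<dots> \<subseteq> {op s t | s t. s \<in> Poly_Mapping.keys p \<and> t \<in> Poly_Mapping.keys q}" by auto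
  finally show ?thesis .
qed

lemma fl_bracket_free_lie_on:
  assumes "f \<in> free_lie_on X" "g \<in> free_lie_on X"
  shows "fl_bracket f g \<in> free_lie_on X"
proof -
  obtain p q where pq: "f = abs_free_lie p" "g = abs_free_lie q"
    "\<forall>t\<in>Poly_Mapping.keys p. gens t \<subseteq> X" "\<forall>t\<in>Poly_Mapping.keys q. gens t \<subseteq> X"
    using assms by (auto simp: free_lie_on_def)
  have "\<forall>t\<in>Poly_Mapping.keys (bilin_ext Prod p q). gens t \<subseteq> X"
    using keys_bilin_ext[of Prod p q] pq(3,4) by fastforce
  then show ?thesis unfolding pq(1,2) fl_bracket.abs_eq free_lie_on_def by blast
qed

lemma fl_gen_free_lie_on: "x \<in> X \<Longrightarrow> fl_gen x \<in> free_lie_on X"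
  unfolding fl_gen.abs_eq free_lie_on_def by (rule imageI) simp

lemma long_commutator_free_lie_on:
  assumes "w \<noteq> []" "set w \<subseteq> X"
  shows "long_commutator (map fl_gen w) \<in> free_lie_on X"
proof -
  have "foldl fl_bracket f (map fl_gen xs) \<in> free_lie_on X" if "f \<in> free_lie_on X" "set xs \<subseteq> X" for f xs
    using that by (induction xs arbitrary: f) (auto intro: fl_bracket_free_lie_on fl_gen_free_lie_on)
  then show ?thesis using assms by (cases w) (auto intro: fl_gen_free_lie_on)
qed

context alg_action
begin

lemma eval_long_commutator:
  assumes L: "lie_algebra scale mul"
  shows "eval_lie scale mul (G_subst \<rho> a) (long_commutator (map fl_gen w)) = commutator_fun w a"
proof (induction w rule: rev_induct)
  case Nil
  interpret l: Vector_Spaces.linear fl_scale scale "eval_lie scale mul (G_subst \<rho> a)"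
    by (rule lie_algebra.linear_eval_lie[OF L])
  show ?case by (simp add: commutator_fun_def l.zero)
next
  case (snoc x w)
  show ?case
  proof (cases "w = []")
    case True
    then show ?thesis by (simp add: commutator_fun_single lie_algebra.eval_lie_gen[OF L])
  next
    case False
    have step: "long_commutator (map fl_gen (w @ [x])) = fl_bracket (long_commutator (map fl_gen w)) (fl_gen x)"
      using False by (cases w) auto
    show ?thesis
      by (simp only: step lie_algebra.eval_lie_bracket[OF L] lie_algebra.eval_lie_gen[OF L] snoc.IH commutator_fun_snoc[OF False])
  qed
qed

theorem codim_lie_eq:
  assumes L: "lie_algebra scale mul" and n: "1 \<le> n"
  shows "codim_lie scale mul G \<rho> n = ml_dim n"
proof -
  define ev :: "(nat \<times> 'g, 'f) free_lie \<Rightarrow> (nat \<Rightarrow> 'a) \<Rightarrow> 'a" where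
    "ev f = (\<lambda>a. eval_lie scale mul (G_subst \<rho> a) f)" for f
  let ?S = "(\<lambda>w. long_commutator (map fl_gen w)) ` multilinear_words G n :: (nat \<times> 'g, 'f) free_lie set"
  have lin: "Vector_Spaces.linear fl_scale fun_scale ev"
  proof -
    interpret v: Vector_Spaces.linear fl_scale scale "eval_lie scale mul \<phi>" for \<phi> :: "nat \<times> 'g \<Rightarrow> 'a"
      by (rule lie_algebra.linear_eval_lie[OF L])
    interpret fs: vector_space "fun_scale :: 'f \<Rightarrow> ((nat \<Rightarrow> 'a) \<Rightarrow> 'a) \<Rightarrow> _" by (rule vector_space_fun_scale)
    show ?thesis
      by unfold_locales (auto simp: ev_def v.add v.scale fun_eq_iff)
  qed
  have sub: "fl.span ?S \<subseteq> free_lie_on (G_letters G)"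
  proof (rule fl.span_minimal[OF _ subspace_free_lie_on])
    show "?S \<subseteq> free_lie_on (G_letters G)"
    proof (rule image_subsetI)
      fix w assume "w \<in> multilinear_words G n"
      then have w: "letter_word {1..n} w" by (simp add: multilinear_words_letter_word[OF n])
      then have "w \<noteq> []" by (simp add: letter_word_def)
      then show "long_commutator (map fl_gen w) \<in> free_lie_on (G_letters G)"
        using letter_word_subset[OF w] by (rule long_commutator_free_lie_on)
    qed
  qed
  have "codim_lie scale mul G \<rho> n = vector_space.dim fun_scale (module.span fun_scale (ev ` ?S))"
    unfolding codim_lie_def P_lie_def
  proof (rule quotient_dim_kernel[OF _ vector_space_fun_scale lin])
    show "vector_space (fl_scale :: 'f \<Rightarrow> (nat \<times> 'g, 'f) free_lie \<Rightarrow> _)" by (rule fl.vector_space_axioms)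
    fix f assume "f \<in> fl.span ?S"
    then show "f \<in> Id_lie scale mul G \<rho> \<longleftrightarrow> ev f = 0" using sub by (auto simp: Id_lie_def ev_def fun_eq_iff)
  qed
  also have "ev ` ?S = commutator_fun ` {w. letter_word {1..n} w}"
  proof -
    have "ev (long_commutator (map fl_gen w)) = commutator_fun w" for w
      unfolding ev_def by (rule ext) (rule eval_long_commutator[OF L])
    then show ?thesis by (simp add: image_image multilinear_words_letter_word[OF n])
  qed
  also have "module.span fun_scale (commutator_fun ` {w. letter_word {1..n} w}) = {p. ml_poly {1..n} p}"
    by (rule span_commutator_fun[OF L])
  finally show ?thesis unfolding ml_dim_def .
qed

lemma simple_iff_G_simple: "simple \<longleftrightarrow> G_simple scale mul G \<rho>"
  by (simp add: simple_def G_simple_def G_ideal_def)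

end

lemma alg_action_of_hom:
  fixes scale :: "'f::{alg_closed_field, field_char_0} \<Rightarrow> 'a::ab_group_add \<Rightarrow> 'a"
  assumes fd: "finite_dimensional_vector_space scale Basis" and G: "group G"
    and \<rho>: "\<rho> \<in> hom G (aut_antiaut_group scale mul)"
    and alg: "assoc_algebra scale mul \<or> lie_algebra scale mul"
  shows "alg_action scale Basis mul G \<rho>"
proof -
  interpret finite_dimensional_vector_space scale Basis by (rule fd)
  interpret G: group G by (rule G)
  interpret A: group "aut_antiaut_group scale mul"
    by (rule group_aut_antiaut_group) (rule vector_space_axioms)
  interpret h: group_hom G "aut_antiaut_group scale mul" \<rho>
    by (intro group_hom.intro group_hom_axioms.intro G.group_axioms A.group_axioms \<rho>)
  interpret nonassoc_algebra scale mul
    using alg by (auto simp: assoc_algebra_def lie_algebra_def)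
  have comp: "\<rho> (g \<otimes>\<^bsub>G\<^esub> k) = \<rho> g \<circ> \<rho> k" if "g \<in> carrier G" "k \<in> carrier G" for g k
    using h.hom_mult[OF that] by (simp add: aut_antiaut_group_def)
  have one: "\<rho> \<one>\<^bsub>G\<^esub> = id" using h.hom_one by (simp add: aut_antiaut_group_def)
  have aut: "is_automorphism scale mul (\<rho> g) \<or> is_antiautomorphism scale mul (\<rho> g)" if "g \<in> carrier G" for g
    using h.hom_closed[OF that] by (simp add: aut_antiaut_group_def)
  show ?thesis
  proof (unfold_locales)
    show "(\<lambda>x. x) \<in> \<rho> ` carrier G" using one G.one_closed by (metis eq_id_iff image_eqI)
    fix g k assume "g \<in> \<rho> ` carrier G" "k \<in> \<rho> ` carrier G"
    then obtain g' k' where gk: "g' \<in> carrier G" "k' \<in> carrier G" "g = \<rho> g'" "k = \<rho> k'" by blast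
    have "g' \<otimes>\<^bsub>G\<^esub> k' \<in> carrier G" using gk by simp
    moreover have "(\<lambda>x. g (k x)) = \<rho> (g' \<otimes>\<^bsub>G\<^esub> k')" unfolding comp[OF gk(1,2)] by (simp add: gk o_def)
    ultimately show "(\<lambda>x. g (k x)) \<in> \<rho> ` carrier G" by blast
  next
    fix g assume "g \<in> \<rho> ` carrier G"
    then obtain g' where g: "g' \<in> carrier G" "g = \<rho> g'" by blast
    have "\<rho> (inv\<^bsub>G\<^esub> g') \<circ> \<rho> g' = id" "\<rho> g' \<circ> \<rho> (inv\<^bsub>G\<^esub> g') = id"
      using comp[of "inv\<^bsub>G\<^esub> g'" g'] comp[of g' "inv\<^bsub>G\<^esub> g'"] g(1) one by simp_all
    then show "\<exists>k\<in>\<rho> ` carrier G. (\<forall>x. k (g x) = x) \<and> (\<forall>x. g (k x) = x)"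
      using g G.inv_closed by (metis comp_apply id_apply imageI)
    have "Vector_Spaces.linear scale scale g"
      using aut[OF g(1)] g(2) by (auto simp: is_automorphism_def is_antiautomorphism_def)
    then interpret g: Vector_Spaces.linear scale scale g .
    show "g (x + y) = g x + g y" "g (scale c x) = scale c (g x)" for x y c
      by (rule g.add g.scale)+
    show "(\<forall>x y. g (mul x y) = mul (g x) (g y)) \<or> (\<forall>x y. g (mul x y) = mul (g y) (g x))"
      using aut[OF g(1)] g(2) by (auto simp: is_automorphism_def is_antiautomorphism_def)
  qed (rule alg)
qed

theorem theorem21:
  fixes scale :: "'f::{alg_closed_field, field_char_0} \<Rightarrow> 'a::ab_group_add \<Rightarrow> 'a"
    and Basis :: "'a set"
    and mul :: "'a \<Rightarrow> 'a \<Rightarrow> 'a"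
    and G :: "('g, 'm) monoid_scheme"
    and \<rho> :: "'g \<Rightarrow> 'a \<Rightarrow> 'a"
  assumes "finite_dimensional_vector_space scale Basis"
    and "(UNIV :: 'a set) \<noteq> {0}"
    and "group G"
    and "\<rho> \<in> hom G (aut_antiaut_group scale mul)"
  shows
    "(assoc_algebra scale mul \<longrightarrow>
       ((\<lambda>n. root n (real (codim_assoc scale mul G \<rho> n)))
          \<longlonglongrightarrow> real (vector_space.dim scale (UNIV :: 'a set))
        \<longleftrightarrow> G_simple scale mul G \<rho>)) \<and>
     (lie_algebra scale mul \<longrightarrow>
       ((\<lambda>n. root n (real (codim_lie scale mul G \<rho> n)))
          \<longlonglongrightarrow> real (vector_space.dim scale (UNIV :: 'a set))
        \<longleftrightarrow> G_simple scale mul G \<rho>))"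
proof (intro conjI impI)
  assume A: "assoc_algebra scale mul"
  interpret alg_action scale Basis mul G \<rho>
    by (rule alg_action_of_hom[OF assms(1,3,4)]) (simp add: A)
  have "\<forall>\<^sub>F n in sequentially. root n (real (codim_assoc scale mul G \<rho> n)) = root n (real (ml_dim n))"
    using eventually_ge_at_top[of 1] by eventually_elim (simp add: codim_assoc_eq[OF A])
  from tendsto_cong[OF this] show "(\<lambda>n. root n (real (codim_assoc scale mul G \<rho> n)))
      \<longlonglongrightarrow> real (vector_space.dim scale (UNIV :: 'a set)) \<longleftrightarrow> G_simple scale mul G \<rho>"
    using ml_dim_growth[OF assms(2)] by (simp only: simple_iff_G_simple)
next
  assume L: "lie_algebra scale mul"
  interpret alg_action scale Basis mul G \<rho>
    by (rule alg_action_of_hom[OF assms(1,3,4)]) (simp add: L)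
  have "\<forall>\<^sub>F n in sequentially. root n (real (codim_lie scale mul G \<rho> n)) = root n (real (ml_dim n))"
    using eventually_ge_at_top[of 1] by eventually_elim (simp add: codim_lie_eq[OF L])
  from tendsto_cong[OF this] show "(\<lambda>n. root n (real (codim_lie scale mul G \<rho> n)))
      \<longlonglongrightarrow> real (vector_space.dim scale (UNIV :: 'a set)) \<longleftrightarrow> G_simple scale mul G \<rho>"
    using ml_dim_growth[OF assms(2)] by (simp only: simple_iff_G_simple)
qed

end
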